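(* Let $K$ be an unconstrained Sierpinski carpet. There is a constant $C>0$ such that $\sigma_n\le C\cdot N^nR_n$ for all $n\ge1$.
   Context: Unconstrained Sierpinski carpets. Let $\square=[0,1]^2\subset\mathbb{R}^2$ with vertices $q_1=(0,0),q_2=(1,0),q_3=(1,1),q_4=(0,1)$, let $\overline{x,y}$ denote the line segment between $x,y$, and let $\mathscr{G}$ be the group of the eight self-isometries of $\square$. Let $k\ge 3$ and $4(k-1)\le N\le k^2-1$ be integers, and let $\{\Psi_i\}_{1\le i\le N}$ be similarities $\Psi_i(x)=\frac{x}{k}+c_i$, $c_i\in\mathbb{R}^2$, such that: (Non-overlapping) for $i\ne j$, $\Psi_i(\square)\cap\Psi_j(\square)$ is a line segment, a point, or empty; (Connectivity) $\bigcup_{i=1}^N\Psi_i(\square)$ is connected; (Symmetry) $\Gamma(\bigcup_{i=1}^N\Psi_i(\square))=\bigcup_{i=1}^N\Psi_i(\square)$ for all $\Gamma\in\mathscr{G}$; (Boundary included) $\overline{q_1,q_2}\subset\bigcup_{i=1}^N\Psi_i(\square)\subset\square$. The unique nonempty compact $K\subset\square$ with $K=\bigcup_{i=1}^N\Psi_i(K)$ is called an unconstrained Sierpinski carpet. Cell graphs. $W_0=\{\emptyset\}$, $W_n=\{1,\dots,N\}^n$, $W_*=\bigcup_{n\ge0}W_n$, $|w|=n$ for $w\in W_n$; $\Psi_w=\Psi_{w_1}\circ\cdots\circ\Psi_{w_n}$; $w\cdot w'$ is concatenation and $A\cdot B=\{w\cdot w':w\in A,w'\in B\}$, $w\cdot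 B=\{w\}\cdot B$. For $w\ne w'$ in $W_n$ write $w\stackrel{n}{\sim}w'$ if $\Psi_wK\cap\Psi_{w'}K\ne\emptyset$. $l(A)$ is the set of real functions on $A$; for $A\subset W_n$, $\mathcal{D}_{n,A}(f)=\sum_{w\stackrel{n}{\sim}w'\text{ in }A}(f(w)-f(w'))^2$ (sum over unordered pairs), $\mathcal{D}_n=\mathcal{D}_{n,W_n}$, and $[f]_A=(\#A)^{-1}\sum_{w\in A}f(w)$. Constants. For disjoint $A,B\subset W_n$, $R_n(A,B)=\max\{(\mathcal{D}_n(f))^{-1}: f\in l(W_n),\ f|_A=0,\ f|_B=1\}$ (interpreted as $+\infty$ if $B=\emptyset$). For $w\in W_*$, $\mathcal{N}_w$ is the set of $w'\in W_{|w|}$ for which there is $w''\in W_{|w|}$ with $\Psi_wK\cap\Psi_{w''}K\ne\emptyset$ and $\Psi_{w'}K\cap\Psi_{w''}K\ne\emptyset$, and $\mathcal{N}_w^c=W_{|w|}\setminus\mathcal{N}_w$. For $m\ge1$, $R_m=\inf\{R_{|w|+m}(w\cdot W_m,\mathcal{N}_w^c\cdot W_m): w\in W_*\setminus\{\emptyset\}\}$. For $m,n\ge1$ and $w\stackrel{n}{\sim}w'$ in $W_n$, $\sigma_m(w,w')=\sup\{N^m([f]_{w\cdot W_m}-[f]_{w'\cdot W_m})^2: f\in l(W_{n+m}),\ \mathcal{D}_{n+m,\{w,w'\}\cdot W_m}(f)=1\}$, and $\sigma_m=\sup\{\sigma_m(w,w'): n\ge1,\ w,w'\in W_n,\ w\stackrel{n}{\sim}w'\}$.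 *)

theory Defs
  imports "HOL-Analysis.Analysis"
begin

definition unit_square :: "(real \<times> real) set" where
  "unit_square = {0..1} \<times> {0..1}"

(* An isometry of the square is a map on the square only, represented here by a
   total function whose values outside the square are irrelevant. *)
definition square_isometries :: "(real \<times> real \<Rightarrow> real \<times> real) set" where
  "square_isometries =
     {g. g ` unit_square = unit_square \<and>
         (\<forall>x\<in>unit_square. \<forall>y\<in>unit_square. dist (g x) (g y) = dist x y)}"

definition similarity :: "nat \<Rightarrow> (nat \<Rightarrow> real \<times> real) \<Rightarrow> nat \<Rightarrow> real \<times> real \<Rightarrow> real \<times> real" where
  "similarity k c i x = x /\<^sub>R real k + c i"

definition cat :: "'a list set \<Rightarrow> 'a list set \<Rightarrow> 'a list set"  (infixr \<open>\<cdot>\<close> 75) where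
  "A \<cdot> B = {w @ w' | w w'. w \<in> A \<and> w' \<in> B}"

definition average :: "'a set \<Rightarrow> ('a \<Rightarrow> real) \<Rightarrow> real" where
  "average A f = (\<Sum>w\<in>A. f w) / real (card A)"

locale unconstrained_carpet =
  fixes k N :: nat
    and c :: "nat \<Rightarrow> real \<times> real"
    and K :: "(real \<times> real) set"
  assumes k_ge: "3 \<le> k"
    and N_ge: "4 * (k - 1) \<le> N"
    and N_le: "N \<le> k\<^sup>2 - 1"
    and non_overlapping:
      "\<And>i j. \<lbrakk>i \<in> {1..N}; j \<in> {1..N}; i \<noteq> j\<rbrakk> \<Longrightarrow>
         (\<exists>a b. similarity k c i ` unit_square \<inter> similarity k c j ` unit_square = closed_segment a b) \<or>
         (\<exists>a. similarity k c i ` unit_square \<inter> similarity k c j ` unit_square = {a}) \<or>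
         similarity k c i ` unit_square \<inter> similarity k c j ` unit_square = {}"
    and connectivity:
      "connected (\<Union>i\<in>{1..N}. similarity k c i ` unit_square)"
    and symmetry:
      "\<And>g. g \<in> square_isometries \<Longrightarrow>
         g ` (\<Union>i\<in>{1..N}. similarity k c i ` unit_square) =
             (\<Union>i\<in>{1..N}. similarity k c i ` unit_square)"
    and boundary_included:
      "closed_segment (0, 0) (1, 0) \<subseteq> (\<Union>i\<in>{1..N}. similarity k c i ` unit_square)"
      "(\<Union>i\<in>{1..N}. similarity k c i ` unit_square) \<subseteq> unit_square"
    and K_compact: "compact K"
    and K_nonempty: "K \<noteq> {}"
    and K_subset: "K \<subseteq> unit_square"
    and K_self_similar: "K = (\<Union>i\<in>{1..N}. similarity k c i ` K)"
begin

definition Psi :: "nat list \<Rightarrow> real \<times> real \<Rightarrow> real \<times> real" where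
  "Psi w = foldr (\<lambda>i g. similarity k c i \<circ> g) w id"

abbreviation cell :: "nat list \<Rightarrow> (real \<times> real) set" where
  "cell w \<equiv> Psi w ` K"

definition W :: "nat \<Rightarrow> nat list set" where
  "W n = {w. length w = n \<and> set w \<subseteq> {1..N}}"

definition W_star :: "nat list set" where
  "W_star = (\<Union>n. W n)"

definition adj :: "nat list \<Rightarrow> nat list \<Rightarrow> bool" where
  "adj w w' \<longleftrightarrow> w \<noteq> w' \<and> cell w \<inter> cell w' \<noteq> {}"

(* The factor 1/2 turns the sum over ordered pairs into one over unordered pairs.
   The level n of the graph is implicit in A \<subseteq> W n. *)
definition energy :: "nat list set \<Rightarrow> (nat list \<Rightarrow> real) \<Rightarrow> real" where
  "energy A f = (1/2) * (\<Sum>(w, w') \<in> {(w, w'). w \<in> A \<and> w' \<in> A \<and> adj w w'}. (f w - f w')\<^sup>2)"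

(* Only the values of f on W n matter, so total functions stand for l(W_n).
   Sup is the maximum of the set, which is attained; inverse 0 = \<infinity> in ennreal. *)
definition resistance :: "nat \<Rightarrow> nat list set \<Rightarrow> nat list set \<Rightarrow> ennreal" where
  "resistance n A B =
     (if B = {} then \<infinity>
      else Sup {inverse (ennreal (energy (W n) f)) | f. (\<forall>w\<in>A. f w = 0) \<and> (\<forall>w\<in>B. f w = 1)})"

definition nbhd :: "nat list \<Rightarrow> nat list set" where
  "nbhd w = {w' \<in> W (length w). \<exists>w''\<in>W (length w).
               cell w \<inter> cell w'' \<noteq> {} \<and> cell w' \<inter> cell w'' \<noteq> {}}"

definition R :: "nat \<Rightarrow> ennreal" where
  "R m = (INF w\<in>W_star - {[]}.
            resistance (length w + m) ({w} \<cdot> W m) ((W (length w) - nbhd w) \<cdot> W m))"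

definition sigma_pair :: "nat \<Rightarrow> nat list \<Rightarrow> nat list \<Rightarrow> ennreal" where
  "sigma_pair m w w' =
     Sup {ennreal (real N ^ m * (average ({w} \<cdot> W m) f - average ({w'} \<cdot> W m) f)\<^sup>2) | f.
            energy ({w, w'} \<cdot> W m) f = 1}"

definition sigma :: "nat \<Rightarrow> ennreal" where
  "sigma m = Sup {sigma_pair m w w' | n w w'. 1 \<le> n \<and> w \<in> W n \<and> w' \<in> W n \<and> adj w w'}"

end

end

theory Submission imports Defs begin

text \<open>
  Let \<open>1 / Q n\<close> be the extremal length, for vertex weights, of left-right crossings of \<open>W n\<close>. Both sides
  of the inequality are compared with it: \<open>sigma n \<le> C * N ^ n / Q n\<close> and \<open>R n \<ge> c / Q n\<close>.

  Upper bound: if a function has energy 1 on two adjacent cells, every square contains a left-right and a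
  bottom-top crossing along which it varies by at most a multiple of the square root of \<open>1 / Q\<close> at its
  level. Crossings of
  the two kinds meet by planarity, which links the crosses of nested and of touching squares, and the
  resulting sum over the levels is geometric.

  Lower bound: from crossing weights one builds, by recursion towards the boundary, weights of mass
  \<open>O (Q n)\<close> for which every path between two boundary points is at least as long as their distance. Placed on
  the cells in \<open>nbhd w\<close> they separate \<open>w\<close> from the complement of \<open>nbhd w\<close>, because squares that are not
  linked through a common neighbour have distance at least a multiple of their side.
\<close>

text \<open>The obstacle is that interior squares need not lie on a grid, so a path cannot be
  reflected from one square into the next. Only the squares along a side are forced onto the grid of
  mesh \<open>1 / k\<close>, by \<open>boundary_included\<close>, \<open>non_overlapping\<close> and
  \<open>symmetry\<close>. Every gluing and folding takes place there; the other squares are reached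
  through shared boundary points and, within one level, through chains provided by
  \<open>connectivity\<close>. Keeping the recursive weights on boundary strips is also what makes
  their recursion close. Over \<open>J\<close> further levels the copies of the old weight have mass
  at most \<open>32 / k ^ J\<close> times the old one, whereas two disjoint rows along opposite
  sides give \<open>(2 / k) ^ J * Q m \<le> Q (J + m)\<close>. Relative to \<open>Q\<close> the
  factor is \<open>32 / 2 ^ J\<close>, which is below 1 for \<open>J = 6\<close>. The same weights
  placed in all squares of a level bound \<open>Q (n + m)\<close> by a multiple of
  \<open>(N / k\<^sup>2) ^ n * Q m\<close>. As \<open>N < k\<^sup>2\<close>, this is the decay that
  makes the sums over the levels geometric.\<close>

context unconstrained_carpet begin

subsection \<open>Squares of a given level\<close>

text \<open>\<open>(px w, py w)\<close> is the lower left corner and \<open>sd (length w)\<close> the side length of the square of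
  the word \<open>w\<close>. As \<open>K\<close> contains the boundary of the unit square and squares of the same level
  have disjoint interiors, adjacency of cells amounts to contact of squares (\<open>touch\<close>).\<close>

definition sd :: "nat \<Rightarrow> real" where "sd n = 1 / real k ^ n"

primrec px :: "nat list \<Rightarrow> real" where
  "px [] = 0"
| "px (i # w) = fst (c i) + px w / real k"

primrec py :: "nat list \<Rightarrow> real" where
  "py [] = 0"
| "py (i # w) = snd (c i) + py w / real k"

definition sq :: "nat list \<Rightarrow> (real \<times> real) set" where
  "sq w = {px w..px w + sd (length w)} \<times> {py w..py w + sd (length w)}"

definition touch :: "nat list \<Rightarrow> nat list \<Rightarrow> bool" where
  "touch w v \<longleftrightarrow> \<bar>px w - px v\<bar> \<le> sd (length w) \<and> \<bar>py w - py v\<bar> \<le> sd (length w)"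

definition bd :: "(real \<times> real) set" where
  "bd = {p \<in> unit_square. fst p = 0 \<or> fst p = 1 \<or> snd p = 0 \<or> snd p = 1}"

abbreviation Idx :: "nat set" where "Idx \<equiv> {1..N}"

lemma k_pos: "0 < real k" and k_gt1: "1 < real k"
  using k_ge by auto

lemma sd_0 [simp]: "sd 0 = 1" by (simp add: sd_def)
lemma sd_Suc: "sd (Suc n) = sd n / real k" by (simp add: sd_def)
lemma sd_pos [simp]: "0 < sd n" using k_pos by (simp add: sd_def)
lemma sd_nonneg [simp]: "0 \<le> sd n" using sd_pos less_imp_le by blast
lemma sd_neq_0 [simp]: "sd n \<noteq> 0" by (metis less_irrefl sd_pos)
lemma sd_add: "sd (m + n) = sd m * sd n" by (simp add: sd_def power_add)
lemma sd_k: "sd n * real k ^ n = 1" using k_pos by (simp add: sd_def)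

lemma sd_tendsto: "sd \<longlonglongrightarrow> 0"
proof -
  have "(\<lambda>n. (1 / real k) ^ n) \<longlonglongrightarrow> 0"
    using k_gt1 by (intro LIMSEQ_power_zero) auto
  moreover have "sd = (\<lambda>n. (1 / real k) ^ n)" by (rule ext) (simp add: sd_def power_one_over)
  ultimately show ?thesis by simp
qed

lemma Psi_Nil [simp]: "Psi [] p = p" by (simp add: Psi_def)
lemma Psi_Cons: "Psi (i # w) p = similarity k c i (Psi w p)" by (simp add: Psi_def)

lemma Psi_append: "Psi (u @ v) p = Psi u (Psi v p)"
  by (induction u) (simp_all add: Psi_Cons)

lemma Psi_eq: "Psi w (a, b) = (px w + a * sd (length w), py w + b * sd (length w))"
  by (induction w)
     (simp_all add: Psi_Cons similarity_def sd_Suc prod_eq_iff add_divide_distrib divide_inverse algebra_simps)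

lemma px_append: "px (u @ v) = px u + px v * sd (length u)"
  by (induction u) (simp_all add: sd_Suc add_divide_distrib)
lemma py_append: "py (u @ v) = py u + py v * sd (length u)"
  by (induction u) (simp_all add: sd_Suc add_divide_distrib)

lemma similarity_eq: "similarity k c i (a, b) = (fst (c i) + a / real k, snd (c i) + b / real k)"
  by (simp add: similarity_def prod_eq_iff divide_inverse algebra_simps)

lemma similarity_square:
  "similarity k c i ` unit_square =
     {fst (c i)..fst (c i) + 1 / real k} \<times> {snd (c i)..snd (c i) + 1 / real k}" (is "?L = ?R")
proof
  show "?L \<subseteq> ?R"
    using k_pos by (auto simp: unit_square_def similarity_eq divide_right_mono)
  show "?R \<subseteq> ?L"
  proof
    fix p assume p: "p \<in> ?R"
    obtain a b where ab: "p = (a, b)" by force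
    have "p = similarity k c i ((a - fst (c i)) * real k, (b - snd (c i)) * real k)"
      using k_pos by (simp add: similarity_eq ab)
    moreover have "((a - fst (c i)) * real k, (b - snd (c i)) * real k) \<in> unit_square"
      using p k_pos by (auto simp: unit_square_def ab field_simps)
    ultimately show "p \<in> ?L" by blast
  qed
qed

definition U :: "(real \<times> real) set" where
  "U = (\<Union>i\<in>Idx. similarity k c i ` unit_square)"

lemma mem_U: "(a, b) \<in> U \<longleftrightarrow> (\<exists>i\<in>Idx. fst (c i) \<le> a \<and> a \<le> fst (c i) + 1 / real k \<and>
    snd (c i) \<le> b \<and> b \<le> snd (c i) + 1 / real k)"
  by (auto simp: U_def similarity_square)

lemma idx_range:
  assumes "i \<in> Idx"
  shows "0 \<le> fst (c i)" "fst (c i) + 1 / real k \<le> 1" "0 \<le> snd (c i)" "snd (c i) + 1 / real k \<le> 1"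
proof -
  have "similarity k c i ` unit_square \<subseteq> unit_square"
    using boundary_included(2) assms by blast
  hence s: "{fst (c i)..fst (c i) + 1 / real k} \<times> {snd (c i)..snd (c i) + 1 / real k} \<subseteq> unit_square"
    by (simp only: similarity_square)
  have "(fst (c i), snd (c i)) \<in> unit_square" "(fst (c i) + 1 / real k, snd (c i) + 1 / real k) \<in> unit_square"
    using k_pos by (auto intro!: subsetD[OF s] simp: mem_Times_iff)
  thus "0 \<le> fst (c i)" "fst (c i) + 1 / real k \<le> 1" "0 \<le> snd (c i)" "snd (c i) + 1 / real k \<le> 1"
    by (auto simp: unit_square_def)
qed

lemma rect_not_segment:
  fixes a a' b b' :: real
  assumes "a < a'" "b < b'" "{a..a'} \<times> {b..b'} = closed_segment p q"
  shows False
proof -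
  have "collinear (closed_segment p q)" by (rule collinear_closed_segment)
  hence "collinear ({a..a'} \<times> {b..b'})" by (simp only: assms(3))
  then obtain u where u: "\<And>x y. x \<in> {a..a'} \<times> {b..b'} \<Longrightarrow> y \<in> {a..a'} \<times> {b..b'} \<Longrightarrow> \<exists>r. x - y = r *\<^sub>R u"
    unfolding collinear_def by blast
  obtain r where r: "(a', b) - (a, b) = r *\<^sub>R u" using u[of "(a', b)" "(a, b)"] assms(1,2) by auto
  obtain r' where r': "(a, b') - (a, b) = r' *\<^sub>R u" using u[of "(a, b')" "(a, b)"] assms(1,2) by auto
  have "a' - a = r * fst u" "0 = r * snd u" "b' - b = r' * snd u"
    using arg_cong[OF r, of fst] arg_cong[OF r, of snd] arg_cong[OF r', of snd] by simp_all
  thus False using assms(1,2) by auto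
qed

text \<open>Corners closer than \<open>1 / k\<close> in both coordinates would make the intersection
  a rectangle with interior, and such a rectangle is not collinear. Every later use of
  \<open>non_overlapping\<close> goes through this inequality.\<close>

lemma idx_sep:
  assumes "i \<in> Idx" "j \<in> Idx" "i \<noteq> j"
  shows "1 / real k \<le> \<bar>fst (c i) - fst (c j)\<bar> \<or> 1 / real k \<le> \<bar>snd (c i) - snd (c j)\<bar>"
proof (rule ccontr)
  assume neg: "\<not> ?thesis"
  define a where "a = max (fst (c i)) (fst (c j))"
  define a' where "a' = min (fst (c i)) (fst (c j)) + 1 / real k"
  define b where "b = max (snd (c i)) (snd (c j))"
  define b' where "b' = min (snd (c i)) (snd (c j)) + 1 / real k"
  have lt: "a < a'" "b < b'" using neg by (auto simp: a_def a'_def b_def b'_def)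
  have I: "similarity k c i ` unit_square \<inter> similarity k c j ` unit_square = {a..a'} \<times> {b..b'}"
    unfolding similarity_square by (auto simp: a_def a'_def b_def b'_def)
  have "{a..a'} \<times> {b..b'} \<noteq> {}" using lt by auto
  moreover have "\<And>p. {a..a'} \<times> {b..b'} \<noteq> {p}"
  proof
    fix p assume e: "{a..a'} \<times> {b..b'} = {p}"
    have "(a, b) \<in> {a..a'} \<times> {b..b'}" "(a', b') \<in> {a..a'} \<times> {b..b'}" using lt by auto
    hence "(a, b) \<in> {p}" "(a', b') \<in> {p}" by (simp_all only: e)
    hence "(a, b) = (a', b')" by simp
    thus False using lt by simp
  qed
  moreover have "\<And>p q. {a..a'} \<times> {b..b'} \<noteq> closed_segment p q" by (rule notI) (erule rect_not_segment[OF lt])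
  ultimately show False
    using non_overlapping[OF assms] unfolding I by metis
qed

section \<open>Words and the positions of their squares\<close>

lemma in_W_Nil [simp]: "[] \<in> W 0" by (simp add: W_def)
lemma W_0: "W 0 = {[]}" by (auto simp: W_def)
lemma in_W_Cons: "i # w \<in> W (Suc n) \<longleftrightarrow> i \<in> Idx \<and> w \<in> W n" by (auto simp: W_def)
lemma W_SucE: assumes "w \<in> W (Suc n)" obtains i u where "w = i # u" "i \<in> Idx" "u \<in> W n"
  using assms by (cases w) (auto simp: W_def)
lemma W_length: "w \<in> W n \<Longrightarrow> length w = n" by (simp add: W_def)
lemma W_alt: "W n = {w. set w \<subseteq> Idx \<and> length w = n}" by (auto simp: W_def)
lemma finite_W [simp]: "finite (W n)" unfolding W_alt by (rule finite_lists_length_eq) simp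
lemma card_W: "card (W n) = N ^ n" unfolding W_alt by (subst card_lists_length_eq) simp_all
lemma W_append: "u \<in> W m \<Longrightarrow> v \<in> W n \<Longrightarrow> u @ v \<in> W (m + n)" by (auto simp: W_def)
lemma W_take: "w \<in> W (m + n) \<Longrightarrow> take m w \<in> W m" by (auto simp: W_def dest: in_set_takeD)
lemma W_drop: "w \<in> W (m + n) \<Longrightarrow> drop m w \<in> W n" by (auto simp: W_def dest: in_set_dropD)
lemma W_appendE: assumes "w \<in> W (m + n)" obtains u v where "w = u @ v" "u \<in> W m" "v \<in> W n"
  by (rule that[OF append_take_drop_id[symmetric] W_take[OF assms] W_drop[OF assms]])

lemma W_range:
  assumes "w \<in> W n"
  shows "0 \<le> px w" "px w + sd n \<le> 1" "0 \<le> py w" "py w + sd n \<le> 1"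
proof -
  have "0 \<le> px w \<and> px w + sd n \<le> 1 \<and> 0 \<le> py w \<and> py w + sd n \<le> 1"
    using assms
  proof (induction n arbitrary: w)
    case 0 thus ?case by (simp add: W_0)
  next
    case (Suc n)
    obtain i u where w: "w = i # u" "i \<in> Idx" "u \<in> W n" using Suc.prems by (rule W_SucE)
    note IH = Suc.IH[OF w(3)] and r = idx_range[OF w(2)]
    have "(px u + sd n) / real k \<le> 1 / real k" "(py u + sd n) / real k \<le> 1 / real k"
      using IH k_pos by (simp_all add: divide_right_mono)
    moreover have "0 \<le> px u / real k" "0 \<le> py u / real k" using IH k_pos by simp_all
    ultimately show ?case using r by (simp add: w sd_Suc add_divide_distrib)
  qed
  thus "0 \<le> px w" "px w + sd n \<le> 1" "0 \<le> py w" "py w + sd n \<le> 1" by auto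
qed

lemma W_sep:
  assumes "w \<in> W n" "v \<in> W n" "w \<noteq> v"
  shows "sd n \<le> \<bar>px w - px v\<bar> \<or> sd n \<le> \<bar>py w - py v\<bar>"
  using assms
proof (induction n arbitrary: w v)
  case 0 thus ?case by (simp add: W_0)
next
  case (Suc n)
  obtain i u where w: "w = i # u" "i \<in> Idx" "u \<in> W n" using Suc.prems(1) by (rule W_SucE)
  obtain j u' where v: "v = j # u'" "j \<in> Idx" "u' \<in> W n" using Suc.prems(2) by (rule W_SucE)
  show ?case
  proof (cases "i = j")
    case True
    hence "sd n \<le> \<bar>px u - px u'\<bar> \<or> sd n \<le> \<bar>py u - py u'\<bar>"
      using Suc.IH[OF w(3) v(3)] Suc.prems(3) w v by auto
    hence "sd n / real k \<le> \<bar>px u - px u'\<bar> / real k \<or> sd n / real k \<le> \<bar>py u - py u'\<bar> / real k"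
      using k_pos by (auto simp: divide_le_cancel)
    moreover have "\<bar>px u - px u'\<bar> / real k = \<bar>px w - px v\<bar>" "\<bar>py u - py u'\<bar> / real k = \<bar>py w - py v\<bar>"
      using True w v k_pos by (auto simp: abs_divide diff_divide_distrib[symmetric])
    ultimately show ?thesis by (simp add: sd_Suc)
  next
    case False
    have q: "0 \<le> px z / real k \<and> px z / real k + sd (Suc n) \<le> 1 / real k
       \<and> 0 \<le> py z / real k \<and> py z / real k + sd (Suc n) \<le> 1 / real k" if "z \<in> W n" for z
      using W_range[OF that] k_pos
      by (auto simp: sd_Suc add_divide_distrib[symmetric] intro!: divide_right_mono)
    show ?thesis using idx_sep[OF w(2) v(2) False] q[OF w(3)] q[OF v(3)] by (auto simp: w v)
  qed
qed

lemma W_pos_inj: "w \<in> W n \<Longrightarrow> v \<in> W n \<Longrightarrow> px w = px v \<Longrightarrow> py w = py v \<Longrightarrow> w = v"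
  using W_sep[of w n v] sd_pos[of n] by auto

lemma touch_refl [simp]: "touch w w" by (simp add: touch_def)
lemma touch_sym: "length w = length v \<Longrightarrow> touch w v \<longleftrightarrow> touch v w"
  by (auto simp: touch_def abs_minus_commute)

lemma touch_iff:
  assumes "length w = length v"
  shows "touch w v \<longleftrightarrow> sq w \<inter> sq v \<noteq> {}"
proof
  assume t: "touch w v"
  have "(max (px w) (px v), max (py w) (py v)) \<in> sq w \<inter> sq v"
    using t assms by (auto simp: touch_def sq_def)
  thus "sq w \<inter> sq v \<noteq> {}" by blast
next
  assume "sq w \<inter> sq v \<noteq> {}"
  then obtain a b where "(a, b) \<in> sq w" "(a, b) \<in> sq v" by force
  thus "touch w v" using assms by (auto simp: touch_def sq_def)
qed

lemma touchI: "length w = length v \<Longrightarrow> p \<in> sq w \<Longrightarrow> p \<in> sq v \<Longrightarrow> touch w v"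
  using touch_iff by blast

lemma touch_append: "length u = length v \<Longrightarrow> touch (t @ u) (t @ v) \<longleftrightarrow> touch u v"
  using sd_pos[of "length t"]
  by (simp add: touch_def px_append py_append sd_add left_diff_distrib[symmetric] abs_mult mult.commute)

lemma touch_Cons: "length u = length v \<Longrightarrow> touch (i # u) (i # v) \<longleftrightarrow> touch u v"
  using touch_append[of u v "[i]"] by simp

lemma Psi_sq: "Psi w ` unit_square = sq w"
proof
  show "Psi w ` unit_square \<subseteq> sq w"
    by (auto simp: unit_square_def Psi_eq sq_def mult_left_le_one_le)
  show "sq w \<subseteq> Psi w ` unit_square"
  proof
    fix p assume p: "p \<in> sq w"
    obtain a b where ab: "p = (a, b)" by force
    have "p = Psi w ((a - px w) / sd (length w), (b - py w) / sd (length w))"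
      by (simp add: Psi_eq ab)
    moreover have "((a - px w) / sd (length w), (b - py w) / sd (length w)) \<in> unit_square"
      using p by (auto simp: unit_square_def ab sq_def divide_le_eq)
    ultimately show "p \<in> Psi w ` unit_square" by blast
  qed
qed

lemma sq_append: "sq (t @ u) = Psi t ` sq u"
  unfolding Psi_sq[symmetric] by (simp add: image_image Psi_append)

lemma sq_Nil: "sq [] = unit_square" by (simp add: sq_def unit_square_def)

lemma Psi_inj: "Psi w p = Psi w q \<Longrightarrow> p = q"
  by (cases p; cases q) (simp add: Psi_eq)

lemma sq_subset: "w \<in> W n \<Longrightarrow> sq w \<subseteq> unit_square"
  using W_range[of w n] by (auto simp: sq_def unit_square_def W_length)

lemma tile_sub: "u \<in> W n \<Longrightarrow> sq (t @ u) \<subseteq> sq t"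
  unfolding sq_append using sq_subset[of u n] Psi_sq[of t] by blast

section \<open>The boundary of the unit square lies in the carpet\<close>

lemma U_reflect: "(a, b) \<in> U \<longleftrightarrow> (1 - a, b) \<in> U"
proof -
  let ?g = "\<lambda>p::real\<times>real. (1 - fst p, snd p)"
  have "?g ` unit_square \<subseteq> unit_square" by (auto simp: unit_square_def)
  moreover have "?g (?g p) = p" for p by simp
  hence "unit_square \<subseteq> ?g ` unit_square"
    using \<open>?g ` unit_square \<subseteq> unit_square\<close> image_mono[OF \<open>?g ` unit_square \<subseteq> unit_square\<close>, of ?g]
    by (simp add: image_image)
  ultimately have "?g ` unit_square = unit_square" by (rule_tac subset_antisym)
  hence "?g \<in> square_isometries"
    by (simp add: square_isometries_def dist_prod_def dist_real_def power2_commute)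
  hence eq: "?g ` U = U" unfolding U_def by (rule symmetry)
  have "(x, y) \<in> U \<Longrightarrow> (1 - x, y) \<in> U" for x y using eq imageI[of "(x, y)" U ?g] by simp
  from this[of a b] this[of "1 - a" b] show ?thesis by auto
qed

lemma U_swap: "(a, b) \<in> U \<longleftrightarrow> (b, a) \<in> U"
proof -
  have "prod.swap ` unit_square = unit_square" by (simp add: unit_square_def product_swap)
  hence "prod.swap \<in> square_isometries"
    by (simp add: square_isometries_def dist_prod_def add.commute)
  hence eq: "prod.swap ` U = U" unfolding U_def by (rule symmetry)
  have "(x, y) \<in> U \<Longrightarrow> (y, x) \<in> U" for x y using eq imageI[of "(x, y)" U prod.swap] by simp
  thus ?thesis by blast
qed

lemma bd_U: "bd \<subseteq> U"
proof
  fix p assume p: "p \<in> bd"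
  obtain a b where ab: "p = (a, b)" by force
  have bot: "(x, 0) \<in> U" if "0 \<le> x" "x \<le> 1" for x
  proof -
    have "(x, 0) \<in> closed_segment (0, 0) (1::real, 0::real)"
      unfolding in_segment using that by (intro exI[of _ x]) auto
    thus ?thesis using boundary_included(1) unfolding U_def by blast
  qed
  have left: "(0, x) \<in> U" if "0 \<le> x" "x \<le> 1" for x using bot[OF that] U_swap by blast
  have right: "(1, x) \<in> U" if "0 \<le> x" "x \<le> 1" for x using left[OF that] U_reflect[of 1 x] by simp
  have top: "(x, 1) \<in> U" if "0 \<le> x" "x \<le> 1" for x using right[OF that] U_swap by blast
  have r: "0 \<le> a" "a \<le> 1" "0 \<le> b" "b \<le> 1" and d: "a = 0 \<or> a = 1 \<or> b = 0 \<or> b = 1"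
    using p by (auto simp: ab bd_def unit_square_def)
  from d show "p \<in> U" unfolding ab using bot[OF r(1,2)] top[OF r(1,2)] left[OF r(3,4)] right[OF r(3,4)]
    by (elim disjE) simp_all
qed

text \<open>The tile lies in the unit square, so its interior cannot meet the outer boundary. This
  carries boundary points down the levels, in \<open>bd_childE\<close> and
  \<open>bd_splitE\<close>.\<close>

lemma bd_tile:
  assumes "Psi t p \<in> bd" "t \<in> W n" "p \<in> unit_square"
  shows "p \<in> bd"
proof -
  obtain a b where p: "p = (a, b)" by force
  have ab: "0 \<le> a" "a \<le> 1" "0 \<le> b" "b \<le> 1" using assms(3) by (auto simp: p unit_square_def)
  have l: "0 \<le> a * sd n" "a * sd n \<le> sd n" "0 \<le> b * sd n" "b * sd n \<le> sd n"
    using ab by (simp_all add: mult_left_le_one_le)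
  have "px t + a * sd n = 0 \<or> px t + a * sd n = 1 \<or> py t + b * sd n = 0 \<or> py t + b * sd n = 1"
    using assms(1) W_length[OF assms(2)] by (simp add: p Psi_eq bd_def)
  hence "a * sd n = 0 \<or> a * sd n = sd n \<or> b * sd n = 0 \<or> b * sd n = sd n"
    using W_range[OF assms(2)] l by linarith
  thus ?thesis using ab by (simp add: p bd_def unit_square_def)
qed

lemma bd_childE:
  assumes "p \<in> bd"
  obtains i q where "i \<in> Idx" "q \<in> bd" "p = Psi [i] q"
proof -
  have "p \<in> U" using assms bd_U by blast
  then obtain i q where iq: "i \<in> Idx" "q \<in> unit_square" "p = similarity k c i q" by (auto simp: U_def)
  hence p: "p = Psi [i] q" by (simp add: Psi_Cons)
  have "[i] \<in> W 1" using iq(1) by (simp add: W_def)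
  hence "q \<in> bd" using bd_tile[OF _ _ iq(2)] assms p by blast
  with iq(1) p that show ?thesis by blast
qed

lemma bd_cell: "p \<in> bd \<Longrightarrow> \<exists>w\<in>W n. p \<in> sq w"
proof (induction n arbitrary: p)
  case 0 thus ?case by (auto simp: W_0 sq_Nil bd_def)
next
  case (Suc n)
  obtain i q where iq: "i \<in> Idx" "q \<in> bd" "p = Psi [i] q" using Suc.prems by (rule bd_childE)
  obtain w where w: "w \<in> W n" "q \<in> sq w" using Suc.IH[OF iq(2)] by blast
  have "p \<in> sq (i # w)" using iq(3) w(2) sq_append[of "[i]" w] by simp
  thus ?case using iq(1) w(1) in_W_Cons by blast
qed

lemma Psi_K: "w \<in> W n \<Longrightarrow> Psi w ` K \<subseteq> K"
proof (induction n arbitrary: w)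
  case 0 thus ?case by (simp add: W_0)
next
  case (Suc n)
  obtain i u where w: "w = i # u" "i \<in> Idx" "u \<in> W n" using Suc.prems by (rule W_SucE)
  have "similarity k c i ` K \<subseteq> K" using K_self_similar w(2) by blast
  thus ?case using Suc.IH[OF w(3)] by (auto simp: w Psi_Cons)
qed

text \<open>A boundary point lies in squares of all levels. Each of them contains a point of
  \<open>K\<close>, the image of a fixed \<open>z\<close>, and the sides shrink to 0, so closedness
  of \<open>K\<close> suffices.\<close>

lemma bd_K: "bd \<subseteq> K"
proof
  fix p assume p: "p \<in> bd"
  obtain z where z: "z \<in> K" using K_nonempty by blast
  have "p \<in> closure K"
    unfolding closure_approachable
  proof (intro allI impI)
    fix e :: real assume e: "e > 0"
    obtain n where n: "sd n < e / 2"
      using sd_tendsto e by (metis (full_types) LIMSEQ_D abs_of_nonneg diff_zero half_gt_zero le_refl real_norm_def sd_nonneg)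
    obtain w where w: "w \<in> W n" "p \<in> sq w" using bd_cell[OF p] by blast
    have "Psi w z \<in> K" using Psi_K[OF w(1)] z by blast
    moreover have "Psi w z \<in> sq w" using z K_subset Psi_sq by blast
    hence "dist (Psi w z) p < e"
    proof -
      obtain a b a' b' where ab: "Psi w z = (a, b)" "p = (a', b')" by force
      have "\<bar>a - a'\<bar> \<le> sd n" "\<bar>b - b'\<bar> \<le> sd n"
        using \<open>Psi w z \<in> sq w\<close> w(2) by (auto simp: ab sq_def W_length[OF w(1)])
      moreover have "dist (a, b) (a', b') \<le> \<bar>a - a'\<bar> + \<bar>b - b'\<bar>"
        unfolding dist_Pair_Pair dist_real_def using sqrt_sum_squares_le_sum_abs[of "\<bar>a - a'\<bar>" "\<bar>b - b'\<bar>"] by simp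
      ultimately show ?thesis using n by (simp add: ab)
    qed
    ultimately show "\<exists>y\<in>K. dist y p < e" by blast
  qed
  thus "p \<in> K" using K_compact compact_imp_closed closure_closed by metis
qed

lemma sq_inter_bd:
  assumes "t \<in> W n" "t' \<in> W n" "t \<noteq> t'" "Psi t p \<in> sq t'" "p \<in> unit_square"
  shows "p \<in> bd"
proof -
  obtain a b where p: "p = (a, b)" by force
  have ab: "0 \<le> a" "a \<le> 1" "0 \<le> b" "b \<le> 1" using assms(5) by (auto simp: p unit_square_def)
  have l: "0 \<le> a * sd n" "a * sd n \<le> sd n" "0 \<le> b * sd n" "b * sd n \<le> sd n"
    using ab by (auto intro!: mult_left_le_one_le)
  have "px t' \<le> px t + a * sd n" "px t + a * sd n \<le> px t' + sd n"
       "py t' \<le> py t + b * sd n" "py t + b * sd n \<le> py t' + sd n"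
    using assms(4) by (auto simp: p Psi_eq sq_def W_length[OF assms(1)] W_length[OF assms(2)])
  hence "a * sd n = 0 \<or> a * sd n = sd n \<or> b * sd n = 0 \<or> b * sd n = sd n"
    using W_sep[OF assms(1,2,3)] l by linarith
  thus ?thesis using ab by (auto simp: p bd_def unit_square_def)
qed

lemma cell_inter_iff:
  assumes "w \<in> W n" "v \<in> W n"
  shows "cell w \<inter> cell v \<noteq> {} \<longleftrightarrow> touch w v"
proof
  assume "cell w \<inter> cell v \<noteq> {}"
  hence "sq w \<inter> sq v \<noteq> {}" using K_subset Psi_sq by blast
  moreover have "length w = length v" using assms by (simp add: W_length)
  ultimately show "touch w v" using touch_iff by blast
next
  assume t: "touch w v"
  show "cell w \<inter> cell v \<noteq> {}"
  proof (cases "w = v")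
    case True thus ?thesis using K_nonempty by auto
  next
    case False
    have "length w = length v" using assms by (simp add: W_length)
    then obtain z where z: "z \<in> sq w" "z \<in> sq v" using t touch_iff by blast
    obtain p where p: "z = Psi w p" "p \<in> unit_square" using z(1) Psi_sq by blast
    obtain q where q: "z = Psi v q" "q \<in> unit_square" using z(2) Psi_sq by blast
    have "p \<in> bd" using sq_inter_bd[OF assms False] z p by simp
    moreover have "q \<in> bd" using sq_inter_bd[OF assms(2,1)] False z q by metis
    ultimately show ?thesis using bd_K p q by blast
  qed
qed

lemma adj_iff: "w \<in> W n \<Longrightarrow> v \<in> W n \<Longrightarrow> adj w v \<longleftrightarrow> w \<noteq> v \<and> touch w v"
  by (simp add: adj_def cell_inter_iff)

lemma nbhd_eq:
  assumes "w \<in> W n"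
  shows "nbhd w = {w' \<in> W n. \<exists>w''\<in>W n. touch w w'' \<and> touch w' w''}"
  unfolding nbhd_def W_length[OF assms] using cell_inter_iff[OF assms] cell_inter_iff by blast

text \<open>Positions relative to \<open>w\<close> are rounded down in units of \<open>sd n\<close>.
  Words with equal rounding would be closer than \<open>sd n\<close> in both coordinates, against
  \<open>W_sep\<close>, and there are \<open>2 * r + 1\<close> possible values per
  coordinate.\<close>

lemma near_card:
  assumes "w \<in> W n"
  shows "card {v \<in> W n. \<bar>px v - px w\<bar> \<le> real r * sd n \<and> \<bar>py v - py w\<bar> \<le> real r * sd n} \<le> (2 * r + 1) ^ 2"
    (is "card ?A \<le> _")
proof -
  let ?f = "\<lambda>v. (\<lfloor>(px v - px w) / sd n\<rfloor>, \<lfloor>(py v - py w) / sd n\<rfloor>)"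
  let ?B = "{-int r..int r} \<times> {-int r..int r}"
  have "inj_on ?f ?A"
  proof (rule inj_onI)
    fix u v assume u: "u \<in> ?A" and v: "v \<in> ?A" and e: "?f u = ?f v"
    have less: "\<bar>x - y\<bar> < sd n" if "\<lfloor>(x - z) / sd n\<rfloor> = \<lfloor>(y - z) / sd n\<rfloor>" for x y z
    proof -
      have "\<bar>(x - z) / sd n - (y - z) / sd n\<bar> < 1" using that by linarith
      moreover have "(x - z) / sd n - (y - z) / sd n = (x - y) / sd n"
        by (simp add: diff_divide_distrib)
      ultimately show ?thesis by (simp add: abs_divide)
    qed
    have "\<bar>px u - px v\<bar> < sd n" "\<bar>py u - py v\<bar> < sd n" using e by (auto intro: less)
    thus "u = v" using W_sep[of u n v] u v by (metis (no_types, lifting) mem_Collect_eq not_less)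
  qed
  moreover have "?f ` ?A \<subseteq> ?B"
  proof -
    have "\<lfloor>(x - z) / sd n\<rfloor> \<in> {-int r..int r}" if "\<bar>x - z\<bar> \<le> real r * sd n" for x z
    proof -
      have "\<bar>(x - z) / sd n\<bar> \<le> real r" using that by (simp add: abs_divide divide_le_eq)
      hence "- real r \<le> (x - z) / sd n \<and> (x - z) / sd n \<le> real r" by linarith
      thus ?thesis by (auto simp: le_floor_iff floor_le_iff)
    qed
    thus ?thesis by auto
  qed
  ultimately have "card ?A \<le> card ?B" by (intro card_inj_on_le[of ?f]) auto
  also have "\<dots> = (2 * r + 1) ^ 2"
  proof -
    have "card {-int r..int r} = 2 * r + 1" by simp
    thus ?thesis by (simp add: card_cartesian_product power2_eq_square)
  qed
  finally show ?thesis .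
qed

end

subsection \<open>Symmetries and the boundary grid\<close>

text \<open>Turns the finiteness of the level-one configuration into a uniform gap. It serves both
  the uniqueness of square decompositions and the choice of \<open>eps\<close> in
  \<open>gap_const_exists\<close>.\<close>

lemma finite_pos_gap:
  fixes S :: "real set"
  assumes "finite S"
  shows "\<exists>e>0. \<forall>x\<in>S. 0 < x \<longrightarrow> e < x"
  using assms
proof induction
  case empty show ?case by (intro exI[of _ 1]) simp
next
  case (insert x S)
  then obtain e where e: "e > 0" "\<forall>x\<in>S. 0 < x \<longrightarrow> e < x" by blast
  show ?case
  proof (cases "x > 0")
    case True
    show ?thesis by (rule exI[of _ "min e (x / 2)"]) (use e True in auto)
  next
    case False
    show ?thesis by (rule exI[of _ e]) (use e False in auto)
  qed
qed

definition sqr :: "real \<Rightarrow> real \<times> real \<Rightarrow> (real \<times> real) set" where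
  "sqr s p = {fst p..fst p + s} \<times> {snd p..snd p + s}"

definition sep :: "real \<Rightarrow> (real \<times> real) set \<Rightarrow> bool" where
  "sep s P \<longleftrightarrow> (\<forall>p\<in>P. \<forall>q\<in>P. p \<noteq> q \<longrightarrow> s \<le> \<bar>fst p - fst q\<bar> \<or> s \<le> \<bar>snd p - snd q\<bar>)"

lemma sep_image:
  assumes "sep s P"
    and g: "\<And>p q. s \<le> \<bar>fst p - fst q\<bar> \<or> s \<le> \<bar>snd p - snd q\<bar> \<Longrightarrow>
      s \<le> \<bar>fst (g p) - fst (g q)\<bar> \<or> s \<le> \<bar>snd (g p) - snd (g q)\<bar>"
  shows "sep s (g ` P)"
  unfolding sep_def
proof (intro ballI impI)
  fix p q assume "p \<in> g ` P" "q \<in> g ` P" "p \<noteq> q"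
  then obtain p' q' where pq: "p = g p'" "q = g q'" "p' \<in> P" "q' \<in> P" by blast
  with \<open>p \<noteq> q\<close> have "p' \<noteq> q'" by metis
  with assms(1) pq(3,4) have "s \<le> \<bar>fst p' - fst q'\<bar> \<or> s \<le> \<bar>snd p' - snd q'\<bar>" by (simp add: sep_def)
  thus "s \<le> \<bar>fst p - fst q\<bar> \<or> s \<le> \<bar>snd p - snd q\<bar>" unfolding pq(1,2) by (rule g)
qed

text \<open>Points slightly above and to the right of the lexicographically least corner \<open>p\<close> of the
  symmetric difference can only be covered by a square with lexicographically smaller corner.\<close>

lemma lex_min_common:
  assumes s: "0 < s" and P': "finite P'" and sp: "sep s P" and sub: "(\<Union>p\<in>P. sqr s p) \<subseteq> (\<Union>p\<in>P'. sqr s p)"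
    and p: "p \<in> P"
    and least: "\<And>q. q \<in> P' \<Longrightarrow> q \<notin> P \<Longrightarrow> snd p < snd q \<or> snd p = snd q \<and> fst p \<le> fst q"
  shows "p \<in> P'"
proof (rule ccontr)
  assume np: "p \<notin> P'"
  have "finite (insert s ((\<lambda>q. fst q - fst p) ` P' \<union> (\<lambda>q. snd q - snd p) ` P'))" using P' by blast
  from finite_pos_gap[OF this] obtain e where e: "e > 0"
    "\<forall>x\<in>insert s ((\<lambda>q. fst q - fst p) ` P' \<union> (\<lambda>q. snd q - snd p) ` P'). 0 < x \<longrightarrow> e < x" by blast
  have es: "e < s" using e(2) s by simp
  have "(fst p + e, snd p + e) \<in> sqr s p" using e(1) es by (simp add: sqr_def)
  then obtain q where q: "q \<in> P'" "(fst p + e, snd p + e) \<in> sqr s q" using sub p by blast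
  have "fst q \<le> fst p + e" "snd q \<le> snd p + e" using q(2) by (simp_all add: sqr_def)
  moreover have "0 < fst q - fst p \<longrightarrow> e < fst q - fst p" "0 < snd q - snd p \<longrightarrow> e < snd q - snd p"
    using e(2) q(1) by blast+
  ultimately have "fst q \<le> fst p" "snd q \<le> snd p" by linarith+
  moreover have "fst p < fst q + s" "snd p < snd q + s" using q(2) e(1) by (auto simp: sqr_def)
  moreover have "q \<noteq> p" using q np by blast
  ultimately show False
  proof -
    have "q \<in> P"
    proof (rule ccontr)
      assume "q \<notin> P"
      from least[OF q(1) this] \<open>fst q \<le> fst p\<close> \<open>snd q \<le> snd p\<close> \<open>q \<noteq> p\<close> show False
        by (simp add: prod_eq_iff)
    qed
    with sp p \<open>q \<noteq> p\<close> have "s \<le> \<bar>fst p - fst q\<bar> \<or> s \<le> \<bar>snd p - snd q\<bar>" by (simp add: sep_def)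
    with \<open>fst q \<le> fst p\<close> \<open>snd q \<le> snd p\<close> \<open>fst p < fst q + s\<close> \<open>snd p < snd q + s\<close> show False by simp
  qed
qed

text \<open>The symmetry hypothesis speaks of the union of the squares only; uniqueness of the
  decomposition transfers it to the individual squares. The proof takes the lowest and then leftmost
  corner of the symmetric difference, which \<open>lex_min_common\<close> shows to be common after
  all.\<close>

lemma square_decomposition_unique:
  assumes s: "0 < s" and fin: "finite P" "finite P'" and sp: "sep s P" "sep s P'"
    and eq: "(\<Union>p\<in>P. sqr s p) = (\<Union>p\<in>P'. sqr s p)"
  shows "P = P'"
proof (rule ccontr)
  assume "P \<noteq> P'"
  define D where "D = (P - P') \<union> (P' - P)"
  have D: "finite D" "D \<noteq> {}" using fin \<open>P \<noteq> P'\<close> by (auto simp: D_def)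
  obtain p0 where p0: "p0 \<in> D" "\<And>q. q \<in> D \<Longrightarrow> snd p0 \<le> snd q"
    using ex_is_arg_min_if_finite[OF D, of snd] unfolding is_arg_min_linorder by blast
  define E where "E = {q \<in> D. snd q = snd p0}"
  have "p0 \<in> E" using p0 by (simp add: E_def)
  hence E: "finite E" "E \<noteq> {}" using finite_subset[OF _ D(1), of E] by (auto simp only: E_def)
  obtain p where p: "p \<in> E" "\<And>q. q \<in> E \<Longrightarrow> fst p \<le> fst q"
    using ex_is_arg_min_if_finite[OF E, of fst] unfolding is_arg_min_linorder by blast
  have least: "snd p < snd q \<or> snd p = snd q \<and> fst p \<le> fst q" if "q \<in> D" for q
  proof (cases "snd q = snd p0")
    case True
    hence "q \<in> E" using that by (simp add: E_def)
    from p(2)[OF this] p(1) True show ?thesis by (simp add: E_def)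
  next
    case False
    with p0(2)[OF that] p(1) show ?thesis by (simp add: E_def)
  qed
  have pD: "p \<in> D" using p by (simp add: E_def)
  show False
  proof (cases "p \<in> P")
    case True
    have "p \<in> P'" by (rule lex_min_common[OF s fin(2) sp(1) equalityD1[OF eq] True]) (simp add: least D_def)
    thus False using pD True by (simp add: D_def)
  next
    case False
    hence "p \<in> P'" using pD by (simp add: D_def)
    moreover from this have "p \<in> P"
      by (rule lex_min_common[OF s fin(1) sp(2) equalityD2[OF eq]]) (simp add: least D_def)
    ultimately show False using False by blast
  qed
qed

context unconstrained_carpet begin

lemma sep_c: "sep (1 / real k) (c ` Idx)"
  unfolding sep_def
proof (intro ballI impI)
  fix p q assume "p \<in> c ` Idx" "q \<in> c ` Idx" "p \<noteq> q"
  then obtain i j where ij: "p = c i" "q = c j" "i \<in> Idx" "j \<in> Idx" by blast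
  with \<open>p \<noteq> q\<close> have "i \<noteq> j" by blast
  thus "1 / real k \<le> \<bar>fst p - fst q\<bar> \<or> 1 / real k \<le> \<bar>snd p - snd q\<bar>"
    unfolding ij(1,2) by (rule idx_sep[OF ij(3,4)])
qed

lemma U_sqr: "U = (\<Union>p\<in>c ` Idx. sqr (1 / real k) p)"
  by (simp add: U_def sqr_def similarity_square)

text \<open>\<open>h\<close> is the symmetry on points and \<open>g\<close> the induced map on lower
  left corners. They differ because a reflection turns a lower left corner into a lower right one,
  hence the shift by \<open>1 / k\<close> in \<open>reflect_corner\<close>.\<close>

lemma symmetric_corner:
  assumes i: "i \<in> Idx" and U_inv: "\<And>z. z \<in> U \<longleftrightarrow> h z \<in> U"
    and m: "\<And>z p. z \<in> sqr (1 / real k) (g p) \<longleftrightarrow> h z \<in> sqr (1 / real k) p"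
    and S: "sep (1 / real k) (g ` (c ` Idx))"
  shows "\<exists>j\<in>Idx. c j = g (c i)"
proof -
  have E: "(\<Union>p\<in>c ` Idx. sqr (1 / real k) p) = (\<Union>p\<in>g ` (c ` Idx). sqr (1 / real k) p)"
  proof (rule set_eqI)
    fix z
    have "z \<in> (\<Union>p\<in>c ` Idx. sqr (1 / real k) p) \<longleftrightarrow> h z \<in> U"
      using U_inv[of z] by (simp only: U_sqr)
    also have "\<dots> \<longleftrightarrow> z \<in> (\<Union>p\<in>g ` (c ` Idx). sqr (1 / real k) p)"
      unfolding U_sqr by (simp only: UN_iff bex_simps(7) m)
    finally show "z \<in> (\<Union>p\<in>c ` Idx. sqr (1 / real k) p) \<longleftrightarrow> z \<in> (\<Union>p\<in>g ` (c ` Idx). sqr (1 / real k) p)" .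
  qed
  have "0 < 1 / real k" "finite (c ` Idx)" "finite (g ` (c ` Idx))" using k_pos by simp_all
  from square_decomposition_unique[OF this sep_c S E] have e: "c ` Idx = g ` (c ` Idx)" .
  have "g (c i) \<in> c ` Idx" by (subst e) (use i in blast)
  then obtain j where j: "g (c i) = c j" "j \<in> Idx" by (rule imageE)
  show ?thesis
  proof (rule bexI[of _ j])
    show "c j = g (c i)" by (rule j(1)[symmetric])
  qed (rule j(2))
qed

lemma reflect_corner:
  assumes "i \<in> Idx"
  shows "\<exists>j\<in>Idx. c j = (1 - 1 / real k - fst (c i), snd (c i))"
proof (rule symmetric_corner[OF assms, of "\<lambda>z. (1 - fst z, snd z)"])
  show "sep (1 / real k) ((\<lambda>p. (1 - 1 / real k - fst p, snd p)) ` (c ` Idx))"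
    by (rule sep_image[OF sep_c]) (simp add: abs_minus_commute)
  show "z \<in> U \<longleftrightarrow> (1 - fst z, snd z) \<in> U" for z using U_reflect[of "fst z" "snd z"] by simp
qed (auto simp: sqr_def)

lemma swap_corner:
  assumes "i \<in> Idx"
  shows "\<exists>j\<in>Idx. c j = (snd (c i), fst (c i))"
proof (rule symmetric_corner[OF assms, of "\<lambda>z. (snd z, fst z)"])
  show "sep (1 / real k) ((\<lambda>p. (snd p, fst p)) ` (c ` Idx))"
    by (rule sep_image[OF sep_c]) auto
  show "z \<in> U \<longleftrightarrow> (snd z, fst z) \<in> U" for z using U_swap[of "fst z" "snd z"] by simp
qed (auto simp: sqr_def)

text \<open>The numbering of the squares is arbitrary, so the mirror image of a square is found by
  its corner. Applied to every letter of a word, the choice reflects the whole square, see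
  \<open>hx_pos\<close>.\<close>

definition hxi :: "nat \<Rightarrow> nat" where
  "hxi i = (SOME j. j \<in> Idx \<and> c j = (1 - 1 / real k - fst (c i), snd (c i)))"
definition tri :: "nat \<Rightarrow> nat" where
  "tri i = (SOME j. j \<in> Idx \<and> c j = (snd (c i), fst (c i)))"

abbreviation "hx \<equiv> map hxi"
abbreviation "tr \<equiv> map tri"

lemma hxi: assumes "i \<in> Idx" shows "hxi i \<in> Idx" "c (hxi i) = (1 - 1 / real k - fst (c i), snd (c i))"
proof -
  have "\<exists>j. j \<in> Idx \<and> c j = (1 - 1 / real k - fst (c i), snd (c i))" using reflect_corner[OF assms] by blast
  from someI_ex[OF this] have "hxi i \<in> Idx \<and> c (hxi i) = (1 - 1 / real k - fst (c i), snd (c i))"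
    unfolding hxi_def .
  thus "hxi i \<in> Idx" "c (hxi i) = (1 - 1 / real k - fst (c i), snd (c i))" by blast+
qed
lemma tri: assumes "i \<in> Idx" shows "tri i \<in> Idx" "c (tri i) = (snd (c i), fst (c i))"
proof -
  have "\<exists>j. j \<in> Idx \<and> c j = (snd (c i), fst (c i))" using swap_corner[OF assms] by blast
  from someI_ex[OF this] have "tri i \<in> Idx \<and> c (tri i) = (snd (c i), fst (c i))" unfolding tri_def .
  thus "tri i \<in> Idx" "c (tri i) = (snd (c i), fst (c i))" by blast+
qed

lemma hx_W: "w \<in> W n \<Longrightarrow> hx w \<in> W n"
proof -
  assume "w \<in> W n"
  hence w: "length w = n" "set w \<subseteq> Idx" unfolding W_def by blast+
  have "set (hx w) \<subseteq> Idx" unfolding set_map using w(2) hxi(1) by blast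
  thus "hx w \<in> W n" unfolding W_def using w(1) by (simp only: mem_Collect_eq length_map)
qed
lemma tr_W: "w \<in> W n \<Longrightarrow> tr w \<in> W n"
proof -
  assume "w \<in> W n"
  hence w: "length w = n" "set w \<subseteq> Idx" unfolding W_def by blast+
  have "set (tr w) \<subseteq> Idx" unfolding set_map using w(2) tri(1) by blast
  thus "tr w \<in> W n" unfolding W_def using w(1) by (simp only: mem_Collect_eq length_map)
qed

lemma hx_pos: "w \<in> W n \<Longrightarrow> px (hx w) = 1 - sd n - px w \<and> py (hx w) = py w"
proof (induction n arbitrary: w)
  case 0 thus ?case by (simp add: W_0)
next
  case (Suc n)
  obtain i u where w: "w = i # u" "i \<in> Idx" "u \<in> W n" using Suc.prems by (rule W_SucE)
  show ?case using Suc.IH[OF w(3)] hxi(2)[OF w(2)] by (simp add: w(1) sd_Suc diff_divide_distrib)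
qed

lemma tr_pos: "w \<in> W n \<Longrightarrow> px (tr w) = py w \<and> py (tr w) = px w"
proof (induction n arbitrary: w)
  case 0 thus ?case by (simp add: W_0)
next
  case (Suc n)
  obtain i u where w: "w = i # u" "i \<in> Idx" "u \<in> W n" using Suc.prems by (rule W_SucE)
  show ?case using Suc.IH[OF w(3)] tri(2)[OF w(2)] by (simp add: w(1))
qed

lemma hx_hx: "w \<in> W n \<Longrightarrow> hx (hx w) = w"
  using hx_pos[OF hx_W, of w n] hx_pos[of w n] by (intro W_pos_inj[of _ n] hx_W) auto
lemma tr_tr: "w \<in> W n \<Longrightarrow> tr (tr w) = w"
  using tr_pos[OF tr_W, of w n] tr_pos[of w n] by (intro W_pos_inj[of _ n] tr_W) auto

lemma touch_hx: "w \<in> W n \<Longrightarrow> v \<in> W n \<Longrightarrow> touch (hx w) (hx v) \<longleftrightarrow> touch w v"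
  using hx_pos[of w n] hx_pos[of v n] by (auto simp: touch_def abs_minus_commute)
lemma touch_tr: "w \<in> W n \<Longrightarrow> v \<in> W n \<Longrightarrow> touch (tr w) (tr v) \<longleftrightarrow> touch w v"
  using tr_pos[of w n] tr_pos[of v n] by (auto simp: touch_def)

lemma bij_hx: "bij_betw hx (W n) (W n)"
  by (rule bij_betw_byWitness[where f' = hx]) (use hx_W hx_hx in auto)
lemma bij_tr: "bij_betw tr (W n) (W n)"
  by (rule bij_betw_byWitness[where f' = tr]) (use tr_W tr_tr in auto)

section \<open>The squares along a side form a regular grid\<close>

lemma bottom_cover:
  assumes "0 \<le> x" "x \<le> 1"
  shows "\<exists>i\<in>Idx. snd (c i) = 0 \<and> fst (c i) \<le> x \<and> x \<le> fst (c i) + 1 / real k"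
proof -
  have "(x, 0) \<in> U" using bd_U assms by (auto simp: bd_def unit_square_def)
  then obtain i where "i \<in> Idx" "fst (c i) \<le> x" "x \<le> fst (c i) + 1 / real k" "snd (c i) \<le> 0"
    unfolding mem_U by blast
  thus ?thesis using idx_range(3)[of i] by (intro bexI[of _ i]) simp_all
qed

text \<open>Points of the bottom side just to the right of square \<open>j\<close> must be covered
  by a bottom square that does not overlap it, hence one starting at \<open>a\<close> or later. As
  such points come arbitrarily close to \<open>a\<close>, the leftmost of these finitely many
  squares starts exactly at \<open>a\<close>.\<close>

lemma bottom_exists: "j < k \<Longrightarrow> \<exists>i\<in>Idx. c i = (real j / real k, 0)"
proof (induction j)
  case 0
  obtain i where i: "i \<in> Idx" "snd (c i) = 0" "fst (c i) \<le> 0" using bottom_cover[of 0] by auto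
  moreover have "fst (c i) = 0" using idx_range(1)[OF i(1)] i by simp
  ultimately show ?case by (intro bexI[of _ i]) (auto simp: prod_eq_iff)
next
  case (Suc j)
  then obtain i where i: "i \<in> Idx" "c i = (real j / real k, 0)" by auto
  define a where "a = real (Suc j) / real k"
  have a1: "a < 1" using Suc.prems by (simp add: a_def)
  have aj: "a = real j / real k + 1 / real k" by (simp add: a_def add_divide_distrib)
  have a0: "0 < a" using k_pos by (simp add: a_def)
  define B where "B = {l \<in> Idx. snd (c l) = 0 \<and> a \<le> fst (c l)}"
  have next_cell: "\<exists>l\<in>B. fst (c l) \<le> x" if x: "a < x" "x \<le> 1" for x
  proof -
    obtain l where l: "l \<in> Idx" "snd (c l) = 0" "fst (c l) \<le> x" "x \<le> fst (c l) + 1 / real k"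
      using bottom_cover[of x] x a0 by auto
    have "l \<noteq> i" using l x aj i by auto
    hence "1 / real k \<le> \<bar>fst (c l) - fst (c i)\<bar>" using idx_sep[OF l(1) i(1)] l(2) i(2) k_pos by auto
    hence "a \<le> fst (c l)" using l x i(2) aj by auto
    thus ?thesis using l by (auto simp: B_def)
  qed
  have "finite B" "B \<noteq> {}" using next_cell[of 1] a1 by (auto simp: B_def)
  then obtain l where l: "l \<in> B" "\<And>q. q \<in> B \<Longrightarrow> fst (c l) \<le> fst (c q)"
    using ex_is_arg_min_if_finite[of B "\<lambda>l. fst (c l)"] unfolding is_arg_min_linorder by blast
  have "fst (c l) = a"
  proof (rule ccontr)
    assume "fst (c l) \<noteq> a"
    hence g: "a < fst (c l)" using l(1) by (auto simp: B_def)
    have "0 < 1 / real k" using k_pos by simp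
    moreover have "l \<in> Idx" using l(1) by (simp add: B_def)
    ultimately have "fst (c l) \<le> 1" using idx_range(2)[of l] by linarith
    then obtain q where "q \<in> B" "fst (c q) \<le> (a + fst (c l)) / 2" using next_cell[of "(a + fst (c l)) / 2"] g by auto
    with l(2)[of q] g show False by simp
  qed
  moreover have "l \<in> Idx" "snd (c l) = 0" using l(1) by (simp_all add: B_def)
  ultimately show ?case unfolding a_def by (intro bexI[of _ l]) (simp_all add: prod_eq_iff)
qed

text \<open>The top row is reached from the bottom row by symmetries: \<open>tri\<close> leads to
  the left column, \<open>hxi\<close> to the right column and \<open>tri\<close> again to the
  top.\<close>

lemma row_exists:
  assumes "j < k" "y0 = 0 \<or> y0 = 1 - 1 / real k"
  shows "\<exists>i\<in>Idx. c i = (real j / real k, y0)"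
proof -
  obtain i where i: "i \<in> Idx" "c i = (real j / real k, 0)" using bottom_exists[OF assms(1)] by blast
  have t: "tri i \<in> Idx" "c (tri i) = (0, real j / real k)" using tri[OF i(1)] i(2) by auto
  have h: "hxi (tri i) \<in> Idx" "c (hxi (tri i)) = (1 - 1 / real k, real j / real k)" using hxi[OF t(1)] t(2) by auto
  have "tri (hxi (tri i)) \<in> Idx" "c (tri (hxi (tri i))) = (real j / real k, 1 - 1 / real k)"
    using tri[OF h(1)] h(2) by auto
  thus ?thesis using i assms(2) by blast
qed

text \<open>The grid squares of \<open>row_exists\<close> leave no room: the one in the column
  obtained by rounding down the position of \<open>i\<close> would overlap \<open>i\<close> unless
  they coincide.\<close>

lemma row_grid:
  assumes i: "i \<in> Idx" and y0: "snd (c i) = y0" "y0 = 0 \<or> y0 = 1 - 1 / real k"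
  shows "\<exists>j<k. c i = (real j / real k, y0)"
proof -
  define j where "j = nat \<lfloor>fst (c i) * real k\<rfloor>"
  have "0 \<le> fst (c i) * real k" using idx_range(1)[OF i] by simp
  hence j: "real j \<le> fst (c i) * real k" "fst (c i) * real k < real j + 1"
    unfolding j_def by linarith+
  have "(fst (c i) + 1 / real k) * real k \<le> 1 * real k" using idx_range(2)[OF i] k_pos by (intro mult_right_mono) auto
  hence "fst (c i) * real k + 1 \<le> real k" using k_pos by (simp add: distrib_right)
  hence "j < k" using j by linarith
  obtain l where l: "l \<in> Idx" "c l = (real j / real k, y0)" using row_exists[OF \<open>j < k\<close> y0(2)] by blast
  have "real j / real k \<le> fst (c i)" "fst (c i) < (real j + 1) / real k"
    using j k_pos by (simp_all add: pos_divide_le_eq pos_less_divide_eq)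
  hence x: "\<bar>fst (c i) - fst (c l)\<bar> < 1 / real k" by (simp add: l(2) add_divide_distrib)
  have "\<bar>snd (c i) - snd (c l)\<bar> < 1 / real k" using y0(1) k_pos by (simp add: l(2))
  with x have "i = l" using idx_sep[OF i l(1)] by (meson not_le)
  thus ?thesis using l \<open>j < k\<close> by blast
qed

subsection \<open>Crossings and their modulus\<close>

text \<open>Since \<open>touch\<close> is reflexive, consecutive words may coincide. Accordingly
  \<open>len\<close> sums the weights over visits, with multiplicity.\<close>

definition gpath :: "nat \<Rightarrow> nat list list \<Rightarrow> bool" where
  "gpath n vs \<longleftrightarrow> vs \<noteq> [] \<and> set vs \<subseteq> W n \<and> successively touch vs"

definition LR :: "nat \<Rightarrow> nat list list \<Rightarrow> bool" where
  "LR n vs \<longleftrightarrow> gpath n vs \<and> px (hd vs) = 0 \<and> px (last vs) + sd n = 1"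

definition BT :: "nat \<Rightarrow> nat list list \<Rightarrow> bool" where
  "BT n vs \<longleftrightarrow> gpath n vs \<and> py (hd vs) = 0 \<and> py (last vs) + sd n = 1"

definition len :: "(nat list \<Rightarrow> real) \<Rightarrow> nat list list \<Rightarrow> real" where
  "len wt vs = sum_list (map wt vs)"

lemma len_simps [simp]: "len wt [] = 0" "len wt (v # vs) = wt v + len wt vs"
  "len wt (us @ vs) = len wt us + len wt vs" "len wt (rev vs) = len wt vs"
  by (simp_all add: len_def rev_map[symmetric])

lemma len_map: "len wt (map f vs) = len (\<lambda>v. wt (f v)) vs" by (simp add: len_def o_def)

lemma len_mono: "(\<And>v. v \<in> set vs \<Longrightarrow> wt v \<le> wt' v) \<Longrightarrow> len wt vs \<le> len wt' vs"
  unfolding len_def by (rule sum_list_mono)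

lemma len_cong: "(\<And>v. v \<in> set vs \<Longrightarrow> wt v = wt' v) \<Longrightarrow> len wt vs = len wt' vs"
  unfolding len_def by (metis map_cong)

lemma len_nonneg: "(\<And>v. v \<in> set vs \<Longrightarrow> 0 \<le> wt v) \<Longrightarrow> 0 \<le> len wt vs"
  unfolding len_def by (rule sum_list_nonneg) auto

lemma len_ge_member: "(\<And>v. v \<in> set vs \<Longrightarrow> 0 \<le> wt v) \<Longrightarrow> v \<in> set vs \<Longrightarrow> wt v \<le> len wt vs"
  unfolding len_def by (rule member_le_sum_list) auto

lemma len_scale: "len (\<lambda>v. r * wt v) vs = r * len wt vs"
  by (simp add: len_def sum_list_const_mult)

lemma len_sum: "finite A \<Longrightarrow> len (\<lambda>v. \<Sum>j\<in>A. wt j v) vs = (\<Sum>j\<in>A. len (wt j) vs)"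
  by (induction vs) (simp_all add: sum.distrib)

lemma gpath_ne: "gpath n vs \<Longrightarrow> vs \<noteq> []" by (simp add: gpath_def)
lemma gpath_W: "gpath n vs \<Longrightarrow> v \<in> set vs \<Longrightarrow> v \<in> W n" by (auto simp: gpath_def)
lemma gpath_hd: "gpath n vs \<Longrightarrow> hd vs \<in> W n" by (auto simp: gpath_def)
lemma gpath_last: "gpath n vs \<Longrightarrow> last vs \<in> W n" by (auto simp: gpath_def)

lemma gpath_single: "v \<in> W n \<Longrightarrow> gpath n [v]" by (simp add: gpath_def)

lemma gpath_append_iff:
  assumes "us \<noteq> []" "vs \<noteq> []"
  shows "gpath n (us @ vs) \<longleftrightarrow> gpath n us \<and> gpath n vs \<and> touch (last us) (hd vs)"
  using assms by (auto simp: gpath_def successively_append_iff)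

lemma touch_symW: "u \<in> W n \<Longrightarrow> v \<in> W n \<Longrightarrow> touch u v \<Longrightarrow> touch v u"
  using touch_sym[of u v] W_length[of u n] W_length[of v n] by simp

lemma touch_iffW: "u \<in> W n \<Longrightarrow> v \<in> W n \<Longrightarrow> touch u v \<longleftrightarrow> sq u \<inter> sq v \<noteq> {}"
  using touch_iff[of u v] W_length[of u n] W_length[of v n] by simp

lemma touchW: "u \<in> W n \<Longrightarrow> v \<in> W n \<Longrightarrow> p \<in> sq u \<Longrightarrow> p \<in> sq v \<Longrightarrow> touch u v"
  using touch_iffW by blast

lemma gpath_map:
  assumes "gpath n vs" "\<And>u. u \<in> W n \<Longrightarrow> f u \<in> W m"
    "\<And>u v. u \<in> W n \<Longrightarrow> v \<in> W n \<Longrightarrow> touch u v \<Longrightarrow> touch (f u) (f v)"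
  shows "gpath m (map f vs)"
proof -
  have "successively (\<lambda>x y. touch (f x) (f y)) vs"
    by (rule successively_mono[of touch]) (use assms(1,3) in \<open>auto simp: gpath_def\<close>)
  moreover have "set (map f vs) \<subseteq> W m" using assms(1,2) by (auto simp: gpath_def)
  ultimately show ?thesis using assms(1) by (simp add: gpath_def successively_map)
qed

lemma gpath_rev:
  assumes "gpath n vs" shows "gpath n (rev vs)"
proof -
  have "successively (\<lambda>x y. touch y x) vs"
    by (rule successively_mono[of touch]) (use assms touch_symW in \<open>auto simp: gpath_def\<close>)
  thus ?thesis using assms by (simp add: gpath_def)
qed

lemma gpath_tr: "gpath n vs \<Longrightarrow> gpath n (map tr vs)"
  by (rule gpath_map[of n]) (simp_all add: tr_W touch_tr)

lemma LR_tr: "LR n vs \<Longrightarrow> BT n (map tr vs)"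
  using tr_pos[OF gpath_hd, of n vs] tr_pos[OF gpath_last, of n vs] gpath_ne[of n vs] gpath_tr[of n vs]
  by (simp add: LR_def BT_def hd_map last_map)
lemma BT_tr: "BT n vs \<Longrightarrow> LR n (map tr vs)"
  using tr_pos[OF gpath_hd, of n vs] tr_pos[OF gpath_last, of n vs] gpath_ne[of n vs] gpath_tr[of n vs]
  by (simp add: LR_def BT_def hd_map last_map)

lemma path_connected_gpath:
  "successively touch vs \<Longrightarrow> set vs \<subseteq> W n \<Longrightarrow> path_connected (\<Union>v\<in>set vs. sq v)"
proof (induction vs)
  case Nil thus ?case by simp
next
  case (Cons v vs)
  have pc: "path_connected (sq v)" unfolding sq_def
    by (intro convex_imp_path_connected convex_Times convex_real_interval)
  show ?case
  proof (cases vs)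
    case Nil thus ?thesis using pc by simp
  next
    case (Cons u us)
    have "touch v u" using Cons.prems Cons by simp
    hence "sq v \<inter> sq u \<noteq> {}" using touch_iffW[of v n u] Cons.prems(2) Cons by simp
    hence "sq v \<inter> (\<Union>v\<in>set vs. sq v) \<noteq> {}" using Cons by auto
    moreover have "path_connected (\<Union>v\<in>set vs. sq v)"
      using Cons.IH Cons.prems Cons by (simp add: successively_Cons)
    ultimately show ?thesis using path_connected_Un[OF pc] by simp
  qed
qed

text \<open>The union of the squares along a path is path connected, so the two chains contain
  curves joining opposite sides of the unit square. These intersect by the Fashoda theorem, and
  squares of the two chains containing the intersection point touch.\<close>

lemma crossing:
  assumes \<alpha>: "LR n \<alpha>" and \<beta>: "BT n \<beta>"
  shows "\<exists>u\<in>set \<alpha>. \<exists>v\<in>set \<beta>. touch u v"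
proof -
  let ?A = "\<Union>v\<in>set \<alpha>. sq v" and ?B = "\<Union>v\<in>set \<beta>. sq v"
  have g: "gpath n \<alpha>" "gpath n \<beta>" using \<alpha> \<beta> by (auto simp: LR_def BT_def)
  have h: "hd \<alpha> \<in> set \<alpha>" "last \<alpha> \<in> set \<alpha>" "hd \<beta> \<in> set \<beta>" "last \<beta> \<in> set \<beta>" using g gpath_ne by auto
  have hW: "hd \<alpha> \<in> W n" "last \<alpha> \<in> W n" "hd \<beta> \<in> W n" "last \<beta> \<in> W n" using g gpath_hd gpath_last by auto
  have pc: "path_connected ?A" "path_connected ?B"
    using path_connected_gpath g unfolding gpath_def by blast+
  have sub: "?A \<subseteq> unit_square" "?B \<subseteq> unit_square"
    using sq_subset gpath_W[OF g(1)] gpath_W[OF g(2)] by blast+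
  have le: "px (last \<alpha>) \<le> 1" "py (last \<beta>) \<le> 1"
    using W_range(2)[OF hW(2)] W_range(4)[OF hW(4)] sd_nonneg[of n] by linarith+
  have "(0, py (hd \<alpha>)) \<in> sq (hd \<alpha>)" "(1, py (last \<alpha>)) \<in> sq (last \<alpha>)"
       "(px (hd \<beta>), 0) \<in> sq (hd \<beta>)" "(px (last \<beta>), 1) \<in> sq (last \<beta>)"
    using \<alpha> \<beta> W_length[OF hW(1)] W_length[OF hW(2)] W_length[OF hW(3)] W_length[OF hW(4)]
      le unfolding LR_def BT_def sq_def by simp_all
  hence m: "(0, py (hd \<alpha>)) \<in> ?A" "(1, py (last \<alpha>)) \<in> ?A" "(px (hd \<beta>), 0) \<in> ?B" "(px (last \<beta>), 1) \<in> ?B"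
    using h by blast+
  obtain f where f: "path f" "path_image f \<subseteq> ?A" "pathstart f = (0, py (hd \<alpha>))" "pathfinish f = (1, py (last \<alpha>))"
    using pc(1) m(1,2) unfolding path_connected_def by blast
  obtain g where g': "path g" "path_image g \<subseteq> ?B" "pathstart g = (px (hd \<beta>), 0)" "pathfinish g = (px (last \<beta>), 1)"
    using pc(2) m(3,4) unfolding path_connected_def by blast
  \<comment> \<open>\<open>fashoda\<close> is a theorem about \<open>real^2\<close>, hence the
    transport of both curves along \<open>phi\<close>.\<close>
  define phi :: "real \<times> real \<Rightarrow> real^2" where "phi p = (\<chi> i. if i = 1 then fst p else snd p)" for p
  have phi: "phi p $ 1 = fst p" "phi p $ 2 = snd p" for p by (simp_all add: phi_def)
  have cont: "continuous_on S phi" for S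
  proof -
    have "continuous_on S (\<lambda>p::real\<times>real. if i = 1 then fst p else snd p)" for i :: 2
      by (cases "i = 1") (simp_all add: continuous_on_fst continuous_on_snd)
    thus ?thesis unfolding phi_def[abs_def] by (intro continuous_on_vec_lambda)
  qed
  have box: "phi ` unit_square \<subseteq> cbox 0 1"
    by (auto simp: mem_box_cart forall_2 phi unit_square_def)
  obtain z where z: "z \<in> path_image (phi \<circ> f)" "z \<in> path_image (phi \<circ> g)"
  proof (rule fashoda[of "phi \<circ> f" "phi \<circ> g" 0 1])
    show "path (phi \<circ> f)" by (rule path_continuous_image[OF f(1) cont])
    show "path (phi \<circ> g)" by (rule path_continuous_image[OF g'(1) cont])
    have "path_image f \<subseteq> unit_square" "path_image g \<subseteq> unit_square"
      using subset_trans[OF f(2) sub(1)] subset_trans[OF g'(2) sub(2)] .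
    from this[THEN image_mono, THEN subset_trans, OF box]
    show "path_image (phi \<circ> f) \<subseteq> cbox 0 1" "path_image (phi \<circ> g) \<subseteq> cbox 0 1"
      unfolding path_image_compose .
    show "pathstart (phi \<circ> f) $ 1 = 0 $ 1" "pathfinish (phi \<circ> f) $ 1 = 1 $ 1"
      "pathstart (phi \<circ> g) $ 2 = 0 $ 2" "pathfinish (phi \<circ> g) $ 2 = 1 $ 2"
      unfolding pathstart_compose pathfinish_compose f(3,4) g'(3,4) phi by simp_all
  qed (rule that)
  obtain p where p: "z = phi p" "p \<in> path_image f" using z(1) unfolding path_image_compose by (rule imageE)
  obtain q where q: "z = phi q" "q \<in> path_image g" using z(2) unfolding path_image_compose by (rule imageE)
  have "fst p = fst q" "snd p = snd q" by (simp_all only: phi[symmetric] p(1)[symmetric] q(1)[symmetric])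
  hence "p = q" by (rule prod_eqI)
  have "p \<in> ?A" by (rule subsetD[OF f(2) p(2)])
  then obtain u where u: "u \<in> set \<alpha>" "p \<in> sq u" by (rule UN_E)
  have "p \<in> ?B" unfolding \<open>p = q\<close> by (rule subsetD[OF g'(2) q(2)])
  then obtain v where v: "v \<in> set \<beta>" "p \<in> sq v" by (rule UN_E)
  have uv: "u \<in> set \<alpha>" "v \<in> set \<beta>" "p \<in> sq u" "p \<in> sq v" using u v by simp_all
  hence "touch u v" using touchW[OF gpath_W[OF g(1) uv(1)] gpath_W[OF g(2) uv(2)]] by blast
  thus ?thesis using uv by blast
qed

section \<open>The vertex modulus of crossings\<close>

definition admissible :: "nat \<Rightarrow> (nat list \<Rightarrow> real) \<Rightarrow> bool" where
  "admissible n wt \<longleftrightarrow> (\<forall>v. 0 \<le> wt v) \<and> (\<forall>vs. LR n vs \<longrightarrow> 1 \<le> len wt vs)"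

definition mass :: "nat \<Rightarrow> (nat list \<Rightarrow> real) \<Rightarrow> real" where
  "mass n wt = (\<Sum>v\<in>W n. (wt v)\<^sup>2)"

text \<open>\<open>Q n\<close> is the vertex modulus of left-right crossings, comparable to their effective conductance.
  Vertex weights, unlike functions, need no matching across the interfaces of squares that are not aligned.\<close>

definition Q :: "nat \<Rightarrow> real" where
  "Q n = Inf {mass n wt | wt. admissible n wt}"

lemma mass_nonneg: "0 \<le> mass n wt" by (simp add: mass_def sum_nonneg)

lemma admissible_1: "admissible n (\<lambda>_. 1)"
proof -
  have "1 \<le> len (\<lambda>_. 1) vs" if "LR n vs" for vs
  proof -
    have "hd vs \<in> set vs" using that gpath_ne[of n vs] by (simp add: LR_def)
    thus ?thesis using len_ge_member[of vs "\<lambda>_. 1" "hd vs"] by simp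
  qed
  thus ?thesis by (simp add: admissible_def)
qed

lemma Q_le: "admissible n wt \<Longrightarrow> Q n \<le> mass n wt"
  unfolding Q_def by (rule cInf_lower) (auto intro!: bdd_belowI[of _ 0] mass_nonneg)

lemma Q_ge: "(\<And>wt. admissible n wt \<Longrightarrow> x \<le> mass n wt) \<Longrightarrow> x \<le> Q n"
  unfolding Q_def by (rule cInf_greatest) (use admissible_1 in blast)+

lemma Q_near:
  assumes "Q n < x" shows "\<exists>wt. admissible n wt \<and> mass n wt < x"
  using Q_ge[of n x] assms by (meson not_le)

text \<open>Length is linear and mass quadratic in the weight, so without a short crossing
  \<open>wt / t\<close> would be admissible with mass below \<open>Q n\<close>. All short crossings
  in the sequel come from this scaling.\<close>

lemma LR_short:
  assumes "\<And>v. 0 \<le> wt v" "0 < t" "mass n wt < t\<^sup>2 * Q n"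
  shows "\<exists>vs. LR n vs \<and> len wt vs < t"
proof (rule ccontr)
  assume neg: "\<not> ?thesis"
  have "admissible n (\<lambda>v. (1 / t) * wt v)"
    unfolding admissible_def len_scale using neg assms(1,2) by (auto simp: not_less)
  from Q_le[OF this] have "Q n \<le> mass n (\<lambda>v. (1 / t) * wt v)" .
  also have "\<dots> = mass n wt / t\<^sup>2"
    by (simp add: mass_def power_mult_distrib power_divide sum_divide_distrib)
  finally have "t\<^sup>2 * Q n \<le> mass n wt" using assms(2) by (simp add: field_simps)
  with assms(3) show False by simp
qed

lemma mass_tr: "mass n (\<lambda>v. wt (tr v)) = mass n wt"
  unfolding mass_def by (rule sum.reindex_bij_betw[OF bij_tr])
lemma mass_hx: "mass n (\<lambda>v. wt (hx v)) = mass n wt"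
  unfolding mass_def by (rule sum.reindex_bij_betw[OF bij_hx])

lemma BT_short:
  assumes "\<And>v. 0 \<le> wt v" "0 < t" "mass n wt < t\<^sup>2 * Q n"
  shows "\<exists>vs. BT n vs \<and> len wt vs < t"
proof -
  obtain vs where "LR n vs" "len (\<lambda>v. wt (tr v)) vs < t"
    using LR_short[of "\<lambda>v. wt (tr v)" t n] assms by (auto simp: mass_tr)
  thus ?thesis using LR_tr[of n vs] by (auto simp: len_map)
qed

lemma Q_0: "Q 0 = 1"
proof (rule antisym)
  show "Q 0 \<le> 1" using Q_le[OF admissible_1, of 0] by (simp add: mass_def W_0)
  have "LR 0 [[]]" by (simp add: LR_def gpath_def)
  hence "1 \<le> mass 0 wt" if "admissible 0 wt" for wt
    using that by (auto simp: admissible_def mass_def W_0 intro!: one_le_power dest: spec[of _ "[[]]"])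
  thus "1 \<le> Q 0" by (rule Q_ge)
qed

lemma mass_append: "mass (m + n) wt = (\<Sum>t\<in>W m. mass n (\<lambda>u. wt (t @ u)))"
proof -
  have "bij_betw (\<lambda>(t, u). t @ u) (W m \<times> W n) (W (m + n))"
  proof (rule bij_betw_byWitness[where f' = "\<lambda>w. (take m w, drop m w)"])
    show "\<forall>a\<in>W m \<times> W n. (take m ((\<lambda>(t, u). t @ u) a), drop m ((\<lambda>(t, u). t @ u) a)) = a"
      by (simp add: W_def split_beta)
    show "\<forall>a'\<in>W (m + n). (\<lambda>(t, u). t @ u) (take m a', drop m a') = a'" by simp
    show "(\<lambda>(t, u). t @ u) ` (W m \<times> W n) \<subseteq> W (m + n)" using W_append by (simp add: image_subset_iff)
    show "(\<lambda>w. (take m w, drop m w)) ` W (m + n) \<subseteq> W m \<times> W n"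
      using W_take W_drop by (simp add: image_subset_iff)
  qed
  from sum.reindex_bij_betw[OF this, of "\<lambda>w. (wt w)\<^sup>2"] show ?thesis
    unfolding mass_def by (simp add: sum.cartesian_product split_beta)
qed

lemma W_1: "W 1 = (\<lambda>i. [i]) ` Idx"
  by (auto simp: W_def length_Suc_conv)

lemma mass_Suc: "mass (Suc n) wt = (\<Sum>i\<in>Idx. mass n (\<lambda>u. wt (i # u)))"
proof -
  have "mass (1 + n) wt = (\<Sum>t\<in>(\<lambda>i. [i]) ` Idx. mass n (\<lambda>u. wt (t @ u)))"
    unfolding mass_append W_1 ..
  also have "\<dots> = (\<Sum>i\<in>Idx. mass n (\<lambda>u. wt (i # u)))"
    by (subst sum.reindex) (simp_all add: inj_on_def)
  finally show ?thesis by simp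
qed

lemma idx_inj: "i \<in> Idx \<Longrightarrow> j \<in> Idx \<Longrightarrow> c i = c j \<Longrightarrow> i = j"
  using idx_sep[of i j] k_pos by force

text \<open>The squares in a boundary row are aligned, so a crossing of one square, alternately reflected,
  continues through the whole row. It is chosen short for the sum \<open>\<Omega>\<close> of the folded weights.\<close>

lemma row_path:
  assumes y0: "y0 = 0 \<or> y0 = 1 - 1 / real k" and nn: "\<And>v. 0 \<le> wt v" and t: "0 < t"
    and small: "real k * (\<Sum>i | i \<in> Idx \<and> snd (c i) = y0. mass n (\<lambda>u. wt (i # u))) < t\<^sup>2 * Q n"
  shows "\<exists>\<gamma>. LR (Suc n) \<gamma> \<and> len wt \<gamma> < t \<and>
    (\<forall>i\<in>Idx. snd (c i) = y0 \<longrightarrow> (\<exists>\<gamma>'. LR n \<gamma>' \<and> (#) i ` set \<gamma>' \<subseteq> set \<gamma>))"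
proof -
  let ?R = "{i. i \<in> Idx \<and> snd (c i) = y0}"
  have "\<forall>j. \<exists>i. j < k \<longrightarrow> i \<in> Idx \<and> c i = (real j / real k, y0)" using row_exists[OF _ y0] by blast
  from choice[OF this] obtain r where r0: "\<forall>j. j < k \<longrightarrow> r j \<in> Idx \<and> c (r j) = (real j / real k, y0)" ..
  have r: "r j \<in> Idx" "c (r j) = (real j / real k, y0)" if "j < k" for j
    using r0[rule_format, OF that] by blast+
  have bij: "bij_betw r {..<k} ?R"
    unfolding bij_betw_def
  proof
    show "inj_on r {..<k}"
    proof (rule inj_onI)
      fix i j assume ij: "i \<in> {..<k}" "j \<in> {..<k}" "r i = r j"
      hence lt: "i < k" "j < k" by simp_all
      have "(real i / real k, y0) = c (r i)" by (rule r(2)[OF lt(1), symmetric])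
      also have "\<dots> = c (r j)" by (simp only: ij(3))
      also have "\<dots> = (real j / real k, y0)" by (rule r(2)[OF lt(2)])
      finally show "i = j" using k_pos by simp
    qed
    show "r ` {..<k} = ?R"
    proof
      show "r ` {..<k} \<subseteq> ?R"
      proof
        fix i assume "i \<in> r ` {..<k}"
        then obtain j where j: "j < k" "i = r j" by blast
        show "i \<in> ?R" unfolding j(2) mem_Collect_eq r(2)[OF j(1)] using r(1)[OF j(1)] by (simp only: snd_conv simp_thms)
      qed
      show "?R \<subseteq> r ` {..<k}"
      proof
        fix i assume i: "i \<in> ?R"
        then obtain j where j: "j < k" "c i = (real j / real k, y0)" using row_grid[of i y0] y0 by blast
        have "i = r j"
        proof (rule idx_inj)
          show "i \<in> Idx" using i by blast
          show "r j \<in> Idx" by (rule r(1)[OF j(1)])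
          show "c i = c (r j)" unfolding j(2) r(2)[OF j(1)] ..
        qed
        thus "i \<in> r ` {..<k}" using j(1) by simp
      qed
    qed
  qed
  define mir :: "nat \<Rightarrow> nat list \<Rightarrow> nat list" where "mir j u = (if even j then u else hx u)" for j u
  have mir_W: "mir j u \<in> W n" if "u \<in> W n" for j u using hx_W[OF that] that by (simp add: mir_def)
  have mir_touch: "touch (mir j u) (mir j v)" if "u \<in> W n" "v \<in> W n" "touch u v" for j u v
    using that touch_hx[of u n v] by (simp add: mir_def)
  have mir_mass: "mass n (\<lambda>u. f (mir j u)) = mass n f" for j f
    using mass_hx[of n f] by (cases "even j") (simp_all add: mir_def)
  define \<Omega> where "\<Omega> u = (\<Sum>j<k. wt (r j # mir j u))" for u
  \<comment> \<open>Cauchy-Schwarz over the \<open>k\<close> squares of the row; this is the origin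
    of the factor \<open>real k\<close> in the hypothesis \<open>small\<close>.\<close>
  have "mass n \<Omega> \<le> (\<Sum>u\<in>W n. real k * (\<Sum>j<k. (wt (r j # mir j u))\<^sup>2))"
    unfolding mass_def
  proof (rule sum_mono)
    fix u show "(\<Omega> u)\<^sup>2 \<le> real k * (\<Sum>j<k. (wt (r j # mir j u))\<^sup>2)"
      using sum_squared_le_sum_of_squares[of "\<lambda>j. wt (r j # mir j u)" "{..<k}"]
      by (simp add: \<Omega>_def mult.commute)
  qed
  also have "\<dots> = real k * (\<Sum>j<k. mass n (\<lambda>u. wt (r j # mir j u)))"
    unfolding mass_def sum_distrib_left[symmetric] by (subst sum.swap) simp
  also have "(\<Sum>j<k. mass n (\<lambda>u. wt (r j # mir j u))) = (\<Sum>j<k. mass n (\<lambda>u. wt (r j # u)))"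
    using mir_mass[of "\<lambda>u. wt (r j # u)" for j] by (intro sum.cong) simp_all
  also have "\<dots> = (\<Sum>i\<in>?R. mass n (\<lambda>u. wt (i # u)))"
    using sum.reindex_bij_betw[OF bij, of "\<lambda>i. mass n (\<lambda>u. wt (i # u))"] .
  finally have "mass n \<Omega> < t\<^sup>2 * Q n" using small by simp
  moreover have "\<And>u. 0 \<le> \<Omega> u" unfolding \<Omega>_def by (rule sum_nonneg) (rule nn)
  ultimately obtain \<alpha> where \<alpha>: "LR n \<alpha>" "len \<Omega> \<alpha> < t" using LR_short[of \<Omega> t n] t by blast
  have g\<alpha>: "gpath n \<alpha>" "\<alpha> \<noteq> []" and end\<alpha>: "px (hd \<alpha>) = 0" "px (last \<alpha>) = 1 - sd n"
    using \<alpha>(1) gpath_ne[of n \<alpha>] by (auto simp: LR_def)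
  have W\<alpha>: "hd \<alpha> \<in> W n" "last \<alpha> \<in> W n" using g\<alpha> gpath_hd gpath_last by blast+
  \<comment> \<open>A reflected crossing runs from right to left, so it is reversed as well. The
    last word of a block and the first word of the next block then come from the same word of
    \<open>\<alpha>\<close> and have equal height.\<close>
  define dir where "dir j = (if even j then \<alpha> else rev \<alpha>)" for j :: nat
  have g_dir: "gpath n (dir j)" for j using g\<alpha>(1) gpath_rev by (simp add: dir_def)
  have ne_dir: "dir j \<noteq> []" for j using g\<alpha> by (simp add: dir_def)
  have W_dir: "hd (dir j) \<in> W n" "last (dir j) \<in> W n" for j using g_dir gpath_hd gpath_last by blast+
  have dir_Suc: "hd (dir (Suc j)) = last (dir j)" for j
    using g\<alpha> by (simp add: dir_def hd_rev last_rev)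
  have dir_px: "px (mir j (hd (dir j))) = 0" "px (mir j (last (dir j))) = 1 - sd n" for j
    using end\<alpha> hx_pos[OF W\<alpha>(1)] hx_pos[OF W\<alpha>(2)] g\<alpha>(2) by (simp_all add: dir_def mir_def hd_rev last_rev)
  have mir_py: "py (mir j u) = py u" if "u \<in> W n" for j u using hx_pos[OF that] by (simp add: mir_def)
  define blk where "blk j = map (\<lambda>u. r j # mir j u) (dir j)" for j
  have g_blk: "gpath (Suc n) (blk j)" if "j < k" for j
    unfolding blk_def
  proof (rule gpath_map[OF g_dir])
    show "r j # mir j u \<in> W (Suc n)" if "u \<in> W n" for u
      using r(1)[OF \<open>j < k\<close>] mir_W[OF that] by (simp add: in_W_Cons)
    show "touch (r j # mir j u) (r j # mir j v)" if "u \<in> W n" "v \<in> W n" "touch u v" for u v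
      using mir_touch[OF that] touch_Cons[of "mir j u" "mir j v"]
        W_length[OF mir_W[OF that(1)]] W_length[OF mir_W[OF that(2)]] by simp
  qed
  have blk_ends: "blk j \<noteq> []" "hd (blk j) = r j # mir j (hd (dir j))" "last (blk j) = r j # mir j (last (dir j))" for j
    using ne_dir[of j] by (simp_all add: blk_def hd_map last_map)
  have joint: "touch (last (blk j)) (hd (blk (Suc j)))" if "Suc j < k" for j
  proof -
    have c1: "c (r j) = (real j / real k, y0)" "c (r (Suc j)) = (real (Suc j) / real k, y0)"
      using r(2) that by simp_all
    have L: "length (last (blk j)) = Suc n"
      unfolding blk_ends using W_length[OF mir_W[OF W_dir(2)]] by simp
    have "px (last (blk j)) - px (hd (blk (Suc j))) = - sd (Suc n)"
      unfolding blk_ends px.simps dir_px c1 by (simp add: sd_Suc add_divide_distrib diff_divide_distrib)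
    moreover have "py (last (blk j)) = py (hd (blk (Suc j)))"
      unfolding blk_ends py.simps c1 dir_Suc mir_py[OF W_dir(2)] by simp
    ultimately show ?thesis unfolding touch_def L by simp
  qed
  define C where "C m = concat (map blk [0..<m])" for m
  have C_Suc: "C (Suc m) = C m @ blk m" for m by (simp add: C_def)
  have C: "gpath (Suc n) (C (Suc m)) \<and> px (hd (C (Suc m))) = 0 \<and> last (C (Suc m)) = last (blk m)" if "m < k" for m
    using that
  proof (induction m)
    case 0
    have "c (r 0) = (0, y0)" using r(2)[of 0] 0 by simp
    hence "px (hd (blk 0)) = 0" unfolding blk_ends px.simps dir_px by simp
    thus ?case using g_blk[OF 0] by (simp add: C_def)
  next
    case (Suc m)
    hence IH: "gpath (Suc n) (C (Suc m))" "px (hd (C (Suc m))) = 0" "last (C (Suc m)) = last (blk m)" by simp_all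
    have ne: "C (Suc m) \<noteq> []" using gpath_ne[OF IH(1)] .
    have "gpath (Suc n) (C (Suc m) @ blk (Suc m))"
      using gpath_append_iff[OF ne blk_ends(1)[of "Suc m"]] IH(1,3) g_blk[OF Suc.prems] joint[OF Suc.prems] by simp
    thus ?case unfolding C_Suc[of "Suc m"] using ne IH(2) blk_ends(1) by simp
  qed
  have k1: "Suc (k - 1) = k" "k - 1 < k" using k_ge by simp_all
  have Ck: "gpath (Suc n) (C k)" "px (hd (C k)) = 0" "last (C k) = last (blk (k - 1))" using C[OF k1(2)] k1(1) by simp_all
  have "px (last (C k)) + sd (Suc n) = 1"
  proof -
    have "c (r (k - 1)) = (real (k - 1) / real k, y0)" using r(2)[OF k1(2)] .
    hence "px (last (C k)) = real (k - 1) / real k + (1 - sd n) / real k"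
      unfolding Ck(3) blk_ends px.simps dir_px by simp
    also have "\<dots> = (real (k - 1) + 1) / real k - sd (Suc n)"
      by (simp add: sd_Suc add_divide_distrib diff_divide_distrib)
    also have "real (k - 1) + 1 = real k" using k_ge by simp
    finally show ?thesis using k_pos by simp
  qed
  hence LRC: "LR (Suc n) (C k)" using Ck by (simp add: LR_def)
  have len_blk: "len wt (blk j) = len (\<lambda>u. wt (r j # mir j u)) \<alpha>" for j
    by (simp add: blk_def len_map dir_def)
  have "len wt (C m) = (\<Sum>j<m. len (\<lambda>u. wt (r j # mir j u)) \<alpha>)" for m
    by (induction m) (simp_all add: C_Suc len_blk, simp add: C_def)
  hence "len wt (C k) = len \<Omega> \<alpha>" unfolding \<Omega>_def by (simp add: len_sum)
  moreover have "\<exists>\<gamma>'. LR n \<gamma>' \<and> (#) i ` set \<gamma>' \<subseteq> set (C k)" if i: "i \<in> Idx" "snd (c i) = y0" for i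
  proof -
    have "i \<in> r ` {..<k}" using bij i unfolding bij_betw_def by blast
    then obtain j where j: "j < k" "i = r j" by blast
    have "gpath n (map (mir j) (dir j))" by (rule gpath_map[OF g_dir mir_W mir_touch])
    hence "LR n (map (mir j) (dir j))"
      unfolding LR_def using dir_px ne_dir by (simp add: hd_map last_map)
    moreover have "(#) i ` set (map (mir j) (dir j)) = set (blk j)" by (simp add: blk_def j(2) image_image)
    moreover have "set (blk j) \<subseteq> set (C k)" unfolding C_def using j(1) by auto
    ultimately show ?thesis by blast
  qed
  ultimately show ?thesis using LRC \<alpha>(2) by (intro exI[of _ "C k"]) simp
qed

lemma Q_nonneg: "0 \<le> Q n"
  by (rule Q_ge) (rule mass_nonneg)

text \<open>The factor 2 comes from the two disjoint rows at the bottom and at the top. It makes the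
  recursion in \<open>full_exists\<close> contract.\<close>

lemma Q_Suc: "2 / real k * Q n \<le> Q (Suc n)"
proof (rule Q_ge)
  fix wt assume a: "admissible (Suc n) wt"
  have row: "Q n \<le> real k * (\<Sum>i | i \<in> Idx \<and> snd (c i) = y0. mass n (\<lambda>u. wt (i # u)))"
    if "y0 = 0 \<or> y0 = 1 - 1 / real k" for y0
  proof (rule ccontr)
    assume "\<not> ?thesis"
    hence "real k * (\<Sum>i | i \<in> Idx \<and> snd (c i) = y0. mass n (\<lambda>u. wt (i # u))) < 1\<^sup>2 * Q n" by simp
    from row_path[OF that _ _ this] a obtain \<gamma> where "LR (Suc n) \<gamma>" "len wt \<gamma> < 1" by (auto simp: admissible_def)
    with a show False unfolding admissible_def by (meson not_le)
  qed
  define S where "S y0 = (\<Sum>i | i \<in> Idx \<and> snd (c i) = y0. mass n (\<lambda>u. wt (i # u)))" for y0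
  have ne: "1 - 1 / real k \<noteq> 0" using k_gt1 by simp
  have "S 0 + S (1 - 1 / real k) =
     (\<Sum>i\<in>{i. i \<in> Idx \<and> snd (c i) = 0} \<union> {i. i \<in> Idx \<and> snd (c i) = 1 - 1 / real k}. mass n (\<lambda>u. wt (i # u)))"
    unfolding S_def by (rule sum.union_disjoint[symmetric]) (use ne in auto)
  also have "\<dots> \<le> (\<Sum>i\<in>Idx. mass n (\<lambda>u. wt (i # u)))"
    by (rule sum_mono2) (auto simp: mass_nonneg)
  finally have "S 0 + S (1 - 1 / real k) \<le> mass (Suc n) wt" unfolding mass_Suc .
  hence "real k * (S 0 + S (1 - 1 / real k)) \<le> real k * mass (Suc n) wt" using k_pos by (intro mult_left_mono) auto
  moreover have "Q n \<le> real k * S 0" "Q n \<le> real k * S (1 - 1 / real k)" unfolding S_def using row by blast+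
  ultimately have "2 * Q n \<le> real k * mass (Suc n) wt" by (simp add: distrib_left)
  thus "2 / real k * Q n \<le> mass (Suc n) wt" using k_pos by (simp add: field_simps)
qed

lemma Q_ge_power: "(2 / real k) ^ m * Q n \<le> Q (m + n)"
proof (induction m)
  case (Suc m)
  have "(2 / real k) ^ Suc m * Q n = 2 / real k * ((2 / real k) ^ m * Q n)" by simp
  also have "\<dots> \<le> 2 / real k * Q (m + n)" using Suc by (rule mult_left_mono) simp
  also have "\<dots> \<le> Q (Suc m + n)" using Q_Suc[of "m + n"] by simp
  finally show ?case .
qed simp

lemma Q_pos: "0 < Q n"
proof -
  have "0 < (2 / real k) ^ n" using k_pos by simp
  thus ?thesis using Q_ge_power[of n 0] Q_0 by simp
qed

subsection \<open>Weights that dominate the boundary distance\<close>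

definition dinf :: "real \<times> real \<Rightarrow> real \<times> real \<Rightarrow> real" where
  "dinf p q = max \<bar>fst p - fst q\<bar> \<bar>snd p - snd q\<bar>"

lemma dinf_triangle: "dinf p q \<le> dinf p r + dinf r q"
  unfolding dinf_def by linarith

lemma dinf_unit: "p \<in> unit_square \<Longrightarrow> q \<in> unit_square \<Longrightarrow> dinf p q \<le> 1"
  by (auto simp: dinf_def unit_square_def)

lemma dinf_Psi: "dinf (Psi t p) (Psi t q) = sd (length t) * dinf p q"
proof -
  obtain a b a' b' where pq: "p = (a, b)" "q = (a', b')" by force
  have "\<bar>x * s - y * s\<bar> = s * \<bar>x - y\<bar>" if "0 \<le> s" for x y s :: real
  proof -
    have "x * s - y * s = s * (x - y)" by (simp add: algebra_simps)
    thus ?thesis using that by (simp only: abs_mult abs_of_nonneg)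
  qed
  thus ?thesis unfolding pq dinf_def by (simp add: Psi_eq max_mult_distrib_left)
qed

text \<open>The end points are arbitrary boundary points of the first and the last square, so that
  the pieces of a path in successive tiles can be joined at any common point. Paths of a single
  square are included.\<close>

definition full :: "nat \<Rightarrow> (nat list \<Rightarrow> real) \<Rightarrow> bool" where
  "full m wt \<longleftrightarrow> (\<forall>v. 0 \<le> wt v) \<and>
     (\<forall>vs p q. gpath m vs \<longrightarrow> p \<in> sq (hd vs) \<longrightarrow> p \<in> bd \<longrightarrow> q \<in> sq (last vs) \<longrightarrow> q \<in> bd \<longrightarrow> dinf p q \<le> len wt vs)"

lemma fullD:
  "full m wt \<Longrightarrow> gpath m vs \<Longrightarrow> p \<in> sq (hd vs) \<Longrightarrow> p \<in> bd \<Longrightarrow> q \<in> sq (last vs) \<Longrightarrow> q \<in> bd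
    \<Longrightarrow> dinf p q \<le> len wt vs"
  unfolding full_def by blast

lemma full_nonneg: "full m wt \<Longrightarrow> 0 \<le> wt v" by (simp add: full_def)

lemma bd_unit: "p \<in> bd \<Longrightarrow> p \<in> unit_square" by (simp add: bd_def)

section \<open>Cutting paths at the boundaries of tiles\<close>

lemma sq_split: "v \<in> W (n + m) \<Longrightarrow> sq v = Psi (take n v) ` sq (drop n v)"
  using sq_append[of "take n v" "drop n v"] by simp

lemma bd_splitE:
  assumes "v \<in> W (n + m)" "p \<in> sq v" "p \<in> bd"
  shows "p \<in> Psi (take n v) ` bd"
proof -
  obtain p' where p': "p = Psi (take n v) p'" "p' \<in> sq (drop n v)"
    using assms(2) unfolding sq_split[OF assms(1)] by (rule imageE)
  have "p' \<in> unit_square" using p'(2) sq_subset[OF W_drop[OF assms(1)]] by blast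
  hence "p' \<in> bd" using bd_tile[OF _ W_take[OF assms(1)]] assms(3) p'(1) by simp
  thus ?thesis using p'(1) by (rule rev_image_eqI)
qed

lemma tile_interface:
  assumes "v \<in> W (n + m)" "w \<in> W (n + m)" "take n v \<noteq> take n w" "z \<in> sq v" "z \<in> sq w"
  shows "z \<in> Psi (take n v) ` bd"
proof -
  obtain z' where z': "z = Psi (take n v) z'" "z' \<in> sq (drop n v)"
    using assms(4) unfolding sq_split[OF assms(1)] by (rule imageE)
  have u: "z' \<in> unit_square" using z'(2) sq_subset[OF W_drop[OF assms(1)]] by blast
  have "z \<in> sq (take n w)" using assms(5) tile_sub[OF W_drop[OF assms(2)], of "take n w"] by auto
  hence "z' \<in> bd" using sq_inter_bd[OF W_take[OF assms(1)] W_take[OF assms(2)] assms(3) _ u] z'(1) by simp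
  thus ?thesis using z'(1) by (rule rev_image_eqI)
qed

text \<open>Inside one tile the path is a scaled copy of a level-\<open>m\<close> path between
  boundary points, to which \<open>full\<close> applies. The factor \<open>sd n\<close> is the side
  of the tile.\<close>

lemma tile_run:
  assumes F: "full m wt'" and kap: "0 \<le> kap" and g: "gpath (n + m) vs"
    and same: "\<And>v. v \<in> set vs \<Longrightarrow> take n v = t" and le: "\<And>v. v \<in> set vs \<Longrightarrow> kap * wt' (drop n v) \<le> wt v"
    and p: "p \<in> sq (hd vs)" "p \<in> Psi t ` bd" and q: "q \<in> sq (last vs)" "q \<in> Psi t ` bd"
  shows "kap * dinf p q \<le> sd n * len wt vs"
proof -
  have ne: "vs \<noteq> []" using gpath_ne[OF g] .
  have W: "hd vs \<in> W (n + m)" "last vs \<in> W (n + m)" using gpath_hd[OF g] gpath_last[OF g] .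
  have th: "take n (hd vs) = t" "take n (last vs) = t" using same ne by simp_all
  have tW: "t \<in> W n" using W_take[OF W(1)] th by simp
  obtain p' where p': "p = Psi t p'" "p' \<in> bd" using p(2) by blast
  obtain q' where q': "q = Psi t q'" "q' \<in> bd" using q(2) by blast
  have "\<exists>x. p = Psi t x \<and> x \<in> sq (drop n (hd vs))" using p(1) unfolding sq_split[OF W(1)] th by blast
  hence p'': "p' \<in> sq (drop n (hd vs))" using p'(1) Psi_inj by metis
  have "\<exists>x. q = Psi t x \<and> x \<in> sq (drop n (last vs))" using q(1) unfolding sq_split[OF W(2)] th by blast
  hence q'': "q' \<in> sq (drop n (last vs))" using q'(1) Psi_inj by metis
  have "gpath m (map (drop n) vs)"
  proof -
    have "successively (\<lambda>x y. touch (drop n x) (drop n y)) vs"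
    proof (rule successively_mono[of touch])
      show "successively touch vs" using g by (simp add: gpath_def)
      fix x y assume xy: "x \<in> set vs" "y \<in> set vs" "touch x y"
      have "touch (t @ drop n x) (t @ drop n y)"
        using xy(3) append_take_drop_id[of n x] append_take_drop_id[of n y] same[OF xy(1)] same[OF xy(2)] by simp
      moreover have "length (drop n x) = length (drop n y)"
        using gpath_W[OF g xy(1)] gpath_W[OF g xy(2)] W_length by simp
      ultimately show "touch (drop n x) (drop n y)" using touch_append by blast
    qed
    moreover have "set (map (drop n) vs) \<subseteq> W m" using gpath_W[OF g] W_drop by (simp add: image_subset_iff)
    ultimately show ?thesis using ne by (simp add: gpath_def successively_map)
  qed
  from fullD[OF F this, of p' q'] have "dinf p' q' \<le> len wt' (map (drop n) vs)"
    using p'(2) q'(2) p'' q'' ne by (simp add: hd_map last_map)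
  hence "kap * dinf p' q' \<le> kap * len wt' (map (drop n) vs)" using kap by (rule mult_left_mono)
  also have "\<dots> = len (\<lambda>v. kap * wt' (drop n v)) vs" unfolding len_map len_scale ..
  also have "\<dots> \<le> len wt vs" by (rule len_mono) (rule le)
  finally have "sd n * (kap * dinf p' q') \<le> sd n * len wt vs" by (rule mult_left_mono) simp
  thus ?thesis unfolding p'(1) q'(1) dinf_Psi W_length[OF tW] by (simp add: algebra_simps)
qed

text \<open>The path is cut whenever it changes the tile. Touching squares of different tiles share
  a point on the boundary of both tiles, which ends one run and starts the next;
  \<open>tile_run\<close> and the triangle inequality do the rest. A tile may be revisited, since
  runs and not tiles are counted.\<close>

lemma tile_decomposition:
  assumes F: "full m wt'" and kap: "0 \<le> kap"
  shows "gpath (n + m) vs \<Longrightarrow> (\<And>v. v \<in> set vs \<Longrightarrow> kap * wt' (drop n v) \<le> wt v) \<Longrightarrow>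
    p \<in> sq (hd vs) \<Longrightarrow> p \<in> Psi (take n (hd vs)) ` bd \<Longrightarrow>
    q \<in> sq (last vs) \<Longrightarrow> q \<in> Psi (take n (last vs)) ` bd \<Longrightarrow> kap * dinf p q \<le> sd n * len wt vs"
proof (induction "length vs" arbitrary: vs p rule: less_induct)
  case less
  define t where "t = take n (hd vs)"
  define as where "as = takeWhile (\<lambda>v. take n v = t) vs"
  define bs where "bs = dropWhile (\<lambda>v. take n v = t) vs"
  have vs: "vs = as @ bs" by (simp add: as_def bs_def)
  have ne: "vs \<noteq> []" using gpath_ne[OF less.prems(1)] .
  have as_ne: "as \<noteq> []" using ne by (cases vs) (simp_all add: as_def t_def)
  have hd_as: "hd as = hd vs" using as_ne vs by simp
  have same: "take n v = t" if "v \<in> set as" for v using that set_takeWhileD[of v] unfolding as_def by blast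
  show ?case
  proof (cases "bs = []")
    case True
    hence "as = vs" using vs by simp
    have "take n (last vs) = t" using same[of "last vs"] ne \<open>as = vs\<close> by simp
    show ?thesis
      by (rule tile_run[OF F kap less.prems(1), of t])
        (use same \<open>as = vs\<close> less.prems \<open>take n (last vs) = t\<close> in \<open>simp_all add: t_def\<close>)
  next
    case False
    have g: "gpath (n + m) as" "gpath (n + m) bs" "touch (last as) (hd bs)"
      using less.prems(1) gpath_append_iff[OF as_ne False] vs by simp_all
    have W: "last as \<in> W (n + m)" "hd bs \<in> W (n + m)" using gpath_last[OF g(1)] gpath_hd[OF g(2)] .
    have la: "take n (last as) = t" using same as_ne by simp
    have hb: "take n (hd bs) \<noteq> t" using False hd_dropWhile[of "\<lambda>v. take n v = t" vs] unfolding bs_def by blast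
    obtain z where z: "z \<in> sq (last as)" "z \<in> sq (hd bs)" using g(3) touch_iffW[OF W] by blast
    have z1: "z \<in> Psi t ` bd" using tile_interface[OF W _ z] la hb by simp
    have z2: "z \<in> Psi (take n (hd bs)) ` bd" using tile_interface[OF W(2,1) _ z(2,1)] la hb by simp
    have "kap * dinf p z \<le> sd n * len wt as"
      by (rule tile_run[OF F kap g(1), of t])
        (use same less.prems vs z(1) z1 hd_as in \<open>simp_all add: t_def\<close>)
    moreover have "kap * dinf z q \<le> sd n * len wt bs"
    proof (rule less.hyps[OF _ g(2)])
      show "length bs < length vs" using vs as_ne by simp
      show "q \<in> sq (last bs)" "q \<in> Psi (take n (last bs)) ` bd" using less.prems(5,6) vs False by simp_all
      show "kap * wt' (drop n v) \<le> wt v" if "v \<in> set bs" for v using less.prems(2) vs that by simp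
    qed (use z(2) z2 in simp_all)
    moreover have "kap * dinf p q \<le> kap * (dinf p z + dinf z q)" using dinf_triangle kap by (rule mult_left_mono)
    ultimately show ?thesis by (simp add: vs distrib_left)
  qed
qed

text \<open>Meant for words whose tile \<open>take J v\<close> lies at the bottom. There
  \<open>px (take J v) * real k ^ J\<close> is the integer column of the tile, and reflecting the
  odd columns folds the strip like paper onto one square.\<close>

definition fold_strip :: "nat \<Rightarrow> nat list \<Rightarrow> nat list" where
  "fold_strip J v = (if even (nat \<lfloor>px (take J v) * real k ^ J\<rfloor>) then drop J v else hx (drop J v))"

lemma bottom_grid: "t \<in> W J \<Longrightarrow> py t = 0 \<Longrightarrow> \<exists>a<k ^ J. px t = real a * sd J"
proof (induction J arbitrary: t)
  case 0 thus ?case by (simp add: W_0)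
next
  case (Suc J)
  obtain i u where t: "t = i # u" "i \<in> Idx" "u \<in> W J" using Suc.prems(1) by (rule W_SucE)
  have "0 \<le> snd (c i)" using idx_range(3)[OF t(2)] .
  moreover have "0 \<le> py u / real k" using W_range(3)[OF t(3)] k_pos by simp
  moreover have "snd (c i) + py u / real k = 0" using Suc.prems(2) t(1) by simp
  ultimately have z: "snd (c i) = 0" "py u / real k = 0" by linarith+
  hence "py u = 0" using k_pos by simp
  from Suc.IH[OF t(3) this] obtain a where a: "a < k ^ J" "px u = real a * sd J" by blast
  obtain j where j: "j < k" "c i = (real j / real k, 0)" using row_grid[OF t(2) z(1)] by blast
  have "px t = real j / real k + real a * sd (Suc J)" unfolding t(1) px.simps j(2) a(2) by (simp add: sd_Suc)
  also have "real j / real k = real j * real k ^ J * sd (Suc J)" using sd_k[of J] by (simp add: sd_def)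
  finally have "px t = real (j * k ^ J + a) * sd (Suc J)" by (simp add: distrib_right)
  moreover have "j * k ^ J + a < k ^ Suc J"
  proof -
    have "j * k ^ J + a < (j + 1) * k ^ J" using a(1) by simp
    also have "\<dots> \<le> k * k ^ J" using j(1) by (intro mult_right_mono) simp_all
    finally show ?thesis by simp
  qed
  ultimately show ?case by blast
qed

lemma fold_strip_append:
  assumes "t \<in> W J" "px t = real a * sd J"
  shows "fold_strip J (t @ u) = (if even a then u else hx u)"
proof -
  have "px t * real k ^ J = real a" unfolding assms(2) using sd_k[of J] by (simp add: mult.assoc)
  thus ?thesis using W_length[OF assms(1)] by (simp add: fold_strip_def)
qed

lemma card_bottom: "card {t \<in> W J. py t = 0} \<le> k ^ J"
proof -
  have "px ` {t \<in> W J. py t = 0} \<subseteq> (\<lambda>a. real a * sd J) ` {..<k ^ J}"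
    using bottom_grid by (auto simp: image_iff)
  hence "card (px ` {t \<in> W J. py t = 0}) \<le> card ((\<lambda>a. real a * sd J) ` {..<k ^ J})"
    by (intro card_mono) simp_all
  also have "\<dots> \<le> k ^ J" using card_image_le[of "{..<k ^ J}" "\<lambda>a. real a * sd J"] by simp
  finally have "card (px ` {t \<in> W J. py t = 0}) \<le> k ^ J" .
  moreover have "inj_on px {t \<in> W J. py t = 0}"
    by (rule inj_onI) (simp add: W_pos_inj[of _ J])
  ultimately show ?thesis by (simp add: card_image)
qed

lemma fold_strip_W:
  assumes "v \<in> W (J + m)" "py (take J v) = 0"
  shows "fold_strip J v \<in> W m" "py (fold_strip J v) = py (drop J v)"
  using W_drop[OF assms(1)] hx_W[of "drop J v" m] hx_pos[of "drop J v" m] by (simp_all add: fold_strip_def)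

text \<open>Within one column both words are treated alike. Squares in different columns touch only
  across the common edge of adjacent columns, and the opposite parities send both of them to the
  same side of the square.\<close>

lemma fold_strip_touch:
  assumes v: "v \<in> W (J + m)" "py (take J v) = 0" and w: "w \<in> W (J + m)" "py (take J w) = 0"
    and t: "touch v w"
  shows "touch (fold_strip J v) (fold_strip J w)"
proof -
  obtain t u where vv: "v = t @ u" "t \<in> W J" "u \<in> W m" using v(1) by (rule W_appendE)
  obtain t' u' where ww: "w = t' @ u'" "t' \<in> W J" "u' \<in> W m" using w(1) by (rule W_appendE)
  have L: "length t = J" "length t' = J" "length u = m" using vv ww W_length by auto
  have b: "py t = 0" "py t' = 0" using v(2) w(2) L by (simp_all add: vv(1) ww(1))
  obtain a where a: "px t = real a * sd J" using bottom_grid[OF vv(2) b(1)] by blast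
  obtain a' where a': "px t' = real a' * sd J" using bottom_grid[OF ww(2) b(2)] by blast
  have Lv: "length v = J + m" using W_length[OF v(1)] .
  have "\<bar>px v - px w\<bar> \<le> sd J * sd m" "\<bar>py v - py w\<bar> \<le> sd J * sd m"
    using t unfolding touch_def Lv sd_add by simp_all
  moreover have "px v - px w = sd J * ((real a + px u) - (real a' + px u'))"
    "py v - py w = sd J * (py u - py u')"
    by (simp_all add: vv(1) ww(1) px_append py_append L a a' b algebra_simps)
  ultimately have d: "\<bar>(real a + px u) - (real a' + px u')\<bar> \<le> sd m" "\<bar>py u - py u'\<bar> \<le> sd m"
    by (simp_all add: abs_mult)
  note r = W_range[OF vv(3)] W_range[OF ww(3)]
  have h: "px (hx u) = 1 - sd m - px u" "py (hx u) = py u" "px (hx u') = 1 - sd m - px u'" "py (hx u') = py u'"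
    using hx_pos[OF vv(3)] hx_pos[OF ww(3)] by simp_all
  have f: "fold_strip J v = (if even a then u else hx u)" "fold_strip J w = (if even a' then u' else hx u')"
    unfolding vv(1) ww(1) using fold_strip_append[OF vv(2) a] fold_strip_append[OF ww(2) a'] by simp_all
  have Lf: "length (fold_strip J v) = m" using L by (simp add: f)
  have py: "\<bar>py (fold_strip J v) - py (fold_strip J w)\<bar> \<le> sd m" using d(2) by (simp add: f h)
  have "\<bar>px (fold_strip J v) - px (fold_strip J w)\<bar> \<le> sd m"
  proof (cases a a' rule: linorder_cases)
    case equal thus ?thesis using d(1) by (cases "even a") (simp_all add: f h abs_minus_commute)
  next
    case less
    hence "real a + 1 \<le> real a'" by simp
    hence e: "px u = 1 - sd m" "px u' = 0" "real a' = real a + 1" using d(1) r by linarith+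
    hence "a' = a + 1" by linarith
    thus ?thesis using e(1,2) by (cases "even a") (simp_all add: f h)
  next
    case greater
    hence "real a' + 1 \<le> real a" by simp
    hence e: "px u' = 1 - sd m" "px u = 0" "real a = real a' + 1" using d(1) r by linarith+
    hence "a = a' + 1" by linarith
    thus ?thesis using e(1,2) by (cases "even a'") (simp_all add: f h)
  qed
  thus ?thesis using py by (simp add: touch_def Lf)
qed

text \<open>Tiles off the bottom need not lie on a grid, so the reason is not divisibility. Below
  the middle of \<open>t\<close> there is a bottom tile; the two overlap horizontally, so
  \<open>W_sep\<close> separates them vertically.\<close>

lemma above_bottom:
  assumes "t \<in> W J" "py t \<noteq> 0"
  shows "sd J \<le> py t"
proof -
  note r = W_range[OF assms(1)]
  have "0 \<le> px t + sd J / 2" "px t + sd J / 2 \<le> 1" using r sd_pos[of J] by linarith+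
  hence "(px t + sd J / 2, 0) \<in> bd" by (simp add: bd_def unit_square_def)
  then obtain t' where t': "t' \<in> W J" "(px t + sd J / 2, 0) \<in> sq t'" using bd_cell by blast
  hence m: "px t' \<le> px t + sd J / 2" "px t + sd J / 2 \<le> px t' + sd J" "py t' \<le> 0"
    by (simp_all add: sq_def W_length[OF t'(1)])
  hence 0: "py t' = 0" using W_range(3)[OF t'(1)] by simp
  hence "t \<noteq> t'" using assms(2) by auto
  moreover have "\<bar>px t - px t'\<bar> < sd J" using m sd_pos[of J] by linarith
  ultimately have "sd J \<le> \<bar>py t - py t'\<bar>" using W_sep[OF assms(1) t'(1)] by linarith
  thus ?thesis using 0 r(3) by simp
qed

text \<open>A path that leaves the strip of level-\<open>J\<close> squares along the bottom side folds to a
  bottom-top crossing of a single square.\<close>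

lemma strip_exit:
  assumes nn: "\<And>v. 0 \<le> wt v" and adm: "\<And>vs. BT m vs \<Longrightarrow> 1 \<le> len wt vs"
    and g: "gpath (J + m) vs" and start: "py (hd vs) = 0" and out: "\<exists>v\<in>set vs. py (take J v) \<noteq> 0"
  shows "1 \<le> len (\<lambda>v. if py (take J v) = 0 then wt (fold_strip J v) else 0) vs"
proof -
  let ?P = "\<lambda>v. py (take J v) = 0"
  let ?F = "\<lambda>v. if py (take J v) = 0 then wt (fold_strip J v) else 0"
  define as where "as = takeWhile ?P vs"
  define bs where "bs = dropWhile ?P vs"
  have vs: "vs = as @ bs" by (simp add: as_def bs_def)
  have ne: "vs \<noteq> []" using gpath_ne[OF g] .
  have P: "?P v" if "v \<in> set as" for v using that set_takeWhileD[of v ?P vs] unfolding as_def by blast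
  have hdW: "hd vs \<in> W (J + m)" using gpath_hd[OF g] .
  have split_py: "py v = py (take J v) + py (drop J v) * sd J" if "v \<in> W (J + m)" for v
    using py_append[of "take J v" "drop J v"] W_length[OF W_take[OF that]] by simp
  have nn2: "0 \<le> py (take J v)" "0 \<le> py (drop J v) * sd J" if "v \<in> W (J + m)" for v
    using W_range(3)[OF W_take[OF that]] W_range(3)[OF W_drop[OF that]] by simp_all
  have hd0: "py (take J (hd vs)) = 0" "py (drop J (hd vs)) * sd J = 0"
    using start split_py[OF hdW] nn2[OF hdW] by linarith+
  have as_ne: "as \<noteq> []" using ne hd0(1) by (cases vs) (simp_all add: as_def)
  have bs_ne: "bs \<noteq> []" using out unfolding bs_def by (simp add: dropWhile_eq_Nil_conv)
  have gg: "gpath (J + m) as" "gpath (J + m) bs" "touch (last as) (hd bs)"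
    using g gpath_append_iff[OF as_ne bs_ne] vs by simp_all
  have "successively (\<lambda>x y. touch (fold_strip J x) (fold_strip J y)) as"
  proof (rule successively_mono[of touch])
    show "successively touch as" using gg(1) by (simp add: gpath_def)
    fix x y assume xy: "x \<in> set as" "y \<in> set as" "touch x y"
    show "touch (fold_strip J x) (fold_strip J y)"
      by (rule fold_strip_touch[OF gpath_W[OF gg(1) xy(1)] P[OF xy(1)] gpath_W[OF gg(1) xy(2)] P[OF xy(2)] xy(3)])
  qed
  moreover have "set (map (fold_strip J) as) \<subseteq> W m"
    using fold_strip_W(1)[OF gpath_W[OF gg(1)] P] by (simp add: image_subset_iff)
  ultimately have gf: "gpath m (map (fold_strip J) as)" using as_ne by (simp add: gpath_def successively_map)
  have W: "last as \<in> W (J + m)" "hd bs \<in> W (J + m)" using gpath_last[OF gg(1)] gpath_hd[OF gg(2)] .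
  have Pl: "?P (last as)" using P as_ne by simp
  have Ph: "\<not> ?P (hd bs)" using bs_ne hd_dropWhile[of ?P vs] unfolding bs_def by blast
  \<comment> \<open>The first word outside the strip begins at height \<open>sd J\<close> or above.
    As it touches the last word inside, the latter reaches the top of its tile, so its folded image
    is at the top of the square.\<close>
  have "sd J \<le> py (hd bs)" using above_bottom[OF W_take[OF W(2)] Ph] split_py[OF W(2)] nn2(2)[OF W(2)] by linarith
  moreover have "py (hd bs) - py (last as) \<le> sd J * sd m"
  proof -
    have "\<bar>py (last as) - py (hd bs)\<bar> \<le> sd (J + m)"
      using gg(3) unfolding touch_def W_length[OF W(1)] by blast
    thus ?thesis unfolding sd_add by linarith
  qed
  moreover have "py (last as) = py (drop J (last as)) * sd J" using split_py[OF W(1)] Pl by simp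
  ultimately have "sd J \<le> sd J * (py (drop J (last as)) + sd m)" by (simp add: algebra_simps)
  hence "1 \<le> py (drop J (last as)) + sd m" by simp
  moreover have "py (drop J (last as)) + sd m \<le> 1" using W_range(4)[OF W_drop[OF W(1)]] .
  ultimately have top: "py (drop J (last as)) + sd m = 1" by simp
  have hd_as: "hd as = hd vs" using as_ne vs by simp
  have "py (hd (map (fold_strip J) as)) = 0"
    using fold_strip_W(2)[OF hdW hd0(1)] hd0(2) as_ne hd_as by (simp add: hd_map)
  moreover have "py (last (map (fold_strip J) as)) + sd m = 1"
    using fold_strip_W(2)[OF W(1) Pl] top as_ne by (simp add: last_map)
  ultimately have "BT m (map (fold_strip J) as)" using gf by (simp add: BT_def)
  hence "1 \<le> len (\<lambda>v. wt (fold_strip J v)) as" using adm len_map by metis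
  also have "\<dots> = len ?F as" using P by (intro len_cong) simp
  also have "\<dots> \<le> len ?F vs" unfolding vs using len_nonneg[of bs ?F] nn by simp
  finally show ?thesis .
qed

text \<open>\<open>side_map j\<close> for \<open>j < 4\<close> are symmetries carrying the four sides of the square to the bottom.\<close>

definition side_map :: "nat \<Rightarrow> nat list \<Rightarrow> nat list" where
  "side_map j v = (if j = 0 then v else if j = 1 then tr v else if j = 2 then tr (hx v) else tr (hx (tr v)))"

lemma side_map_W: "v \<in> W n \<Longrightarrow> side_map j v \<in> W n"
  by (simp add: side_map_def hx_W tr_W del: map_map)

lemma side_map_touch: "u \<in> W n \<Longrightarrow> v \<in> W n \<Longrightarrow> touch (side_map j u) (side_map j v) \<longleftrightarrow> touch u v"
  using touch_tr[of u n v] touch_hx[of u n v] touch_tr[of "hx u" n "hx v"] touch_hx[of "tr u" n "tr v"]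
    touch_tr[of "hx (tr u)" n "hx (tr v)"] hx_W[of u n] hx_W[of v n] tr_W[of u n] tr_W[of v n]
    hx_W[of "tr u" n] hx_W[of "tr v" n]
  by (simp add: side_map_def del: map_map)

lemma side_map_pos:
  assumes "v \<in> W n"
  shows "px (side_map 0 v) = px v" "py (side_map 0 v) = py v"
    "px (side_map 1 v) = py v" "py (side_map 1 v) = px v"
    "px (side_map 2 v) = py v" "py (side_map 2 v) = 1 - sd n - px v"
    "px (side_map 3 v) = px v" "py (side_map 3 v) = 1 - sd n - py v"
  using tr_pos[OF assms] tr_pos[OF hx_W[OF assms]] hx_pos[OF assms] hx_pos[OF tr_W[OF assms]]
    tr_pos[OF hx_W[OF tr_W[OF assms]]]
  by (simp_all add: side_map_def del: map_map)

lemma side_map_take: "take J (side_map j v) = side_map j (take J v)"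
  by (simp add: side_map_def take_map)

lemma side_map_bij: "bij_betw (side_map j) (W n) (W n)"
proof -
  have "bij_betw (tr \<circ> hx) (W n) (W n)" by (rule bij_betw_trans[OF bij_hx bij_tr])
  moreover have "bij_betw (tr \<circ> (hx \<circ> tr)) (W n) (W n)"
    by (rule bij_betw_trans[OF bij_betw_trans[OF bij_tr bij_hx] bij_tr])
  moreover have "side_map j = (if j = 0 then id else if j = 1 then tr else if j = 2 then tr \<circ> hx else tr \<circ> (hx \<circ> tr))"
    by (rule ext) (simp add: side_map_def)
  ultimately show ?thesis using bij_tr by (simp add: bij_betw_id)
qed

lemma gpath_side_map: "gpath n vs \<Longrightarrow> gpath n (map (side_map j) vs)"
  by (rule gpath_map[of n]) (simp_all add: side_map_W side_map_touch)

lemma side_map_bottom: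
  assumes "v \<in> W n" "p \<in> sq v" "p \<in> bd"
  shows "\<exists>j<4. py (side_map j v) = 0"
proof -
  note r = W_range[OF assms(1)]
  have p: "px v \<le> fst p" "fst p \<le> px v + sd n" "py v \<le> snd p" "snd p \<le> py v + sd n"
    using assms(2) W_length[OF assms(1)] by (auto simp: sq_def)
  have "fst p = 0 \<or> fst p = 1 \<or> snd p = 0 \<or> snd p = 1" using assms(3) by (simp add: bd_def)
  hence "px v = 0 \<or> 1 - sd n - px v = 0 \<or> py v = 0 \<or> 1 - sd n - py v = 0" using p r by linarith
  hence "py (side_map 1 v) = 0 \<or> py (side_map 2 v) = 0 \<or> py (side_map 0 v) = 0 \<or> py (side_map 3 v) = 0"
    unfolding side_map_pos[OF assms(1)] by blast
  moreover have "(1::nat) < 4" "(2::nat) < 4" "(0::nat) < 4" "(3::nat) < 4" by simp_all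
  ultimately show ?thesis by blast
qed

lemma card_side: "card {t \<in> W J. py (side_map j t) = 0} \<le> k ^ J"
proof -
  have "card {t \<in> W J. py (side_map j t) = 0} \<le> card {t \<in> W J. py t = 0}"
  proof (rule card_inj_on_le)
    show "inj_on (side_map j) {t \<in> W J. py (side_map j t) = 0}"
      using side_map_bij[of j J] unfolding bij_betw_def by (rule inj_on_subset[OF conjunct1]) blast
    show "side_map j ` {t \<in> W J. py (side_map j t) = 0} \<subseteq> {t \<in> W J. py t = 0}"
      using side_map_W by (simp add: image_subset_iff)
    show "finite {t \<in> W J. py t = 0}" by simp
  qed
  also have "\<dots> \<le> k ^ J" by (rule card_bottom)
  finally show ?thesis .
qed

section \<open>Mass estimates and one step of the recursion\<close>

lemma mass_side_map: "mass n (\<lambda>v. f (side_map j v)) = mass n f"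
  unfolding mass_def by (rule sum.reindex_bij_betw[OF side_map_bij])

lemma mass_scale: "mass n (\<lambda>v. r * f v) = r\<^sup>2 * mass n f"
  unfolding mass_def by (simp add: power_mult_distrib sum_distrib_left)

lemma mass_zero: "mass n (\<lambda>v. 0) = 0" by (simp add: mass_def)

lemma mass_add: "mass n (\<lambda>v. f v + g v) \<le> 2 * mass n f + 2 * mass n g"
proof -
  have "(f v + g v)\<^sup>2 \<le> 2 * (f v)\<^sup>2 + 2 * (g v)\<^sup>2" for v
    using sum_squares_bound[of "f v" "g v"] by (simp add: power2_sum)
  thus ?thesis unfolding mass_def sum_distrib_left sum.distrib[symmetric] by (intro sum_mono) simp
qed

lemma mass_sum: "mass n (\<lambda>v. \<Sum>j<r. f j v) \<le> real r * (\<Sum>j<r. mass n (f j))"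
proof -
  have "mass n (\<lambda>v. \<Sum>j<r. f j v) \<le> (\<Sum>v\<in>W n. real r * (\<Sum>j<r. (f j v)\<^sup>2))"
    unfolding mass_def
    by (rule sum_mono) (use sum_squared_le_sum_of_squares[of "\<lambda>j. f j _" "{..<r}"] in \<open>simp add: mult.commute\<close>)
  also have "\<dots> = real r * (\<Sum>j<r. mass n (f j))"
    unfolding mass_def sum_distrib_left[symmetric] by (subst sum.swap) simp
  finally show ?thesis .
qed

text \<open>Serves for weights copied into the tiles of a boundary strip, with
  \<open>r = k ^ J\<close>, and into the tiles of a neighbourhood, with
  \<open>r = 25\<close>.\<close>

lemma mass_select:
  assumes le: "card {t \<in> W J. P t} \<le> r" and eq: "\<And>t. t \<in> W J \<Longrightarrow> P t \<Longrightarrow> mass m (\<lambda>u. f (t @ u)) = M"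
    and M: "0 \<le> M"
  shows "mass (J + m) (\<lambda>v. if P (take J v) then f v else 0) \<le> real r * M"
proof -
  have "mass (J + m) (\<lambda>v. if P (take J v) then f v else 0) =
      (\<Sum>t\<in>W J. mass m (\<lambda>u. if P (take J (t @ u)) then f (t @ u) else 0))"
    by (rule mass_append)
  also have "\<dots> = (\<Sum>t\<in>W J. if P t then M else 0)"
  proof (rule sum.cong[OF refl])
    fix t assume t: "t \<in> W J"
    have "take J (t @ u) = t" for u using W_length[OF t] by simp
    thus "mass m (\<lambda>u. if P (take J (t @ u)) then f (t @ u) else 0) = (if P t then M else 0)"
      using eq[OF t] by (simp add: mass_zero)
  qed
  also have "\<dots> = real (card {t \<in> W J. P t}) * M"
    by (simp add: sum.If_cases Int_def)
  also have "\<dots> \<le> real r * M" using le M by (intro mult_right_mono) simp_all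
  finally show ?thesis .
qed

text \<open>Both kinds of weights are put on the level-\<open>J\<close> squares at the boundary only: a path between
  boundary points either stays in one boundary strip, where the scaled \<open>wt'\<close> measures its displacement,
  or leaves it, which costs at least 1 in terms of \<open>\<beta>\<close>.\<close>

lemma full_step:
  assumes F: "full m wt'" and nn: "\<And>v. 0 \<le> \<beta> v" and adm: "\<And>vs. BT m vs \<Longrightarrow> 1 \<le> len \<beta> vs"
  shows "\<exists>wt. full (J + m) wt \<and> mass (J + m) wt \<le> 32 * (sd J * mass m wt' + real k ^ J * mass m \<beta>)"
proof -
  \<comment> \<open>Tiles have side \<open>sd J\<close>, so the copies of \<open>wt'\<close> are
    scaled by \<open>sd J\<close> to measure displacement in the large square. On at most
    \<open>k ^ J\<close> tiles this gives the mass factor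
    \<open>real k ^ J * (sd J)\<^sup>2 = sd J\<close>.\<close>
  define A where "A j v = (if py (side_map j (take J v)) = 0 then sd J * wt' (drop J v) else 0)" for j v
  define F0 where "F0 v = (if py (take J v) = 0 then \<beta> (fold_strip J v) else 0)" for v
  define T where "T j v = A j v + F0 (side_map j v)" for j v
  define wt where "wt v = (\<Sum>j<4. T j v)" for v
  have A0: "0 \<le> A j v" for j v using full_nonneg[OF F] by (simp add: A_def)
  have F00: "0 \<le> F0 v" for v using nn by (simp add: F0_def)
  have T0: "0 \<le> T j v" for j v using A0 F00 by (simp add: T_def)
  have T_le: "T j v \<le> wt v" if "j < 4" for j v
    unfolding wt_def by (rule member_le_sum) (use that in \<open>simp_all add: T0\<close>)
  have massA: "mass (J + m) (A j) \<le> real (k ^ J) * ((sd J)\<^sup>2 * mass m wt')" for j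
    unfolding A_def
  proof (rule mass_select[OF card_side])
    fix t assume "t \<in> W J"
    thus "mass m (\<lambda>u. sd J * wt' (drop J (t @ u))) = (sd J)\<^sup>2 * mass m wt'"
      using W_length[of t J] by (simp add: mass_scale)
  qed (simp add: mass_nonneg)
  have massF0: "mass (J + m) F0 \<le> real (k ^ J) * mass m \<beta>"
    unfolding F0_def
  proof (rule mass_select[OF card_bottom])
    fix t assume t: "t \<in> W J" "py t = 0"
    obtain a where a: "px t = real a * sd J" using bottom_grid[OF t] by blast
    show "mass m (\<lambda>u. \<beta> (fold_strip J (t @ u))) = mass m \<beta>"
      unfolding fold_strip_append[OF t(1) a] using mass_hx[of m \<beta>] by (cases "even a") simp_all
  qed (simp add: mass_nonneg)
  have massT: "mass (J + m) (T j) \<le> 2 * (sd J * mass m wt') + 2 * (real k ^ J * mass m \<beta>)" for j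
  proof -
    have "mass (J + m) (T j) \<le> 2 * mass (J + m) (A j) + 2 * mass (J + m) (\<lambda>v. F0 (side_map j v))"
      unfolding T_def[abs_def] by (rule mass_add)
    moreover have "real (k ^ J) * ((sd J)\<^sup>2 * mass m wt') = sd J * mass m wt'"
    proof -
      have "real (k ^ J) * ((sd J)\<^sup>2 * mass m wt') = (sd J * real k ^ J) * (sd J * mass m wt')"
        by (simp add: power2_eq_square mult_ac)
      thus ?thesis by (simp only: sd_k mult_1_left)
    qed
    ultimately show ?thesis using massA[of j] massF0 unfolding mass_side_map of_nat_power by linarith
  qed
  \<comment> \<open>The factor 32 is 2 for the two summands of \<open>T\<close>, 4 for
    Cauchy-Schwarz over the sides and 4 for their number.\<close>
  have "mass (J + m) wt \<le> real 4 * (\<Sum>j<4. mass (J + m) (T j))" unfolding wt_def[abs_def] by (rule mass_sum)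
  also have "\<dots> \<le> real 4 * (\<Sum>j<(4::nat). 2 * (sd J * mass m wt') + 2 * (real k ^ J * mass m \<beta>))"
    by (intro mult_left_mono sum_mono massT) simp
  also have "\<dots> = 32 * (sd J * mass m wt' + real k ^ J * mass m \<beta>)" by simp
  finally have M: "mass (J + m) wt \<le> 32 * (sd J * mass m wt' + real k ^ J * mass m \<beta>)" .
  have "full (J + m) wt"
    unfolding full_def
  proof (intro conjI allI impI)
    show "0 \<le> wt v" for v unfolding wt_def using T0 by (rule sum_nonneg)
    fix vs p q
    assume g: "gpath (J + m) vs" and p: "p \<in> sq (hd vs)" "p \<in> bd" and q: "q \<in> sq (last vs)" "q \<in> bd"
    have ne: "vs \<noteq> []" using gpath_ne[OF g] .
    have W: "hd vs \<in> W (J + m)" "last vs \<in> W (J + m)" using gpath_hd[OF g] gpath_last[OF g] .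
    obtain j where j: "j < 4" "py (side_map j (hd vs)) = 0" using side_map_bottom[OF W(1) p] by blast
    show "dinf p q \<le> len wt vs"
    proof (cases "\<exists>v\<in>set vs. py (take J (side_map j v)) \<noteq> 0")
      case True
      have "1 \<le> len F0 (map (side_map j) vs)"
        unfolding F0_def
      proof (rule strip_exit[OF nn adm gpath_side_map[OF g]])
        show "py (hd (map (side_map j) vs)) = 0" using j(2) ne by (simp add: hd_map)
        show "\<exists>v\<in>set (map (side_map j) vs). py (take J v) \<noteq> 0" using True by simp
      qed
      also have "\<dots> = len (\<lambda>v. F0 (side_map j v)) vs" by (rule len_map)
      also have "\<dots> \<le> len wt vs"
      proof (rule len_mono)
        fix v
        have "F0 (side_map j v) \<le> T j v" using A0[of j v] by (simp add: T_def)
        thus "F0 (side_map j v) \<le> wt v" using T_le[OF j(1), of v] by linarith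
      qed
      finally show ?thesis using dinf_unit[OF bd_unit[OF p(2)] bd_unit[OF q(2)]] by linarith
    next
      case False
      have "sd J * dinf p q \<le> sd J * len wt vs"
      proof (rule tile_decomposition[OF F _ g _ p(1) _ q(1)])
        show "0 \<le> sd J" by simp
        show "p \<in> Psi (take J (hd vs)) ` bd" using bd_splitE[OF W(1) p] .
        show "q \<in> Psi (take J (last vs)) ` bd" using bd_splitE[OF W(2) q] .
        fix v assume v: "v \<in> set vs"
        have "A j v = sd J * wt' (drop J v)" using False v by (simp add: A_def side_map_take)
        hence "sd J * wt' (drop J v) \<le> T j v" using F00 by (simp add: T_def)
        thus "sd J * wt' (drop J v) \<le> wt v" using T_le[OF j(1), of v] by linarith
      qed
      thus ?thesis by simp
    qed
  qed
  thus ?thesis using M by blast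
qed

lemma full_one: "full m (\<lambda>_. 1)"
  unfolding full_def
proof (intro conjI allI impI)
  fix vs p q
  assume g: "gpath m vs" and p: "p \<in> sq (hd vs)" "p \<in> bd" and q: "q \<in> sq (last vs)" "q \<in> bd"
  have "1 \<le> len (\<lambda>_. 1) vs" using len_ge_member[of vs "\<lambda>_. 1" "hd vs"] gpath_ne[OF g] by simp
  thus "dinf p q \<le> len (\<lambda>_. 1) vs" using dinf_unit[OF bd_unit[OF p(2)] bd_unit[OF q(2)]] by linarith
qed simp

section \<open>Existence of the weights and decay of the modulus\<close>

lemma BT_admissible:
  "\<exists>\<beta>. (\<forall>v. 0 \<le> \<beta> v) \<and> (\<forall>vs. BT m vs \<longrightarrow> 1 \<le> len \<beta> vs) \<and> mass m \<beta> \<le> 2 * Q m"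
proof -
  have "Q m < 2 * Q m" using Q_pos by simp
  from Q_near[OF this] obtain wt where w: "admissible m wt" "mass m wt < 2 * Q m" by blast
  have "1 \<le> len (\<lambda>v. wt (tr v)) vs" if "BT m vs" for vs
    using w(1) BT_tr[OF that] unfolding admissible_def len_map[symmetric] by blast
  moreover have "\<forall>v. 0 \<le> wt (tr v)" using w(1) by (simp add: admissible_def)
  ultimately show ?thesis using w(2) mass_tr[of m wt] by (intro exI[of _ "\<lambda>v. wt (tr v)"]) simp
qed

lemma Q_lower: "Q m \<le> (real k / 2) ^ J * Q (J + m)"
proof -
  have "(real k / 2) ^ J * ((2 / real k) ^ J * Q m) \<le> (real k / 2) ^ J * Q (J + m)"
    using Q_ge_power k_pos by (intro mult_left_mono) simp_all
  moreover have "(real k / 2) ^ J * ((2 / real k) ^ J * Q m) = Q m"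
    using k_pos by (simp add: mult.assoc[symmetric] power_mult_distrib[symmetric])
  ultimately show ?thesis by simp
qed

text \<open>Six levels are the least number for which the recursion contracts:
  \<open>32 * sd 6 * (real k / 2) ^ 6 = 1 / 2\<close>, while five would give the factor 1. Below
  level 6 the constant weight 1 is used.\<close>

lemma full_exists: "\<exists>C>0. \<forall>m. \<exists>wt. full m wt \<and> mass m wt \<le> C * Q m"
proof -
  \<comment> \<open>The first summand covers the levels below 6, the second one yields
    \<open>C / 2 + real k ^ 12 \<le> C\<close>, which closes the induction.\<close>
  define C where "C = (real N * real k) ^ 6 + 2 * real k ^ 12"
  have C0: "0 < C" using k_pos by (simp add: C_def add_nonneg_pos)
  have N1: "1 \<le> real N" using N_ge k_ge by simp
  have "\<exists>wt. full m wt \<and> mass m wt \<le> C * Q m" for m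
  proof (induction m rule: less_induct)
    case (less m)
    show ?case
    proof (cases "m < 6")
      case True
      have "mass m (\<lambda>_. 1) = real N ^ m" by (simp add: mass_def card_W)
      also have "\<dots> = real N ^ m * Q 0" by (simp add: Q_0)
      also have "\<dots> \<le> real N ^ m * ((real k / 2) ^ m * Q m)" using Q_lower[of 0 m] by (intro mult_left_mono) simp_all
      also have "\<dots> \<le> real N ^ 6 * (real k ^ 6 * Q m)"
      proof (intro mult_mono)
        show "real N ^ m \<le> real N ^ 6" using True N1 by (intro power_increasing) simp_all
        have "(real k / 2) ^ m \<le> real k ^ m" using k_pos by (intro power_mono) simp_all
        also have "\<dots> \<le> real k ^ 6" using True k_gt1 by (intro power_increasing) simp_all
        finally show "(real k / 2) ^ m \<le> real k ^ 6" .
      qed (use Q_nonneg in simp_all)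
      also have "\<dots> \<le> C * Q m"
      proof -
        have "real N ^ 6 * real k ^ 6 \<le> C" by (simp add: C_def power_mult_distrib)
        thus ?thesis using Q_nonneg[of m] by (simp add: mult.assoc[symmetric] mult_right_mono)
      qed
      finally show ?thesis using full_one by blast
    next
      case False
      define l where "l = m - 6"
      have m: "m = 6 + l" using False by (simp add: l_def)
      obtain wt' where w: "full l wt'" "mass l wt' \<le> C * Q l" using less[of l] m by auto
      obtain \<beta> where b: "\<And>v. 0 \<le> \<beta> v" "\<And>vs. BT l vs \<Longrightarrow> 1 \<le> len \<beta> vs" "mass l \<beta> \<le> 2 * Q l"
        using BT_admissible by blast
      obtain wt where o: "full m wt" "mass m wt \<le> 32 * (sd 6 * mass l wt' + real k ^ 6 * mass l \<beta>)"
        using full_step[OF w(1) b(1,2), of 6] unfolding m by blast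
      note o(2)
      also have "32 * (sd 6 * mass l wt' + real k ^ 6 * mass l \<beta>) \<le> 32 * (sd 6 * (C * Q l) + real k ^ 6 * (2 * Q l))"
        using w(2) b(3) by (intro mult_left_mono add_mono) simp_all
      also have "\<dots> = 32 * (sd 6 * C + 2 * real k ^ 6) * Q l" by (simp add: algebra_simps)
      also have "\<dots> \<le> 32 * (sd 6 * C + 2 * real k ^ 6) * ((real k / 2) ^ 6 * Q m)"
        using Q_lower[of l 6] C0 unfolding m by (intro mult_left_mono) simp_all
      also have "\<dots> = (C / 2 + real k ^ 12) * Q m"
      proof -
        have "32 * (sd 6 * C + 2 * real k ^ 6) * (real k / 2) ^ 6 = (sd 6 * real k ^ 6) * C / 2 + real k ^ 6 * real k ^ 6"
          by (simp add: power_divide algebra_simps)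
        also have "\<dots> = C / 2 + real k ^ 12" unfolding sd_k by (simp add: power_add[symmetric])
        finally show ?thesis by (simp add: mult.assoc[symmetric])
      qed
      also have "\<dots> \<le> C * Q m"
      proof (rule mult_right_mono[OF _ Q_nonneg])
        have "0 \<le> (real N * real k) ^ 6" by simp
        thus "C / 2 + real k ^ 12 \<le> C" unfolding C_def by simp
      qed
      finally show ?thesis using o(1) by blast
    qed
  qed
  thus ?thesis using C0 by blast
qed

text \<open>The weight \<open>wt'\<close>, scaled by \<open>sd n\<close>, is copied into all
  \<open>N ^ n\<close> tiles. The end points of a crossing have distance at least 1, so by
  \<open>tile_decomposition\<close> the resulting weight is admissible.\<close>

lemma Q_growth_step:
  assumes F: "full m wt'"
  shows "Q (n + m) \<le> (real N / (real k)\<^sup>2) ^ n * mass m wt'"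
proof -
  have "admissible (n + m) (\<lambda>v. sd n * wt' (drop n v))"
    unfolding admissible_def
  proof (intro conjI allI impI)
    show "0 \<le> sd n * wt' (drop n v)" for v using full_nonneg[OF F] by simp
    fix vs assume L: "LR (n + m) vs"
    hence g: "gpath (n + m) vs" by (simp add: LR_def)
    have W: "hd vs \<in> W (n + m)" "last vs \<in> W (n + m)" using gpath_hd[OF g] gpath_last[OF g] .
    define p where "p = (0::real, py (hd vs))"
    define q where "q = (1::real, py (last vs))"
    note r = W_range[OF W(1)] W_range[OF W(2)]
    have y: "py (hd vs) \<le> 1" "py (last vs) \<le> 1" using r sd_nonneg[of "n + m"] by linarith+
    have x: "px (hd vs) = 0" "px (last vs) \<le> 1" "1 = px (last vs) + sd (n + m)"
      using L sd_nonneg[of "n + m"] unfolding LR_def by linarith+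
    have p: "p \<in> sq (hd vs)" "p \<in> bd"
      using x(1) y(1) r W_length[OF W(1)] by (simp_all add: p_def sq_def bd_def unit_square_def)
    have q: "q \<in> sq (last vs)" "q \<in> bd"
      using x(2,3) y(2) r W_length[OF W(2)] by (simp_all add: q_def sq_def bd_def unit_square_def)
    have "sd n * dinf p q \<le> sd n * len (\<lambda>v. sd n * wt' (drop n v)) vs"
      by (rule tile_decomposition[OF F _ g _ p(1) bd_splitE[OF W(1) p] q(1) bd_splitE[OF W(2) q]]) simp_all
    hence "dinf p q \<le> len (\<lambda>v. sd n * wt' (drop n v)) vs" by simp
    moreover have "1 \<le> dinf p q" by (simp add: dinf_def p_def q_def)
    ultimately show "1 \<le> len (\<lambda>v. sd n * wt' (drop n v)) vs" by linarith
  qed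
  from Q_le[OF this] have "Q (n + m) \<le> mass (n + m) (\<lambda>v. sd n * wt' (drop n v))" .
  also have "\<dots> = (\<Sum>t\<in>W n. mass m (\<lambda>u. sd n * wt' (drop n (t @ u))))" by (rule mass_append)
  also have "\<dots> = (\<Sum>t\<in>W n. (sd n)\<^sup>2 * mass m wt')"
    by (rule sum.cong) (simp_all add: W_length mass_scale)
  also have "\<dots> = real N ^ n * (sd n)\<^sup>2 * mass m wt'" by (simp add: card_W)
  also have "real N ^ n * (sd n)\<^sup>2 = (real N / (real k)\<^sup>2) ^ n"
    by (simp add: sd_def power_divide power_mult[symmetric] mult.commute)
  finally show ?thesis .
qed

lemma Q_growth: "\<exists>C>0. \<forall>n m. Q (n + m) \<le> C * (real N / (real k)\<^sup>2) ^ n * Q m"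
proof -
  obtain C where C: "C > 0" "\<And>m. \<exists>wt. full m wt \<and> mass m wt \<le> C * Q m" using full_exists by blast
  have "Q (n + m) \<le> C * (real N / (real k)\<^sup>2) ^ n * Q m" for n m
  proof -
    obtain wt where w: "full m wt" "mass m wt \<le> C * Q m" using C(2) by blast
    have "Q (n + m) \<le> (real N / (real k)\<^sup>2) ^ n * mass m wt" by (rule Q_growth_step[OF w(1)])
    also have "\<dots> \<le> (real N / (real k)\<^sup>2) ^ n * (C * Q m)" using w(2) by (rule mult_left_mono) simp
    finally show ?thesis by (simp add: mult_ac)
  qed
  thus ?thesis using C(1) by blast
qed

subsection \<open>Oscillation of functions of bounded energy\<close>

text \<open>The natural scale of variation: by \<open>LR_short\<close>, a weight of mass at most 2
  has a crossing of length below \<open>2 * res m\<close>.\<close>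

definition res :: "nat \<Rightarrow> real" where "res m = 1 / sqrt (Q m)"

definition res_sum :: "nat \<Rightarrow> real" where "res_sum m = (\<Sum>l\<le>m. res l)"

text \<open>\<open>wt\<close> plays the role of a discrete gradient of \<open>g\<close>. The bound 2
  is the normalisation for energy 1, since vertex weights count each edge twice. It passes to
  children unchanged, so all levels use the same class.\<close>

definition lip :: "nat \<Rightarrow> (nat list \<Rightarrow> real) \<Rightarrow> (nat list \<Rightarrow> real) \<Rightarrow> bool" where
  "lip m g wt \<longleftrightarrow> (\<forall>u. 0 \<le> wt u) \<and> (\<forall>u\<in>W m. \<forall>v\<in>W m. touch u v \<longrightarrow> \<bar>g u - g v\<bar> \<le> wt u) \<and> mass m wt \<le> 2"

text \<open>\<open>y\<close> is a typical value of \<open>g\<close>: up to \<open>8 * res m\<close>, it is the value of \<open>g\<close> on some left-right and some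
  bottom-top crossing. By planarity such crosses meet those of neighbouring squares and of other levels.\<close>

definition cross_value :: "nat \<Rightarrow> (nat list \<Rightarrow> real) \<Rightarrow> real \<Rightarrow> bool" where
  "cross_value m g y \<longleftrightarrow> (\<exists>\<alpha> \<beta>. LR m \<alpha> \<and> BT m \<beta> \<and> (\<forall>u\<in>set \<alpha> \<union> set \<beta>. \<bar>g u - y\<bar> \<le> 8 * res m))"

definition ring_const :: real where "ring_const = 8 * real k + 8"

lemma res_pos: "0 < res m" using Q_pos by (simp add: res_def)
lemma res_Q: "(res m)\<^sup>2 * Q m = 1" using Q_pos[of m] by (simp add: res_def power_divide)
lemma res_0: "res 0 = 1" by (simp add: res_def Q_0)
lemma res_sum_0: "res_sum 0 = 1" by (simp add: res_sum_def res_0)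
lemma res_sum_Suc: "res_sum (Suc m) = res_sum m + res (Suc m)" by (simp add: res_sum_def)
lemma res_le_sum: "res m \<le> res_sum m"
  unfolding res_sum_def by (rule member_le_sum) (simp_all add: less_imp_le[OF res_pos])
lemma res_sum_ge1: "1 \<le> res_sum m"
  by (induction m) (use res_pos in \<open>simp_all add: res_sum_0 res_sum_Suc add_increasing2 less_imp_le\<close>)

lemma lip_nonneg: "lip m g wt \<Longrightarrow> 0 \<le> wt u" by (simp add: lip_def)
lemma lipD: "lip m g wt \<Longrightarrow> u \<in> W m \<Longrightarrow> v \<in> W m \<Longrightarrow> touch u v \<Longrightarrow> \<bar>g u - g v\<bar> \<le> wt u"
  by (simp add: lip_def)
lemma lip_mass: "lip m g wt \<Longrightarrow> mass m wt \<le> 2" by (simp add: lip_def)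

lemma lip_child:
  assumes "lip (Suc m) g wt" "i \<in> Idx"
  shows "lip m (\<lambda>u. g (i # u)) (\<lambda>u. wt (i # u))"
proof -
  have "mass m (\<lambda>u. wt (i # u)) \<le> mass (Suc m) wt"
    unfolding mass_Suc by (rule member_le_sum[OF assms(2)]) (simp_all add: mass_nonneg)
  moreover have "\<bar>g (i # u) - g (i # v)\<bar> \<le> wt (i # u)" if "u \<in> W m" "v \<in> W m" "touch u v" for u v
  proof (rule lipD[OF assms(1)])
    show "i # u \<in> W (Suc m)" "i # v \<in> W (Suc m)" using that assms(2) in_W_Cons by blast+
    show "touch (i # u) (i # v)" using that touch_Cons W_length by metis
  qed
  ultimately show ?thesis using lip_nonneg[OF assms(1)] lip_mass[OF assms(1)] by (simp add: lip_def)
qed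

lemma path_variation:
  assumes L: "lip m g wt"
  shows "gpath m vs \<Longrightarrow> u \<in> set vs \<Longrightarrow> \<bar>g (hd vs) - g u\<bar> \<le> len wt vs"
proof (induction vs)
  case Nil thus ?case by simp
next
  case (Cons v vs)
  have nn: "0 \<le> len wt vs" using len_nonneg lip_nonneg[OF L] by blast
  show ?case
  proof (cases "u = v")
    case True thus ?thesis using nn lip_nonneg[OF L] by simp
  next
    case False
    hence u: "u \<in> set vs" using Cons.prems(2) by simp
    hence ne: "vs \<noteq> []" by auto
    have g: "gpath m [v]" "gpath m vs" "touch v (hd vs)"
      using Cons.prems(1) gpath_append_iff[of "[v]" vs m] ne by simp_all
    have "\<bar>g v - g (hd vs)\<bar> \<le> wt v"
      by (rule lipD[OF L _ gpath_hd[OF g(2)] g(3)]) (use gpath_hd[OF g(1)] in simp)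
    moreover have "\<bar>g (hd vs) - g u\<bar> \<le> len wt vs" by (rule Cons.IH[OF g(2) u])
    ultimately show ?thesis by simp
  qed
qed

lemma cross_gap:
  assumes L: "lip m g wt" and \<alpha>: "LR m \<alpha>" and \<beta>: "BT m \<beta>"
  obtains u v where "u \<in> set \<alpha>" "v \<in> set \<beta>" "\<bar>g u - g v\<bar> \<le> len wt \<alpha>"
proof -
  obtain u v where uv: "u \<in> set \<alpha>" "v \<in> set \<beta>" "touch u v" using crossing[OF \<alpha> \<beta>] by blast
  have g: "gpath m \<alpha>" "gpath m \<beta>" using \<alpha> \<beta> by (simp_all add: LR_def BT_def)
  have "\<bar>g u - g v\<bar> \<le> wt u" by (rule lipD[OF L gpath_W[OF g(1) uv(1)] gpath_W[OF g(2) uv(2)] uv(3)])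
  also have "\<dots> \<le> len wt \<alpha>" by (rule len_ge_member) (use lip_nonneg[OF L] uv(1) in simp_all)
  finally show ?thesis using that uv by blast
qed

lemma cross_value_exists:
  assumes L: "lip m g wt"
  shows "\<exists>y. cross_value m g y"
proof -
  \<comment> \<open>The factor 2 ensures \<open>mass m wt < t\<^sup>2 * Q m\<close>. A word of the
    cross is then within \<open>4 * t = 8 * res m\<close> of the value at
    \<open>hd \<alpha>\<close>: one \<open>t\<close> along \<open>\<alpha>\<close>, one for the
    contact and two along \<open>\<beta>\<close>.\<close>
  define t where "t = 2 * res m"
  have t: "0 < t" "mass m wt < t\<^sup>2 * Q m"
    using res_pos[of m] res_Q[of m] lip_mass[OF L] by (simp_all add: t_def power_mult_distrib mult.assoc)
  obtain \<alpha> where \<alpha>: "LR m \<alpha>" "len wt \<alpha> < t" using LR_short[OF lip_nonneg[OF L] t] by blast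
  obtain \<beta> where \<beta>: "BT m \<beta>" "len wt \<beta> < t" using BT_short[OF lip_nonneg[OF L] t] by blast
  have g: "gpath m \<alpha>" "gpath m \<beta>" using \<alpha>(1) \<beta>(1) by (simp_all add: LR_def BT_def)
  obtain u v where uv: "u \<in> set \<alpha>" "v \<in> set \<beta>" "\<bar>g u - g v\<bar> \<le> len wt \<alpha>" by (rule cross_gap[OF L \<alpha>(1) \<beta>(1)])
  have "\<bar>g x - g (hd \<alpha>)\<bar> \<le> 8 * res m" if "x \<in> set \<alpha> \<union> set \<beta>" for x
  proof (cases "x \<in> set \<alpha>")
    case True
    from path_variation[OF L g(1) this] \<alpha>(2) res_pos[of m] show ?thesis unfolding t_def by linarith
  next
    case False
    hence "x \<in> set \<beta>" using that by simp
    from path_variation[OF L g(2) this] path_variation[OF L g(2) uv(2)] path_variation[OF L g(1) uv(1)] uv(3) \<alpha>(2) \<beta>(2)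
    show ?thesis unfolding t_def by linarith
  qed
  thus ?thesis using \<alpha>(1) \<beta>(1) unfolding cross_value_def by blast
qed

text \<open>The cross of a square and that of its child need not meet. The row crossing of
  \<open>row_path\<close> meets the bottom-top part of the large cross, and its piece in square
  \<open>i\<close> meets that of the small one, so it links the two values.\<close>

lemma row_step:
  assumes L: "lip (Suc m) g wt" and y: "cross_value (Suc m) g y" and i: "i \<in> Idx"
    and row: "snd (c i) = 0 \<or> snd (c i) = 1 - 1 / real k"
    and y': "cross_value m (\<lambda>u. g (i # u)) y'"
  shows "\<bar>y - y'\<bar> \<le> ring_const * (res m + res (Suc m))"
proof -
  \<comment> \<open>Chosen to absorb the factor \<open>real k\<close> of \<open>row_path\<close>:
    \<open>real k * 2 < 4 * (real k)\<^sup>2 = t\<^sup>2 * Q m\<close>.\<close>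
  define t where "t = 2 * real k * res m"
  have t: "0 < t" using res_pos[of m] k_pos by (simp add: t_def)
  let ?R = "{j. j \<in> Idx \<and> snd (c j) = snd (c i)}"
  have "(\<Sum>j\<in>?R. mass m (\<lambda>u. wt (j # u))) \<le> mass (Suc m) wt"
    unfolding mass_Suc by (rule sum_mono2) (auto simp: mass_nonneg)
  hence "(\<Sum>j\<in>?R. mass m (\<lambda>u. wt (j # u))) \<le> 2" using lip_mass[OF L] by linarith
  hence "real k * (\<Sum>j\<in>?R. mass m (\<lambda>u. wt (j # u))) \<le> real k * 2" using k_pos by (intro mult_left_mono) simp_all
  also have "\<dots> < real k * (4 * real k)" using k_gt1 by (intro mult_strict_left_mono) simp_all
  also have "\<dots> = t\<^sup>2 * Q m"
  proof -
    have "t\<^sup>2 * Q m = (2 * real k)\<^sup>2 * ((res m)\<^sup>2 * Q m)" by (simp add: t_def power_mult_distrib mult.assoc)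
    thus ?thesis unfolding res_Q by (simp add: power2_eq_square)
  qed
  finally have small: "real k * (\<Sum>j\<in>?R. mass m (\<lambda>u. wt (j # u))) < t\<^sup>2 * Q m" .
  obtain \<gamma> where \<gamma>: "LR (Suc m) \<gamma>" "len wt \<gamma> < t"
    "\<forall>j\<in>Idx. snd (c j) = snd (c i) \<longrightarrow> (\<exists>\<gamma>'. LR m \<gamma>' \<and> (#) j ` set \<gamma>' \<subseteq> set \<gamma>)"
    using row_path[where wt = wt and n = m, OF row lip_nonneg[OF L] t small] by blast
  obtain \<gamma>' where \<gamma>': "LR m \<gamma>'" "(#) i ` set \<gamma>' \<subseteq> set \<gamma>" using \<gamma>(3) i by blast
  have g: "gpath (Suc m) \<gamma>" using \<gamma>(1) by (simp add: LR_def)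
  obtain \<beta> where \<beta>: "BT (Suc m) \<beta>" "\<And>u. u \<in> set \<beta> \<Longrightarrow> \<bar>g u - y\<bar> \<le> 8 * res (Suc m)"
    using y unfolding cross_value_def by blast
  obtain \<beta>' where \<beta>': "BT m \<beta>'" "\<And>u. u \<in> set \<beta>' \<Longrightarrow> \<bar>g (i # u) - y'\<bar> \<le> 8 * res m"
    using y' unfolding cross_value_def by blast
  obtain u v where uv: "u \<in> set \<gamma>" "v \<in> set \<beta>" "\<bar>g u - g v\<bar> \<le> len wt \<gamma>" by (rule cross_gap[OF L \<gamma>(1) \<beta>(1)])
  obtain u' v' where uv': "u' \<in> set \<gamma>'" "v' \<in> set \<beta>'" "touch u' v'" using crossing[OF \<gamma>'(1) \<beta>'(1)] by blast
  have W': "u' \<in> W m" "v' \<in> W m" using uv' \<gamma>'(1) \<beta>'(1) gpath_W unfolding LR_def BT_def by blast+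
  have iu: "i # u' \<in> set \<gamma>" using uv'(1) \<gamma>'(2) by blast
  have "\<bar>g (i # u') - g (i # v')\<bar> \<le> wt (i # u')" by (rule lipD[OF lip_child[OF L i] W' uv'(3)])
  also have "\<dots> \<le> len wt \<gamma>" by (rule len_ge_member[OF _ iu]) (rule lip_nonneg[OF L])
  finally have "\<bar>g (i # u') - g (i # v')\<bar> \<le> len wt \<gamma>" .
  \<comment> \<open>Two stretches of \<open>\<gamma>\<close> and two contacts give
    \<open>4 * t = 8 * real k * res m\<close>. Together with the two tolerances of the crosses this
    is the origin of \<open>ring_const\<close>.\<close>
  hence "\<bar>y - y'\<bar> \<le> 4 * t + 8 * res m + 8 * res (Suc m)"
    using uv(3) \<beta>(2)[OF uv(2)] \<beta>'(2)[OF uv'(2)] path_variation[OF L g uv(1)] path_variation[OF L g iu] \<gamma>(2)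
    by linarith
  also have "\<dots> \<le> ring_const * (res m + res (Suc m))"
    using res_pos[of "Suc m"] k_pos by (simp add: t_def ring_const_def algebra_simps)
  finally show ?thesis .
qed

lemma cross_value_tr:
  assumes "cross_value m g y" shows "cross_value m (\<lambda>u. g (tr u)) y"
proof -
  obtain \<alpha> \<beta> where ab: "LR m \<alpha>" "BT m \<beta>" "\<And>u. u \<in> set \<alpha> \<union> set \<beta> \<Longrightarrow> \<bar>g u - y\<bar> \<le> 8 * res m"
    using assms unfolding cross_value_def by blast
  have W: "set \<alpha> \<union> set \<beta> \<subseteq> W m" using ab(1,2) by (simp add: LR_def BT_def gpath_def)
  have "\<bar>g (tr u) - y\<bar> \<le> 8 * res m" if "u \<in> set (map tr \<beta>) \<union> set (map tr \<alpha>)" for u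
  proof -
    obtain v where v: "v \<in> set \<alpha> \<union> set \<beta>" "u = tr v" using \<open>u \<in> _\<close> by auto
    hence "tr u = v" using tr_tr[of v m] W by blast
    thus ?thesis using ab(3)[OF v(1)] by simp
  qed
  thus ?thesis using BT_tr[OF ab(2)] LR_tr[OF ab(1)] unfolding cross_value_def by blast
qed

lemma lip_tr:
  assumes "lip m g wt" shows "lip m (\<lambda>u. g (tr u)) (\<lambda>u. wt (tr u))"
  unfolding lip_def
proof (intro conjI ballI impI allI)
  show "mass m (\<lambda>u. wt (tr u)) \<le> 2" using lip_mass[OF assms] mass_tr by simp
  fix u v assume uv: "u \<in> W m" "v \<in> W m" "touch u v"
  show "\<bar>g (tr u) - g (tr v)\<bar> \<le> wt (tr u)"
    by (rule lipD[OF assms tr_W[OF uv(1)] tr_W[OF uv(2)]]) (use touch_tr[OF uv(1,2)] uv(3) in blast)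
qed (rule lip_nonneg[OF assms])

definition ring :: "nat \<Rightarrow> bool" where
  "ring i \<longleftrightarrow> (snd (c i) = 0 \<or> snd (c i) = 1 - 1 / real k) \<or> (fst (c i) = 0 \<or> fst (c i) = 1 - 1 / real k)"

text \<open>Columns are rows after transposition, and \<open>lip\<close> and
  \<open>cross_value\<close> are invariant under it.\<close>

lemma ring_step:
  assumes L: "lip (Suc m) g wt" and y: "cross_value (Suc m) g y" and i: "i \<in> Idx" "ring i"
    and y': "cross_value m (\<lambda>u. g (i # u)) y'"
  shows "\<bar>y - y'\<bar> \<le> ring_const * (res m + res (Suc m))"
proof (cases "snd (c i) = 0 \<or> snd (c i) = 1 - 1 / real k")
  case True thus ?thesis by (rule row_step[OF L y i(1) _ y'])
next
  case False
  hence r: "snd (c (tri i)) = 0 \<or> snd (c (tri i)) = 1 - 1 / real k"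
    using i(2) tri(2)[OF i(1)] by (simp add: ring_def)
  have "[i] \<in> W 1" using i(1) by (simp add: W_def)
  from tr_tr[OF this] have "tri (tri i) = i" by simp
  hence e: "(\<lambda>u. g (tr (tri i # u))) = (\<lambda>u. g (i # tr u))" by simp
  have "cross_value m (\<lambda>u. g (tr (tri i # u))) y'" unfolding e using cross_value_tr[OF y'] .
  from row_step[OF lip_tr[OF L] cross_value_tr[OF y] tri(1)[OF i(1)] r this] show ?thesis .
qed

lemma bd_child_ring:
  assumes "p \<in> bd" "i \<in> Idx" "q \<in> unit_square" "p = Psi [i] q"
  shows "ring i"
proof -
  obtain a b where q: "q = (a, b)" by force
  have e: "p = (fst (c i) + a / real k, snd (c i) + b / real k)"
    using assms(4) by (simp add: q Psi_eq sd_def)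
  have ab: "0 \<le> a" "a \<le> 1" "0 \<le> b" "b \<le> 1" using assms(3) by (auto simp: q unit_square_def)
  have l: "0 \<le> a / real k" "a / real k \<le> 1 / real k" "0 \<le> b / real k" "b / real k \<le> 1 / real k"
    using ab k_pos by (simp_all add: divide_right_mono)
  note r = idx_range[OF assms(2)]
  have "fst (c i) + a / real k = 0 \<or> fst (c i) + a / real k = 1 \<or> snd (c i) + b / real k = 0 \<or> snd (c i) + b / real k = 1"
    using assms(1) unfolding bd_def e by simp
  thus ?thesis unfolding ring_def using r l by linarith
qed

text \<open>\<open>ring_step\<close> compares each square containing \<open>p\<close> with its
  parent, down to a single word; the children on the way belong to the ring because \<open>p\<close>
  is on the boundary. Every level enters twice except the top one, hence
  \<open>2 * res_sum m - res m\<close>.\<close>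

lemma boundary_value:
  "lip m g wt \<Longrightarrow> cross_value m g y \<Longrightarrow> p \<in> bd \<Longrightarrow>
    \<exists>u\<in>W m. p \<in> sq u \<and> \<bar>g u - y\<bar> \<le> ring_const * (2 * res_sum m - res m)"
proof (induction m arbitrary: g wt y p)
  case 0
  obtain \<alpha> where a: "LR 0 \<alpha>" "\<And>u. u \<in> set \<alpha> \<Longrightarrow> \<bar>g u - y\<bar> \<le> 8 * res 0"
    using 0(2) unfolding cross_value_def by blast
  have "hd \<alpha> \<in> set \<alpha>" "hd \<alpha> \<in> W 0" using a(1) gpath_ne[of 0 \<alpha>] gpath_hd[of 0 \<alpha>] by (simp_all add: LR_def)
  hence "\<bar>g [] - y\<bar> \<le> 8" using a(2)[of "hd \<alpha>"] by (simp add: W_0 res_0)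
  moreover have "p \<in> sq []" using bd_unit[OF 0(3)] by (simp add: sq_Nil)
  ultimately show ?case by (intro bexI[of _ "[]"]) (simp_all add: res_0 res_sum_0 ring_const_def)
next
  case (Suc m)
  obtain i q where iq: "i \<in> Idx" "q \<in> bd" "p = Psi [i] q" using Suc.prems(3) by (rule bd_childE)
  have rg: "ring i" by (rule bd_child_ring[OF Suc.prems(3) iq(1) bd_unit[OF iq(2)] iq(3)])
  note L' = lip_child[OF Suc.prems(1) iq(1)]
  obtain y' where y': "cross_value m (\<lambda>u. g (i # u)) y'" using cross_value_exists[OF L'] by blast
  obtain u where u: "u \<in> W m" "q \<in> sq u" "\<bar>g (i # u) - y'\<bar> \<le> ring_const * (2 * res_sum m - res m)"
    using Suc.IH[OF L' y' iq(2)] by blast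
  have "\<bar>y - y'\<bar> \<le> ring_const * (res m + res (Suc m))" by (rule ring_step[OF Suc.prems(1,2) iq(1) rg y'])
  hence "\<bar>g (i # u) - y\<bar> \<le> ring_const * (2 * res_sum m - res m) + ring_const * (res m + res (Suc m))"
    using u(3) by linarith
  also have "\<dots> = ring_const * (2 * res_sum (Suc m) - res (Suc m))" by (simp add: res_sum_Suc algebra_simps)
  finally have "\<bar>g (i # u) - y\<bar> \<le> ring_const * (2 * res_sum (Suc m) - res (Suc m))" .
  moreover have "p \<in> sq (i # u)" using iq(3) u(2) sq_append[of "[i]" u] by simp
  moreover have "i # u \<in> W (Suc m)" using iq(1) u(1) in_W_Cons by blast
  ultimately show ?case by blast
qed

definition touch_const :: real where "touch_const = 4 * ring_const + 2"

lemma ring_const_pos: "0 < ring_const" using k_pos by (simp add: ring_const_def)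

text \<open>Touching squares share a point on both boundaries, near which
  \<open>boundary_value\<close> provides touching words of the two tiles; no alignment is involved.
  The summand 2 of \<open>touch_const\<close> pays for the jump between these words, as
  \<open>1 \<le> res_sum m\<close>.\<close>

lemma touching_tiles:
  assumes t: "t \<in> W n" "t' \<in> W n" "touch t t'" "t \<noteq> t'"
    and L: "lip m (\<lambda>u. f (t @ u)) wt" and y: "cross_value m (\<lambda>u. f (t @ u)) y"
    and L': "lip m (\<lambda>u. f (t' @ u)) wt'" and y': "cross_value m (\<lambda>u. f (t' @ u)) y'"
    and link: "\<And>u v. u \<in> W m \<Longrightarrow> v \<in> W m \<Longrightarrow> touch (t @ u) (t' @ v) \<Longrightarrow> \<bar>f (t @ u) - f (t' @ v)\<bar> \<le> 2"
  shows "\<bar>y - y'\<bar> \<le> touch_const * res_sum m"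
proof -
  obtain p where p: "p \<in> sq t" "p \<in> sq t'" using t(3) touch_iffW[OF t(1,2)] by blast
  obtain q where q: "p = Psi t q" "q \<in> unit_square" using p(1) Psi_sq by blast
  obtain q' where q': "p = Psi t' q'" "q' \<in> unit_square" using p(2) Psi_sq by blast
  have b: "q \<in> bd" using sq_inter_bd[OF t(1,2,4) _ q(2)] p(2) q(1) by simp
  have b': "q' \<in> bd" using sq_inter_bd[OF t(2,1) not_sym[OF t(4)] _ q'(2)] p(1) q'(1) by simp
  obtain u where u: "u \<in> W m" "q \<in> sq u" "\<bar>f (t @ u) - y\<bar> \<le> ring_const * (2 * res_sum m - res m)"
    using boundary_value[OF L y b] by blast
  obtain v where v: "v \<in> W m" "q' \<in> sq v" "\<bar>f (t' @ v) - y'\<bar> \<le> ring_const * (2 * res_sum m - res m)"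
    using boundary_value[OF L' y' b'] by blast
  have "p \<in> sq (t @ u)" "p \<in> sq (t' @ v)" using u(2) v(2) q(1) q'(1) sq_append by blast+
  hence "touch (t @ u) (t' @ v)" using touchW[OF W_append[OF t(1) u(1)] W_append[OF t(2) v(1)]] by blast
  from link[OF u(1) v(1) this] have "\<bar>y - y'\<bar> \<le> 2 * (ring_const * (2 * res_sum m - res m)) + 2"
    using u(3) v(3) by linarith
  also have "\<dots> \<le> touch_const * res_sum m"
  proof -
    have "0 \<le> ring_const * res m" using ring_const_pos res_pos[of m] by simp
    thus ?thesis using res_sum_ge1[of m] by (simp add: touch_const_def algebra_simps)
  qed
  finally show ?thesis .
qed

section \<open>From the ring to all children, and from crosses to single words\<close>

lemma lip_le2:
  assumes "lip m g wt" "u \<in> W m" shows "wt u \<le> 2"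
proof -
  have "(wt u)\<^sup>2 \<le> mass m wt" unfolding mass_def by (rule member_le_sum) (use assms(2) in simp_all)
  hence "(wt u)\<^sup>2 \<le> 2\<^sup>2" using lip_mass[OF assms(1)] by simp
  thus ?thesis by (rule power2_le_imp_le) simp
qed

text \<open>Interior squares lie in no aligned row, so \<open>ring_step\<close> does not reach them.
  The constant may depend on the square but neither on the level nor on the function, which makes
  finitely many steps through touching squares affordable.\<close>

definition child_bound :: "nat \<Rightarrow> real \<Rightarrow> bool" where
  "child_bound i d \<longleftrightarrow> (\<forall>m g wt y y'. lip (Suc m) g wt \<longrightarrow> cross_value (Suc m) g y \<longrightarrow>
     cross_value m (\<lambda>u. g (i # u)) y' \<longrightarrow> \<bar>y - y'\<bar> \<le> d * res_sum (Suc m))"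

lemma child_bound_mono: "child_bound i d \<Longrightarrow> d \<le> d' \<Longrightarrow> child_bound i d'"
  unfolding child_bound_def
  by (meson order_trans mult_right_mono res_sum_ge1 zero_le_one)

lemma child_bound_ring:
  assumes "i \<in> Idx" "ring i" shows "child_bound i ring_const"
  unfolding child_bound_def
proof (intro allI impI)
  fix m g wt y y'
  assume "lip (Suc m) g wt" "cross_value (Suc m) g y" "cross_value m (\<lambda>u. g (i # u)) y'"
  from ring_step[OF this(1,2) assms this(3)]
  have "\<bar>y - y'\<bar> \<le> ring_const * (res m + res (Suc m))" .
  also have "\<dots> \<le> ring_const * res_sum (Suc m)"
    using ring_const_pos res_le_sum[of m] by (simp add: res_sum_Suc)
  finally show "\<bar>y - y'\<bar> \<le> ring_const * res_sum (Suc m)" .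
qed

lemma child_bound_step:
  assumes i: "i \<in> Idx" and j: "j \<in> Idx" and t: "touch [i] [j]" and b: "child_bound i d"
  shows "child_bound j (d + touch_const)"
proof (cases "i = j")
  case True
  have "0 \<le> touch_const" using ring_const_pos by (simp add: touch_const_def)
  thus ?thesis using child_bound_mono[OF b, of "d + touch_const"] True by simp
next
  case False
  show ?thesis
    unfolding child_bound_def
  proof (intro allI impI)
    fix m g wt y y'
    assume L: "lip (Suc m) g wt" and y: "cross_value (Suc m) g y" and y': "cross_value m (\<lambda>u. g (j # u)) y'"
    note Li = lip_child[OF L i] and Lj = lip_child[OF L j]
    obtain yi where yi: "cross_value m (\<lambda>u. g (i # u)) yi" using cross_value_exists[OF Li] by blast
    have "\<bar>y - yi\<bar> \<le> d * res_sum (Suc m)" using b L y yi unfolding child_bound_def by blast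
    moreover have "\<bar>yi - y'\<bar> \<le> touch_const * res_sum m"
    proof (rule touching_tiles[of "[i]" 1 "[j]" m g])
      show "[i] \<in> W 1" "[j] \<in> W 1" using i j by (simp_all add: W_def)
      show "[i] \<noteq> [j]" using False by simp
      show "lip m (\<lambda>u. g ([i] @ u)) (\<lambda>u. wt (i # u))" "lip m (\<lambda>u. g ([j] @ u)) (\<lambda>u. wt (j # u))"
        using Li Lj by simp_all
      show "cross_value m (\<lambda>u. g ([i] @ u)) yi" "cross_value m (\<lambda>u. g ([j] @ u)) y'" using yi y' by simp_all
      fix u v assume uv: "u \<in> W m" "v \<in> W m" "touch ([i] @ u) ([j] @ v)"
      have W: "[i] @ u \<in> W (Suc m)" "[j] @ v \<in> W (Suc m)" using uv(1,2) i j in_W_Cons by simp_all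
      show "\<bar>g ([i] @ u) - g ([j] @ v)\<bar> \<le> 2"
        using lipD[OF L W uv(3)] lip_le2[OF L W(1)] by linarith
    qed (rule t)
    moreover have "touch_const * res_sum m \<le> touch_const * res_sum (Suc m)"
      using res_pos[of "Suc m"] ring_const_pos by (intro mult_left_mono) (simp_all add: res_sum_Suc touch_const_def)
    ultimately show "\<bar>y - y'\<bar> \<le> (d + touch_const) * res_sum (Suc m)" unfolding distrib_right by linarith
  qed
qed

text \<open>This is where \<open>connectivity\<close> enters: the squares reachable from
  \<open>r\<close> and the remaining ones would otherwise have disjoint closed unions that cover a
  connected set.\<close>

lemma children_connected:
  assumes r: "r \<in> Idx" and i: "i \<in> Idx"
  shows "(\<lambda>i j. i \<in> Idx \<and> j \<in> Idx \<and> touch [i] [j])\<^sup>*\<^sup>* r i"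
proof (rule ccontr)
  assume neg: "\<not> ?thesis"
  let ?rel = "\<lambda>i j. i \<in> Idx \<and> j \<in> Idx \<and> touch [i] [j]"
  define Z where "Z = {i \<in> Idx. ?rel\<^sup>*\<^sup>* r i}"
  define A where "A = (\<Union>i\<in>Z. sq [i])"
  define B where "B = (\<Union>i\<in>Idx - Z. sq [i])"
  have sqi: "similarity k c j ` unit_square = sq [j]" for j
    unfolding Psi_sq[symmetric] by (simp add: Psi_Cons)
  have U: "(\<Union>i\<in>Idx. similarity k c i ` unit_square) = A \<union> B"
    unfolding sqi A_def B_def Z_def by blast
  have cl: "closed (sq [j])" for j unfolding sq_def by (intro closed_Times closed_atLeastAtMost)
  have "finite Z" unfolding Z_def by simp
  have "closed A" "closed B" unfolding A_def B_def using cl \<open>finite Z\<close> by (simp_all add: closed_UN)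
  moreover have "A \<inter> B = {}"
  proof (rule ccontr)
    assume "A \<inter> B \<noteq> {}"
    then obtain z j l where z: "j \<in> Z" "l \<in> Idx - Z" "z \<in> sq [j]" "z \<in> sq [l]" unfolding A_def B_def by blast
    have "touch [j] [l]" by (rule touchI[OF _ z(3,4)]) simp
    hence "?rel j l" using z(1,2) unfolding Z_def by blast
    hence "?rel\<^sup>*\<^sup>* r l" using z(1) unfolding Z_def by (metis (no_types, lifting) mem_Collect_eq rtranclp.rtrancl_into_rtrancl)
    thus False using z(2) unfolding Z_def by blast
  qed
  moreover have "A \<noteq> {}"
  proof -
    have "r \<in> Z" using r unfolding Z_def by simp
    moreover have "(px [r], py [r]) \<in> sq [r]" unfolding sq_def mem_Times_iff by simp
    ultimately show ?thesis unfolding A_def by blast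
  qed
  moreover have "B \<noteq> {}"
  proof -
    have "i \<in> Idx - Z" using i neg unfolding Z_def by blast
    moreover have "(px [i], py [i]) \<in> sq [i]" unfolding sq_def mem_Times_iff by simp
    ultimately show ?thesis unfolding B_def by blast
  qed
  moreover have "connected (A \<union> B)" using connectivity unfolding U .
  ultimately show False unfolding connected_closed by blast
qed

text \<open>The chain starts at the corner square at the origin, which belongs to the ring, and each
  contact adds \<open>touch_const\<close>.\<close>

lemma child_bound_exists: "i \<in> Idx \<Longrightarrow> \<exists>d\<ge>0. child_bound i d"
proof -
  assume i: "i \<in> Idx"
  obtain r where r: "r \<in> Idx" "c r = (0, 0)" using bottom_exists[of 0] k_ge by auto
  have "ring r" using r(2) by (simp add: ring_def)
  from children_connected[OF r(1) i] show ?thesis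
  proof (induction rule: rtranclp_induct)
    case base
    show ?case using child_bound_ring[OF r(1) \<open>ring r\<close>] ring_const_pos less_imp_le by blast
  next
    case (step j l)
    then obtain d where d: "0 \<le> d" "child_bound j d" by blast
    have "child_bound l (d + touch_const)" using child_bound_step[of j l d] step(2) d(2) by blast
    moreover have "0 \<le> d + touch_const" using d(1) ring_const_pos by (simp add: touch_const_def)
    ultimately show ?case by blast
  qed
qed

lemma child_bound_uniform: "\<exists>d\<ge>0. \<forall>i\<in>Idx. child_bound i d"
proof -
  have "\<forall>i\<in>Idx. \<exists>d. 0 \<le> d \<and> child_bound i d" using child_bound_exists by blast
  from bchoice[OF this] obtain h where h: "\<forall>i\<in>Idx. 0 \<le> h i \<and> child_bound i (h i)" ..
  have "child_bound i (sum h Idx)" if "i \<in> Idx" for i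
  proof (rule child_bound_mono)
    show "child_bound i (h i)" using h that by blast
    show "h i \<le> sum h Idx" by (rule member_le_sum[OF that]) (use h in simp_all)
  qed
  moreover have "0 \<le> sum h Idx" by (rule sum_nonneg) (use h in simp)
  ultimately show ?thesis by blast
qed

text \<open>One letter of \<open>u\<close> is removed at a time. The step from level
  \<open>l\<close> to its child costs \<open>D * res_sum l\<close>, and \<open>8 \<le> D\<close>
  takes care of level 0.\<close>

lemma point_value:
  assumes D: "8 \<le> D" "\<And>i. i \<in> Idx \<Longrightarrow> child_bound i D"
  shows "lip m g wt \<Longrightarrow> cross_value m g y \<Longrightarrow> u \<in> W m \<Longrightarrow> \<bar>g u - y\<bar> \<le> D * (\<Sum>l\<le>m. res_sum l)"
proof (induction m arbitrary: g wt y u)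
  case 0
  obtain \<alpha> where a: "LR 0 \<alpha>" "\<And>u. u \<in> set \<alpha> \<Longrightarrow> \<bar>g u - y\<bar> \<le> 8 * res 0"
    using 0(2) unfolding cross_value_def by blast
  have "hd \<alpha> \<in> set \<alpha>" "hd \<alpha> \<in> W 0" using a(1) gpath_ne[of 0 \<alpha>] gpath_hd[of 0 \<alpha>] by (simp_all add: LR_def)
  hence "\<bar>g [] - y\<bar> \<le> 8" using a(2)[of "hd \<alpha>"] by (simp add: W_0 res_0)
  thus ?case using 0(3) D(1) by (simp add: W_0 res_sum_0)
next
  case (Suc m)
  obtain i v where u: "u = i # v" "i \<in> Idx" "v \<in> W m" using Suc.prems(3) by (rule W_SucE)
  note L' = lip_child[OF Suc.prems(1) u(2)]
  obtain y' where y': "cross_value m (\<lambda>u. g (i # u)) y'" using cross_value_exists[OF L'] by blast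
  have "\<bar>g (i # v) - y'\<bar> \<le> D * (\<Sum>l\<le>m. res_sum l)" by (rule Suc.IH[OF L' y' u(3)])
  moreover have "\<bar>y - y'\<bar> \<le> D * res_sum (Suc m)"
    using D(2)[OF u(2)] Suc.prems(1,2) y' unfolding child_bound_def by blast
  ultimately show ?case unfolding u(1) by (simp add: distrib_left)
qed

text \<open>The upper bound on \<open>N\<close> enters here: it makes \<open>q < 1\<close>, so by
  \<open>Q_growth\<close> the numbers \<open>res l\<close> grow at least geometrically up to a
  constant, and their sum is comparable to its last term.\<close>

lemma res_sum_bound: "\<exists>E>0. \<forall>m. res_sum m \<le> E * res m"
proof -
  obtain C where C: "C > 0" "\<And>n m. Q (n + m) \<le> C * (real N / (real k)\<^sup>2) ^ n * Q m" using Q_growth by blast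
  define q where "q = real N / (real k)\<^sup>2"
  have k1: "1 \<le> k\<^sup>2" using k_ge by simp
  hence "N < k\<^sup>2" using N_le by linarith
  hence "real N < (real k)\<^sup>2" using of_nat_less_iff[of N "k\<^sup>2", where 'a = real] by simp
  hence q: "0 \<le> q" "q < 1" using k_pos by (simp_all add: q_def)
  define s where "s = sqrt q"
  have s: "0 \<le> s" "s < 1" using q by (simp_all add: s_def)
  have step: "res l \<le> sqrt C * s ^ n * res (n + l)" for l n
  proof -
    have "sqrt (Q (n + l)) \<le> sqrt (C * q ^ n * Q l)" using C(2)[of n l] unfolding q_def by (rule real_sqrt_le_mono)
    also have "\<dots> = sqrt C * s ^ n * sqrt (Q l)" by (simp add: real_sqrt_mult real_sqrt_power s_def)
    finally have "sqrt (Q (n + l)) \<le> sqrt C * s ^ n * sqrt (Q l)" .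
    thus ?thesis using Q_pos[of l] Q_pos[of "n + l"] by (simp add: res_def field_simps)
  qed
  define E where "E = sqrt C / (1 - s)"
  have "res_sum m \<le> E * res m" for m
  proof -
    have "res_sum m \<le> (\<Sum>l\<le>m. sqrt C * s ^ (m - l) * res m)"
      unfolding res_sum_def
    proof (rule sum_mono)
      fix l assume "l \<in> {..m}"
      thus "res l \<le> sqrt C * s ^ (m - l) * res m" using step[of l "m - l"] by simp
    qed
    also have "\<dots> = sqrt C * (\<Sum>l\<le>m. s ^ (m - l)) * res m" by (simp add: sum_distrib_left sum_distrib_right)
    also have "(\<Sum>l\<le>m. s ^ (m - l)) = (\<Sum>l\<le>m. s ^ l)"
      using sum.nat_diff_reindex[of "\<lambda>l. s ^ l" "Suc m"] by (simp add: lessThan_Suc_atMost)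
    also have "sqrt C * (\<Sum>l\<le>m. s ^ l) * res m \<le> sqrt C * (1 / (1 - s)) * res m"
    proof (intro mult_right_mono mult_left_mono)
      have "(\<Sum>l\<le>m. s ^ l) = (1 - s ^ Suc m) / (1 - s)" using s sum_gp0[of s m] by simp
      also have "\<dots> \<le> 1 / (1 - s)" using s by (intro divide_right_mono) simp_all
      finally show "(\<Sum>l\<le>m. s ^ l) \<le> 1 / (1 - s)" .
    qed (use C(1) res_pos[of m] in simp_all)
    finally show ?thesis by (simp add: E_def)
  qed
  moreover have "0 < E" using C(1) s by (simp add: E_def)
  ultimately show ?thesis by blast
qed

lemma cat_single: "{w} \<cdot> A = (@) w ` A"
  by (auto simp: cat_def)

lemma average_near:
  assumes "finite A" "A \<noteq> {}" "\<And>x. x \<in> A \<Longrightarrow> \<bar>f x - y\<bar> \<le> e"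
  shows "\<bar>average A f - y\<bar> \<le> e"
proof -
  have c: "0 < real (card A)" using assms(1,2) by (simp add: card_gt_0_iff)
  have "average A f - y = (\<Sum>x\<in>A. f x - y) / real (card A)"
    using c by (simp add: average_def sum_subtractf diff_divide_distrib)
  moreover have "\<bar>\<Sum>x\<in>A. f x - y\<bar> \<le> real (card A) * e"
    by (rule order_trans[OF sum_abs sum_bounded_above[OF assms(3)]])
  ultimately show ?thesis using c by (simp add: abs_divide divide_le_eq mult.commute)
qed

text \<open>Each average is close to the cross value of its tile by \<open>point_value\<close>, and
  the cross values of touching tiles are close by \<open>touching_tiles\<close>. The constant
  \<open>M\<close> collects these three terms.\<close>

lemma oscillation_bound:
  "\<exists>C>0. \<forall>m n w w' f. w \<in> W n \<longrightarrow> w' \<in> W n \<longrightarrow> adj w w' \<longrightarrow> energy ({w, w'} \<cdot> W m) f = 1 \<longrightarrow>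
     (average ({w} \<cdot> W m) f - average ({w'} \<cdot> W m) f)\<^sup>2 \<le> C / Q m"
proof -
  obtain d where d: "d \<ge> 0" "\<forall>i\<in>Idx. child_bound i d" using child_bound_uniform by blast
  define D where "D = d + 8"
  have D: "8 \<le> D" "\<And>i. i \<in> Idx \<Longrightarrow> child_bound i D"
    using d child_bound_mono[of _ d D] by (simp_all add: D_def)
  obtain E where E: "E > 0" "\<And>m. res_sum m \<le> E * res m" using res_sum_bound by blast
  \<comment> \<open>\<open>res_sum_bound\<close> is applied twice, because
    \<open>point_value\<close> involves a sum of the sums \<open>res_sum\<close>.\<close>
  have SS: "(\<Sum>l\<le>m. res_sum l) \<le> E\<^sup>2 * res m" for m
  proof -
    have "(\<Sum>l\<le>m. res_sum l) \<le> (\<Sum>l\<le>m. E * res l)" by (rule sum_mono) (rule E(2))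
    also have "\<dots> = E * res_sum m" by (simp add: res_sum_def sum_distrib_left)
    also have "\<dots> \<le> E * (E * res m)" using E by (intro mult_left_mono) simp_all
    finally show ?thesis by (simp add: power2_eq_square mult.assoc)
  qed
  define M where "M = 2 * D * E\<^sup>2 + touch_const * E"
  have tc: "0 < touch_const" using ring_const_pos by (simp add: touch_const_def)
  have M0: "0 < M" using D(1) E(1) tc by (simp add: M_def add_nonneg_pos)
  have main: "(average ({w} \<cdot> W m) f - average ({w'} \<cdot> W m) f)\<^sup>2 \<le> M\<^sup>2 / Q m"
    if w: "w \<in> W n" "w' \<in> W n" "adj w w'" and en: "energy ({w, w'} \<cdot> W m) f = 1" for m n w w' f
  proof -
    define A where "A = {w, w'} \<cdot> W m"
    have A_eq: "A = (@) w ` W m \<union> (@) w' ` W m" unfolding A_def by (auto simp: cat_def)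
    have finA: "finite A" unfolding A_eq by simp
    have AW: "v \<in> A \<Longrightarrow> v \<in> W (n + m)" for v using W_append w(1,2) unfolding A_eq by blast
    have tw: "w \<noteq> w'" "touch w w'" using adj_iff[OF w(1,2)] w(3) by blast+
    \<comment> \<open>Differences to neighbours in both tiles are included, so that
      \<open>wt\<close> also controls the jump between the tiles. Summing the squares counts each
      edge twice, which turns energy 1 into mass 2.\<close>
    define wt where "wt v = sqrt (\<Sum>v' | v' \<in> A \<and> adj v v'. (f v - f v')\<^sup>2)" for v
    have wt0: "0 \<le> wt v" for v by (simp add: wt_def sum_nonneg)
    have wtsq: "(wt v)\<^sup>2 = (\<Sum>v' | v' \<in> A \<and> adj v v'. (f v - f v')\<^sup>2)" for v
      by (simp add: wt_def sum_nonneg)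
    have link: "\<bar>f u - f v\<bar> \<le> wt u" if "u \<in> A" "v \<in> A" "touch u v" for u v
    proof (cases "u = v")
      case True thus ?thesis using wt0 by simp
    next
      case False
      hence "adj u v" using adj_iff[OF AW[OF that(1)] AW[OF that(2)]] that(3) by blast
      hence "(f u - f v)\<^sup>2 \<le> (\<Sum>v' | v' \<in> A \<and> adj u v'. (f u - f v')\<^sup>2)"
        using that(2) finA by (intro member_le_sum[of v _ "\<lambda>v'. (f u - f v')\<^sup>2"]) simp_all
      hence "\<bar>f u - f v\<bar>\<^sup>2 \<le> (wt u)\<^sup>2" unfolding wtsq by simp
      thus ?thesis using wt0 by (rule power2_le_imp_le)
    qed
    have tot: "(\<Sum>v\<in>A. (wt v)\<^sup>2) = 2"
    proof -
      have "{(v, v'). v \<in> A \<and> v' \<in> A \<and> adj v v'} = Sigma A (\<lambda>v. {v'. v' \<in> A \<and> adj v v'})" by blast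
      hence "energy A f = 1 / 2 * (\<Sum>(v, v')\<in>Sigma A (\<lambda>v. {v'. v' \<in> A \<and> adj v v'}). (f v - f v')\<^sup>2)"
        unfolding energy_def by simp
      also have "\<dots> = 1 / 2 * (\<Sum>v\<in>A. (wt v)\<^sup>2)"
        unfolding wtsq using finA by (subst sum.Sigma) simp_all
      finally show ?thesis using en unfolding A_def by simp
    qed
    have L: "lip m (\<lambda>u. f (x @ u)) (\<lambda>u. wt (x @ u))" if x: "x = w \<or> x = w'" for x
      unfolding lip_def
    proof (intro conjI allI ballI impI)
      have "mass m (\<lambda>u. wt (x @ u)) = (\<Sum>v\<in>(@) x ` W m. (wt v)\<^sup>2)"
        unfolding mass_def by (simp add: sum.reindex inj_on_def)
      also have "\<dots> \<le> (\<Sum>v\<in>A. (wt v)\<^sup>2)"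
        by (rule sum_mono2) (use finA x in \<open>auto simp: A_eq\<close>)
      finally show "mass m (\<lambda>u. wt (x @ u)) \<le> 2" unfolding tot .
      fix u v assume uv: "u \<in> W m" "v \<in> W m" "touch u v"
      have "x @ u \<in> A" "x @ v \<in> A" using x uv(1,2) unfolding A_eq by blast+
      moreover have "touch (x @ u) (x @ v)"
        using touch_append[of u v x] uv W_length[OF uv(1)] W_length[OF uv(2)] by simp
      ultimately show "\<bar>f (x @ u) - f (x @ v)\<bar> \<le> wt (x @ u)" by (rule link)
    qed (rule wt0)
    note Lw = L[OF disjI1[OF refl]] and Lw' = L[OF disjI2[OF refl]]
    obtain y where y: "cross_value m (\<lambda>u. f (w @ u)) y" using cross_value_exists[OF Lw] by blast
    obtain y' where y': "cross_value m (\<lambda>u. f (w' @ u)) y'" using cross_value_exists[OF Lw'] by blast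
    have yy: "\<bar>y - y'\<bar> \<le> touch_const * res_sum m"
    proof (rule touching_tiles[OF w(1,2) tw(2,1) Lw y Lw' y'])
      fix u v assume uv: "u \<in> W m" "v \<in> W m" "touch (w @ u) (w' @ v)"
      have "w @ u \<in> A" "w' @ v \<in> A" using uv(1,2) unfolding A_eq by blast+
      from link[OF this uv(3)] lip_le2[OF Lw uv(1)] show "\<bar>f (w @ u) - f (w' @ v)\<bar> \<le> 2" by linarith
    qed
    define e where "e = D * (E\<^sup>2 * res m)"
    have "0 < N" using N_ge k_ge by linarith
    hence "card (W m) \<noteq> 0" by (simp add: card_W)
    hence ne: "W m \<noteq> {}" by (metis card.empty)
    have av: "\<bar>average ({x} \<cdot> W m) f - z\<bar> \<le> e"
      if "lip m (\<lambda>u. f (x @ u)) (\<lambda>u. wt (x @ u))" "cross_value m (\<lambda>u. f (x @ u)) z" for x z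
      unfolding cat_single
    proof (rule average_near)
      fix v assume "v \<in> (@) x ` W m"
      then obtain u where u: "u \<in> W m" "v = x @ u" by blast
      have "\<bar>f (x @ u) - z\<bar> \<le> D * (\<Sum>l\<le>m. res_sum l)" by (rule point_value[OF D that u(1)])
      also have "\<dots> \<le> e" unfolding e_def using SS D(1) by (intro mult_left_mono) simp_all
      finally show "\<bar>f v - z\<bar> \<le> e" unfolding u(2) .
    qed (use ne in simp_all)
    have "touch_const * res_sum m \<le> touch_const * (E * res m)" using E(2) tc by (intro mult_left_mono) simp_all
    hence "\<bar>average ({w} \<cdot> W m) f - average ({w'} \<cdot> W m) f\<bar> \<le> 2 * e + touch_const * (E * res m)"
      using av[OF Lw y] av[OF Lw' y'] yy by linarith
    also have "\<dots> = M * res m" by (simp add: M_def e_def algebra_simps)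
    finally have "\<bar>average ({w} \<cdot> W m) f - average ({w'} \<cdot> W m) f\<bar>\<^sup>2 \<le> (M * res m)\<^sup>2"
      by (rule power_mono) simp
    also have "\<dots> = M\<^sup>2 / Q m" using Q_pos[of m] by (simp add: res_def power_mult_distrib power_divide)
    finally show ?thesis by simp
  qed
  have "0 < M\<^sup>2" using M0 by simp
  thus ?thesis using main by blast
qed

subsection \<open>Squares at a small distance\<close>

text \<open>All eight symmetries of the square: \<open>side_map\<close> brings one side to the
  bottom, and the reflection \<open>hx\<close> keeps it there.\<close>

definition sym8 :: "nat \<Rightarrow> bool \<Rightarrow> nat list \<Rightarrow> nat list" where
  "sym8 a b v = (if b then hx (side_map a v) else side_map a v)"

lemma sym8_W: "v \<in> W n \<Longrightarrow> sym8 a b v \<in> W n"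
  using side_map_W[of v n a] hx_W[of "side_map a v" n] by (simp add: sym8_def del: map_map)

lemma sym8_touch: "u \<in> W n \<Longrightarrow> v \<in> W n \<Longrightarrow> touch (sym8 a b u) (sym8 a b v) \<longleftrightarrow> touch u v"
  using side_map_touch[of u n v a] touch_hx[of "side_map a u" n "side_map a v"] side_map_W[of u n a] side_map_W[of v n a]
  by (simp add: sym8_def del: map_map)

lemma sym8_surj:
  assumes "x \<in> W n" obtains x' where "x' \<in> W n" "x = sym8 a b x'"
proof -
  have "bij_betw (hx \<circ> side_map a) (W n) (W n)" by (rule bij_betw_trans[OF side_map_bij bij_hx])
  moreover have "sym8 a b = (if b then hx \<circ> side_map a else side_map a)" by (rule ext) (simp add: sym8_def)
  ultimately have "bij_betw (sym8 a b) (W n) (W n)" using side_map_bij by simp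
  hence "x \<in> sym8 a b ` W n" using assms unfolding bij_betw_def by blast
  thus ?thesis using that by blast
qed

lemma sym8_snoc:
  assumes "i \<in> Idx" obtains j where "j \<in> Idx" "\<And>P. sym8 a b (P @ [i]) = sym8 a b P @ [j]"
proof -
  have e: "sym8 a b (P @ [i]) = sym8 a b P @ sym8 a b [i]" for P
    by (simp add: sym8_def side_map_def)
  have "[i] \<in> W 1" using assms by (simp add: W_def)
  from sym8_W[OF this, of a b] obtain j where j: "sym8 a b [i] = [j]" "j \<in> Idx" unfolding W_1 by blast
  show ?thesis using that[OF j(2)] e j(1) by simp
qed

text \<open>Expressed through corners; the squares themselves are then less than
  \<open>eps * sd n\<close> apart in the metric \<open>dinf\<close>.\<close>

definition near :: "nat \<Rightarrow> real \<Rightarrow> nat list \<Rightarrow> nat list \<Rightarrow> bool" where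
  "near n eps w v \<longleftrightarrow> \<bar>px w - px v\<bar> < (1 + eps) * sd n \<and> \<bar>py w - py v\<bar> < (1 + eps) * sd n"

lemma near_side_map:
  assumes "w \<in> W n" "v \<in> W n" "near n eps w v"
  shows "near n eps (side_map a w) (side_map a v)"
proof -
  have s: "side_map a = side_map 0 \<or> side_map a = side_map 1 \<or> side_map a = side_map 2 \<or> side_map a = side_map 3"
  proof -
    consider "a = 0" | "a = 1" | "a = 2" | "a \<noteq> 0 \<and> a \<noteq> 1 \<and> a \<noteq> 2" by blast
    thus ?thesis
    proof cases
      case 4
      hence "side_map a = side_map 3" by (intro ext) (simp add: side_map_def del: map_map)
      thus ?thesis by blast
    qed simp_all
  qed
  thus ?thesis using assms(3) unfolding near_def
    by (elim disjE) (simp_all only: side_map_pos[OF assms(1)] side_map_pos[OF assms(2)], auto simp: abs_minus_commute)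
qed

lemma near_sym8:
  assumes "w \<in> W n" "v \<in> W n" "near n eps w v"
  shows "near n eps (sym8 a b w) (sym8 a b v)"
proof -
  have "near n eps (side_map a w) (side_map a v)" by (rule near_side_map[OF assms])
  moreover from this have "near n eps (hx (side_map a w)) (hx (side_map a v))"
    using hx_pos[OF side_map_W[OF assms(1)], of a] hx_pos[OF side_map_W[OF assms(2)], of a]
    unfolding near_def by (simp add: abs_minus_commute)
  ultimately show ?thesis by (simp add: sym8_def del: map_map)
qed

text \<open>The only way in which two squares of the same level can be very close without touching:
  they lie on opposite sides of a common line, and one of them has a neighbour in its row that touches both.\<close>

definition flat :: "nat \<Rightarrow> nat list \<Rightarrow> nat list \<Rightarrow> bool" where
  "flat n w v \<longleftrightarrow> py v = py w + sd n \<and> px w + sd n < px v \<and>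
     (\<exists>x\<in>W n. (py x = py w \<and> px x = px w + sd n) \<or> (py x = py v \<and> px x = px v - sd n))"

text \<open>Distances of level-one squares from the four sides, and signed gaps between two such
  squares in each coordinate. By \<open>gap_const\<close>, none of these finitely many numbers is
  positive and below \<open>eps / real k\<close>, and this one fact controls all levels.\<close>

definition gaps :: "nat \<Rightarrow> nat \<Rightarrow> real set" where
  "gaps i j = {fst (c i), snd (c i), 1 - 1 / real k - fst (c i), 1 - 1 / real k - snd (c i),
        \<bar>fst (c i) - fst (c j)\<bar> - 1 / real k, \<bar>snd (c i) - snd (c j)\<bar> - 1 / real k}"

definition gap_const :: "real \<Rightarrow> bool" where
  "gap_const eps \<longleftrightarrow> 0 < eps \<and> eps \<le> 1 \<and>
    (\<forall>i\<in>Idx. \<forall>j\<in>Idx. \<forall>x\<in>gaps i j. x < eps / real k \<longrightarrow> x \<le> 0)"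

lemma gap_const_exists: "\<exists>eps. gap_const eps"
proof -
  have "finite (\<Union>i\<in>Idx. \<Union>j\<in>Idx. gaps i j)" by (simp add: gaps_def)
  from finite_pos_gap[OF this] obtain e where e: "e > 0" "\<forall>x\<in>(\<Union>i\<in>Idx. \<Union>j\<in>Idx. gaps i j). 0 < x \<longrightarrow> e < x" by blast
  define eps where "eps = min 1 e"
  have "eps * 1 \<le> eps * real k" using e(1) k_gt1 by (intro mult_left_mono) (simp_all add: eps_def)
  hence "eps / real k \<le> eps" using k_pos by (simp add: pos_divide_le_eq)
  hence k: "eps / real k \<le> e" by (simp add: eps_def)
  have "x \<le> 0" if "i \<in> Idx" "j \<in> Idx" "x \<in> gaps i j" "x < eps / real k" for i j x
  proof (rule ccontr)
    assume "\<not> x \<le> 0"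
    moreover have "x \<in> (\<Union>i\<in>Idx. \<Union>j\<in>Idx. gaps i j)" using that(1,2,3) by blast
    ultimately have "e < x" using e(2) by (meson not_le)
    thus False using that(4) k by linarith
  qed
  hence "gap_const eps" unfolding gap_const_def using e(1) by (simp add: eps_def)
  thus ?thesis by blast
qed

lemma gap_constD:
  assumes "gap_const eps" "i \<in> Idx" "j \<in> Idx"
  shows "fst (c i) < eps / real k \<Longrightarrow> fst (c i) = 0"
    "snd (c i) < eps / real k \<Longrightarrow> snd (c i) = 0"
    "1 - 1 / real k - fst (c i) < eps / real k \<Longrightarrow> fst (c i) = 1 - 1 / real k"
    "1 - 1 / real k - snd (c i) < eps / real k \<Longrightarrow> snd (c i) = 1 - 1 / real k"
    "\<bar>fst (c i) - fst (c j)\<bar> - 1 / real k < eps / real k \<Longrightarrow> \<bar>fst (c i) - fst (c j)\<bar> \<le> 1 / real k"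
    "\<bar>snd (c i) - snd (c j)\<bar> - 1 / real k < eps / real k \<Longrightarrow> \<bar>snd (c i) - snd (c j)\<bar> \<le> 1 / real k"
proof -
  have h: "x \<le> 0" if "x \<in> gaps i j" "x < eps / real k" for x
    using assms that unfolding gap_const_def by blast
  note r = idx_range[OF assms(2)]
  show "fst (c i) < eps / real k \<Longrightarrow> fst (c i) = 0" using h[of "fst (c i)"] r by (simp add: gaps_def)
  show "snd (c i) < eps / real k \<Longrightarrow> snd (c i) = 0" using h[of "snd (c i)"] r by (simp add: gaps_def)
  show "1 - 1 / real k - fst (c i) < eps / real k \<Longrightarrow> fst (c i) = 1 - 1 / real k"
    using h[of "1 - 1 / real k - fst (c i)"] r by (simp add: gaps_def)
  show "1 - 1 / real k - snd (c i) < eps / real k \<Longrightarrow> snd (c i) = 1 - 1 / real k"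
    using h[of "1 - 1 / real k - snd (c i)"] r by (simp add: gaps_def)
  show "\<bar>fst (c i) - fst (c j)\<bar> - 1 / real k < eps / real k \<Longrightarrow> \<bar>fst (c i) - fst (c j)\<bar> \<le> 1 / real k"
    using h[of "\<bar>fst (c i) - fst (c j)\<bar> - 1 / real k"] by (simp add: gaps_def)
  show "\<bar>snd (c i) - snd (c j)\<bar> - 1 / real k < eps / real k \<Longrightarrow> \<bar>snd (c i) - snd (c j)\<bar> \<le> 1 / real k"
    using h[of "\<bar>snd (c i) - snd (c j)\<bar> - 1 / real k"] by (simp add: gaps_def)
qed

section \<open>Near squares and their parents\<close>

lemma pos_snoc:
  assumes "P \<in> W n"
  shows "px (P @ [i]) = px P + sd n * fst (c i)" "py (P @ [i]) = py P + sd n * snd (c i)"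
  using W_length[OF assms] by (simp_all add: px_append py_append mult.commute)

lemma snoc_W: "P \<in> W n \<Longrightarrow> i \<in> Idx \<Longrightarrow> P @ [i] \<in> W (Suc n)"
  using W_append[of P n "[i]" 1] by (simp add: W_def)

lemma snocE:
  assumes "w \<in> W (Suc n)" obtains P i where "w = P @ [i]" "P \<in> W n" "i \<in> Idx"
proof -
  have "w \<in> W (n + 1)" using assms by simp
  then obtain u v where "w = u @ v" "u \<in> W n" "v \<in> W 1" by (rule W_appendE)
  thus ?thesis using that unfolding W_1 by blast
qed

lemma scaled_less: "sd n * x < (1 + eps) * sd (Suc n) \<Longrightarrow> x < 1 / real k + eps / real k"
proof -
  assume "sd n * x < (1 + eps) * sd (Suc n)"
  also have "(1 + eps) * sd (Suc n) = sd n * (1 / real k + eps / real k)"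
    by (simp add: sd_Suc add_divide_distrib distrib_right distrib_left)
  finally show ?thesis by simp
qed

text \<open>Relative to the parents' side, the distances of the two children from the line between
  the parents add up to less than \<open>eps / real k\<close>. Hence both vanish by the choice of
  \<open>eps\<close>.\<close>

lemma vertical_children:
  assumes eps: "gap_const eps" and P: "P \<in> W n" "P' \<in> W n" "py P' = py P + sd n" and ij: "i \<in> Idx" "j \<in> Idx"
    and nr: "near (Suc n) eps (P @ [i]) (P' @ [j])"
  shows "snd (c i) = 1 - 1 / real k" "snd (c j) = 0" "py (P' @ [j]) = py (P @ [i]) + sd (Suc n)"
proof -
  have "sd n * (1 + snd (c j) - snd (c i)) < (1 + eps) * sd (Suc n)"
  proof -
    have "sd n * (1 + snd (c j) - snd (c i)) = py (P' @ [j]) - py (P @ [i])"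
      unfolding pos_snoc[OF P(1)] pos_snoc[OF P(2)] P(3) by (simp add: algebra_simps)
    also have "\<dots> \<le> \<bar>py (P @ [i]) - py (P' @ [j])\<bar>" by linarith
    also have "\<dots> < (1 + eps) * sd (Suc n)" using nr unfolding near_def by blast
    finally show ?thesis .
  qed
  from scaled_less[OF this] have l: "snd (c j) + (1 - 1 / real k - snd (c i)) < eps / real k" by simp
  note r = idx_range[OF ij(1)] idx_range[OF ij(2)]
  have "snd (c j) < eps / real k" "1 - 1 / real k - snd (c i) < eps / real k" using l r by linarith+
  thus i: "snd (c i) = 1 - 1 / real k" and j: "snd (c j) = 0" using gap_constD[OF eps] ij by blast+
  show "py (P' @ [j]) = py (P @ [i]) + sd (Suc n)"
    unfolding pos_snoc[OF P(1)] pos_snoc[OF P(2)] P(3) i j by (simp add: sd_Suc algebra_simps)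
qed

text \<open>Both children lie in aligned rows along the common line. If the left one is not in the
  last column it has a right neighbour, and if the right one is not in the first column it has a
  left neighbour. Last against first column leaves no gap, because the parents touch.\<close>

lemma flat_children_touch:
  assumes eps: "gap_const eps" and P: "P \<in> W n" "P' \<in> W n" "py P' = py P + sd n" "touch P P'" and ij: "i \<in> Idx" "j \<in> Idx"
    and nr: "near (Suc n) eps (P @ [i]) (P' @ [j])" and le: "px (P @ [i]) \<le> px (P' @ [j])"
  shows "touch (P @ [i]) (P' @ [j]) \<or> flat (Suc n) (P @ [i]) (P' @ [j])"
proof -
  note v = vertical_children[OF eps P(1,2,3) ij nr]
  note p = pos_snoc[OF P(1)] pos_snoc[OF P(2)]
  show ?thesis
  proof (cases "px (P' @ [j]) - px (P @ [i]) \<le> sd (Suc n)")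
    case True
    thus ?thesis using v(3) le W_length[OF snoc_W[OF P(1) ij(1)]] by (simp add: touch_def)
  next
    case False
    obtain a where a: "a < k" "c i = (real a / real k, 1 - 1 / real k)" using row_grid[OF ij(1) v(1)] by blast
    obtain b where b: "b < k" "c j = (real b / real k, 0)" using row_grid[OF ij(2) v(2)] by blast
    have "\<exists>x\<in>W (Suc n). (py x = py (P @ [i]) \<and> px x = px (P @ [i]) + sd (Suc n)) \<or>
       (py x = py (P' @ [j]) \<and> px x = px (P' @ [j]) - sd (Suc n))"
    proof (cases "a + 1 < k")
      case True
      obtain l where l: "l \<in> Idx" "c l = (real (a + 1) / real k, 1 - 1 / real k)" using row_exists[OF True] by blast
      have "py (P @ [l]) = py (P @ [i])" "px (P @ [l]) = px (P @ [i]) + sd (Suc n)"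
        unfolding p pos_snoc[OF P(1)] a(2) l(2) by (simp_all add: sd_Suc add_divide_distrib distrib_left)
      thus ?thesis using snoc_W[OF P(1) l(1)] by blast
    next
      case a': False
      show ?thesis
      proof (cases "b = 0")
        case True
        have "real a + 1 = real k" using a' a(1) by linarith
        hence "fst (c i) = 1 - 1 / real k" using k_pos a(2) by (simp add: field_simps)
        moreover have "fst (c j) = 0" using b(2) True by simp
        ultimately have "px (P' @ [j]) - px (P @ [i]) = px P' - px P - sd n + sd (Suc n)"
          unfolding p by (simp only: sd_Suc) (simp add: algebra_simps)
        moreover have "px P' - px P \<le> sd n" using P(4) W_length[OF P(1)] by (simp add: touch_def abs_le_iff)
        ultimately show ?thesis using False by linarith
      next
        case b': False
        have "b - 1 < k" using b(1) by simp
        then obtain l where l: "l \<in> Idx" "c l = (real (b - 1) / real k, 0)" using row_exists by blast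
        have "real (b - 1) = real b - 1" using b' by simp
        hence "py (P' @ [l]) = py (P' @ [j])" "px (P' @ [l]) = px (P' @ [j]) - sd (Suc n)"
          unfolding pos_snoc[OF P(2)] b(2) l(2) by (simp_all add: sd_Suc diff_divide_distrib right_diff_distrib)
        thus ?thesis using snoc_W[OF P(2) l(1)] by blast
      qed
    qed
    thus ?thesis using v(3) False unfolding flat_def by simp
  qed
qed

text \<open>The parents already have a horizontal gap, so near children are the corners facing each
  other across it, with the same gap. The linking square is a corner child of the parents' linking
  square \<open>X\<close>: top left if \<open>X\<close> is in the row of \<open>P\<close>, bottom
  right if it is in the row of \<open>P'\<close>.\<close>

lemma flat_children_flat:
  assumes eps: "gap_const eps" and P: "P \<in> W n" "P' \<in> W n" "flat n P P'" and ij: "i \<in> Idx" "j \<in> Idx"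
    and nr: "near (Suc n) eps (P @ [i]) (P' @ [j])"
  shows "flat (Suc n) (P @ [i]) (P' @ [j])"
proof -
  have f: "py P' = py P + sd n" "px P + sd n < px P'" using P(3) unfolding flat_def by blast+
  note v = vertical_children[OF eps P(1,2) f(1) ij nr]
  have "px (P' @ [j]) - px (P @ [i]) < (1 + eps) * sd (Suc n)"
    using nr unfolding near_def by (simp add: abs_less_iff)
  moreover have "sd n * (1 + fst (c j) - fst (c i)) < px (P' @ [j]) - px (P @ [i])"
    unfolding pos_snoc[OF P(1)] pos_snoc[OF P(2)] using f(2) by (simp add: algebra_simps)
  ultimately have "sd n * (1 + fst (c j) - fst (c i)) < (1 + eps) * sd (Suc n)" by linarith
  from scaled_less[OF this] have l: "fst (c j) + (1 - 1 / real k - fst (c i)) < eps / real k" by simp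
  note r = idx_range[OF ij(1)] idx_range[OF ij(2)]
  have "fst (c j) < eps / real k" "1 - 1 / real k - fst (c i) < eps / real k" using l r by linarith+
  hence i: "fst (c i) = 1 - 1 / real k" and j: "fst (c j) = 0" using gap_constD[OF eps] ij by blast+
  have w: "px (P @ [i]) = px P + sd n - sd (Suc n)" "py (P @ [i]) = py P + sd n - sd (Suc n)"
    "px (P' @ [j]) = px P'" "py (P' @ [j]) = py P'"
    unfolding pos_snoc[OF P(1)] pos_snoc[OF P(2)] i j v(1,2) by (simp_all add: sd_Suc algebra_simps)
  obtain X where X: "X \<in> W n" "(py X = py P \<and> px X = px P + sd n) \<or> (py X = py P' \<and> px X = px P' - sd n)"
    using P(3) unfolding flat_def by blast
  have k0: "0 < k" "k - 1 < k" using k_ge by simp_all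
  obtain l0 where l0: "l0 \<in> Idx" "c l0 = (real 0 / real k, 1 - 1 / real k)" using row_exists[OF k0(1)] by blast
  obtain l1 where l1: "l1 \<in> Idx" "c l1 = (real (k - 1) / real k, 0)" using row_exists[OF k0(2)] by blast
  have k1: "real (k - 1) / real k = 1 - 1 / real k" using k_ge by (simp add: of_nat_diff diff_divide_distrib)
  have e0: "px (X @ [l0]) = px X" "py (X @ [l0]) = py X + sd n - sd (Suc n)"
    unfolding pos_snoc[OF X(1)] l0(2) by (simp_all add: sd_Suc algebra_simps)
  have e1: "px (X @ [l1]) = px X + sd n - sd (Suc n)" "py (X @ [l1]) = py X"
    unfolding pos_snoc[OF X(1)] l1(2) k1 by (simp_all add: sd_Suc algebra_simps)
  have "\<exists>x\<in>W (Suc n). (py x = py (P @ [i]) \<and> px x = px (P @ [i]) + sd (Suc n)) \<or>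
       (py x = py (P' @ [j]) \<and> px x = px (P' @ [j]) - sd (Suc n))"
    using X(2)
  proof
    assume x: "py X = py P \<and> px X = px P + sd n"
    have "py (X @ [l0]) = py (P @ [i]) \<and> px (X @ [l0]) = px (P @ [i]) + sd (Suc n)"
      unfolding e0 w using x by simp
    thus ?thesis using snoc_W[OF X(1) l0(1)] by blast
  next
    assume x: "py X = py P' \<and> px X = px P' - sd n"
    have "py (X @ [l1]) = py (P' @ [j]) \<and> px (X @ [l1]) = px (P' @ [j]) - sd (Suc n)"
      unfolding e1 w using x by simp
    thus ?thesis using snoc_W[OF X(1) l1(1)] by blast
  qed
  moreover have "px (P @ [i]) + sd (Suc n) < px (P' @ [j])" unfolding w using f(2) by simp
  ultimately show ?thesis using v(3) unfolding flat_def by blast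
qed

text \<open>\<open>side_map\<close> puts \<open>P'\<close> directly above \<open>P\<close>; the
  reflection \<open>hx\<close> preserves heights and can therefore be used to put \<open>w\<close>
  to the left of \<open>v\<close>.\<close>

lemma orient:
  assumes P: "P \<in> W n" "P' \<in> W n" "touch P P'" "P \<noteq> P'" and w: "w \<in> W m" "v \<in> W m"
  shows "\<exists>a b. py (sym8 a b P') = py (sym8 a b P) + sd n \<and> px (sym8 a b w) \<le> px (sym8 a b v)"
proof -
  have "\<bar>px P - px P'\<bar> \<le> sd n" "\<bar>py P - py P'\<bar> \<le> sd n"
    using P(3) W_length[OF P(1)] by (simp_all add: touch_def)
  hence "py P' - py P = sd n \<or> px P' - px P = sd n \<or> px P - px P' = sd n \<or> py P - py P' = sd n"
    using W_sep[OF P(1,2,4)] by linarith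
  hence "\<exists>a. py (side_map a P') = py (side_map a P) + sd n"
  proof (elim disjE)
    assume "py P' - py P = sd n" thus ?thesis using side_map_pos[OF P(1)] side_map_pos[OF P(2)] by (intro exI[of _ 0]) simp
  next
    assume "px P' - px P = sd n" thus ?thesis using side_map_pos[OF P(1)] side_map_pos[OF P(2)] by (intro exI[of _ 1]) simp
  next
    assume "px P - px P' = sd n" thus ?thesis using side_map_pos[OF P(1)] side_map_pos[OF P(2)] by (intro exI[of _ 2]) simp
  next
    assume "py P - py P' = sd n" thus ?thesis using side_map_pos[OF P(1)] side_map_pos[OF P(2)] by (intro exI[of _ 3]) simp
  qed
  then obtain a where a: "py (side_map a P') = py (side_map a P) + sd n" by blast
  show ?thesis
  proof (cases "px (side_map a w) \<le> px (side_map a v)")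
    case True thus ?thesis using a by (intro exI[of _ a] exI[of _ False]) (simp add: sym8_def)
  next
    case False thus ?thesis
      using a hx_pos[OF side_map_W[OF P(1)], of a] hx_pos[OF side_map_W[OF P(2)], of a]
        hx_pos[OF side_map_W[OF w(1)], of a] hx_pos[OF side_map_W[OF w(2)], of a]
      by (intro exI[of _ a] exI[of _ True]) (simp add: sym8_def del: map_map)
  qed
qed

text \<open>Induction on the last letter, since near squares have equal or near parents. Equal
  parents leave only gaps between level-one squares, which \<open>eps\<close> excludes; touching and
  flat parents are treated in the two preceding lemmas on children, after a symmetry.\<close>

lemma near_dichotomy:
  assumes eps: "gap_const eps"
  shows "w \<in> W n \<Longrightarrow> v \<in> W n \<Longrightarrow> near n eps w v \<Longrightarrow> touch w v \<or> (\<exists>a b. flat n (sym8 a b w) (sym8 a b v))"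
proof (induction n arbitrary: w v)
  case 0 thus ?case by (simp add: W_0)
next
  case (Suc n)
  obtain P i where w: "w = P @ [i]" "P \<in> W n" "i \<in> Idx" using Suc.prems(1) by (rule snocE)
  obtain P' j where v: "v = P' @ [j]" "P' \<in> W n" "j \<in> Idx" using Suc.prems(2) by (rule snocE)
  note p = pos_snoc[OF w(2), of i] pos_snoc[OF v(2), of j]
  have nr: "\<bar>px w - px v\<bar> < (1 + eps) * sd (Suc n)" "\<bar>py w - py v\<bar> < (1 + eps) * sd (Suc n)"
    using Suc.prems(3) unfolding near_def by blast+
  show ?case
  proof (cases "P = P'")
    case True
    have "px w - px v = sd n * (fst (c i) - fst (c j))" "py w - py v = sd n * (snd (c i) - snd (c j))"
      unfolding w(1) v(1) p True pos_snoc[OF v(2)] by (simp_all add: right_diff_distrib)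
    hence e: "\<bar>px w - px v\<bar> = sd n * \<bar>fst (c i) - fst (c j)\<bar>" "\<bar>py w - py v\<bar> = sd n * \<bar>snd (c i) - snd (c j)\<bar>"
      by (simp_all add: abs_mult)
    have "\<bar>fst (c i) - fst (c j)\<bar> < 1 / real k + eps / real k" "\<bar>snd (c i) - snd (c j)\<bar> < 1 / real k + eps / real k"
      by (rule scaled_less[of n], use nr e in simp)+
    hence "\<bar>fst (c i) - fst (c j)\<bar> \<le> 1 / real k" "\<bar>snd (c i) - snd (c j)\<bar> \<le> 1 / real k"
      using gap_constD(5,6)[OF eps w(3) v(3)] by linarith+
    hence "\<bar>px w - px v\<bar> \<le> sd n * (1 / real k)" "\<bar>py w - py v\<bar> \<le> sd n * (1 / real k)"
      unfolding e by (intro mult_left_mono; simp)+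
    thus ?thesis using W_length[OF Suc.prems(1)] by (simp add: touch_def sd_Suc)
  next
    case False
    \<comment> \<open>The gap between the parents is at most that between the children, and it is
      smaller still relative to the larger side.\<close>
    have nP: "near n eps P P'"
    proof -
      have b: "\<bar>X\<bar> < (1 + eps) * sd n"
        if "\<bar>X + sd n * (x - y)\<bar> < (1 + eps) * sd (Suc n)" "0 \<le> x" "x + 1 / real k \<le> 1" "0 \<le> y" "y + 1 / real k \<le> 1" for X x y
      proof -
        have "\<bar>sd n * (x - y)\<bar> \<le> sd n * (1 - 1 / real k)"
          unfolding abs_mult using that(2-) by (simp add: abs_le_iff)
        hence "\<bar>X\<bar> < (1 + eps) * sd (Suc n) + sd n * (1 - 1 / real k)" using that(1) by linarith
        also have "\<dots> = (1 + eps / real k) * sd n" by (simp add: sd_Suc algebra_simps add_divide_distrib)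
        also have "\<dots> \<le> (1 + eps) * sd n"
        proof (rule mult_right_mono)
          have "0 < eps" using eps by (simp add: gap_const_def)
          thus "1 + eps / real k \<le> 1 + eps" using k_gt1 by (simp add: divide_le_eq)
        qed simp
        finally show ?thesis .
      qed
      note ri = idx_range[OF w(3)] and rj = idx_range[OF v(3)]
      have "px w - px v = (px P - px P') + sd n * (fst (c i) - fst (c j))"
        "py w - py v = (py P - py P') + sd n * (snd (c i) - snd (c j))"
        unfolding w(1) v(1) p by (simp_all add: algebra_simps)
      thus ?thesis unfolding near_def using b[OF _ ri(1,2) rj(1,2)] b[OF _ ri(3,4) rj(3,4)] nr by simp
    qed
    have children: "\<exists>i'\<in>Idx. \<exists>j'\<in>Idx. sym8 a b w = sym8 a b P @ [i'] \<and> sym8 a b v = sym8 a b P' @ [j']" for a b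
      unfolding w(1) v(1) using sym8_snoc[OF w(3)] sym8_snoc[OF v(3)] by metis
    from Suc.IH[OF w(2) v(2) nP] show ?thesis
    proof
      assume t: "touch P P'"
      obtain a b where ab: "py (sym8 a b P') = py (sym8 a b P) + sd n" "px (sym8 a b w) \<le> px (sym8 a b v)"
        using orient[OF w(2) v(2) t False Suc.prems(1,2)] by blast
      obtain i' j' where ij: "i' \<in> Idx" "j' \<in> Idx" and sw: "sym8 a b w = sym8 a b P @ [i']" "sym8 a b v = sym8 a b P' @ [j']"
        using children[of a b] by blast
      have "touch (sym8 a b w) (sym8 a b v) \<or> flat (Suc n) (sym8 a b w) (sym8 a b v)"
        unfolding sw
      proof (rule flat_children_touch[OF eps sym8_W[OF w(2)] sym8_W[OF v(2)] ab(1) _ ij])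
        show "touch (sym8 a b P) (sym8 a b P')" using sym8_touch[OF w(2) v(2)] t by blast
        show "near (Suc n) eps (sym8 a b P @ [i']) (sym8 a b P' @ [j'])"
          using near_sym8[OF Suc.prems, of a b] unfolding sw .
        show "px (sym8 a b P @ [i']) \<le> px (sym8 a b P' @ [j'])" using ab(2) unfolding sw .
      qed
      thus ?thesis using sym8_touch[OF Suc.prems(1,2)] by blast
    next
      assume "\<exists>a b. flat n (sym8 a b P) (sym8 a b P')"
      then obtain a b where ab: "flat n (sym8 a b P) (sym8 a b P')" by blast
      obtain i' j' where ij: "i' \<in> Idx" "j' \<in> Idx" and sw: "sym8 a b w = sym8 a b P @ [i']" "sym8 a b v = sym8 a b P' @ [j']"
        using children[of a b] by blast
      have "flat (Suc n) (sym8 a b w) (sym8 a b v)"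
        unfolding sw
        by (rule flat_children_flat[OF eps sym8_W[OF w(2)] sym8_W[OF v(2)] ab ij])
          (use near_sym8[OF Suc.prems, of a b] in \<open>simp only: sw\<close>)
      thus ?thesis by blast
    qed
  qed
qed

text \<open>In the flat case the horizontal gap is below \<open>eps * sd n \<le> sd n\<close>, so
  the linking square reaches across it and touches both squares.\<close>

lemma near_nbhd:
  assumes eps: "gap_const eps" and w: "w \<in> W n" "v \<in> W n" and nr: "near n eps w v"
  shows "v \<in> nbhd w"
proof -
  have "\<exists>x\<in>W n. touch w x \<and> touch v x"
    using near_dichotomy[OF eps w nr]
  proof
    assume "touch w v" thus ?thesis using w(2) by (intro bexI[of _ v]) simp_all
  next
    assume "\<exists>a b. flat n (sym8 a b w) (sym8 a b v)"
    then obtain a b where f: "flat n (sym8 a b w) (sym8 a b v)" by blast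
    have W: "sym8 a b w \<in> W n" "sym8 a b v \<in> W n" using sym8_W w by blast+
    obtain x where x: "x \<in> W n" "(py x = py (sym8 a b w) \<and> px x = px (sym8 a b w) + sd n) \<or>
        (py x = py (sym8 a b v) \<and> px x = px (sym8 a b v) - sd n)"
      using f unfolding flat_def by blast
    have y: "py (sym8 a b v) = py (sym8 a b w) + sd n" "px (sym8 a b w) + sd n < px (sym8 a b v)"
      using f unfolding flat_def by blast+
    have "px (sym8 a b v) - px (sym8 a b w) < (1 + eps) * sd n"
      using near_sym8[OF w nr, of a b] unfolding near_def by (simp add: abs_less_iff)
    also have "\<dots> \<le> 2 * sd n" using eps by (intro mult_right_mono) (simp_all add: gap_const_def)
    finally have z: "px (sym8 a b v) - px (sym8 a b w) < 2 * sd n" .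
    have t: "touch (sym8 a b w) x" "touch (sym8 a b v) x"
      unfolding touch_def W_length[OF W(1)] W_length[OF W(2)] using x(2) y z sd_pos[of n] by auto
    obtain x' where x': "x' \<in> W n" "x = sym8 a b x'" by (rule sym8_surj[OF x(1)])
    have "touch w x'" "touch v x'"
      using t sym8_touch[OF w(1) x'(1)] sym8_touch[OF w(2) x'(1)] unfolding x'(2) by blast+
    thus ?thesis using x'(1) by blast
  qed
  thus ?thesis unfolding nbhd_eq[OF w(1)] using w(2) by blast
qed

lemma nbhd_distance:
  assumes eps: "gap_const eps" and w: "w \<in> W n" "v \<in> W n" "v \<notin> nbhd w" and p: "p \<in> sq w" "q \<in> sq v"
  shows "eps * sd n \<le> dinf p q"
proof (rule ccontr)
  assume "\<not> ?thesis"
  hence d: "\<bar>fst p - fst q\<bar> < eps * sd n" "\<bar>snd p - snd q\<bar> < eps * sd n" by (simp_all add: dinf_def)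
  have "px w \<le> fst p" "fst p \<le> px w + sd n" "py w \<le> snd p" "snd p \<le> py w + sd n"
    "px v \<le> fst q" "fst q \<le> px v + sd n" "py v \<le> snd q" "snd q \<le> py v + sd n"
    using p W_length[OF w(1)] W_length[OF w(2)] by (auto simp: sq_def)
  hence "near n eps w v" using d unfolding near_def distrib_right by linarith
  thus False using near_nbhd[OF eps w(1,2)] w(3) by blast
qed

subsection \<open>Cutoff functions and the lower bound for the resistance\<close>

text \<open>After its last visit to \<open>w\<close> and before it first leaves
  \<open>nbhd w\<close>, the path stays in \<open>nbhd w - {w}\<close>. This stretch runs from a
  point of \<open>w\<close> to a point of a tile outside \<open>nbhd w\<close>, which are at least
  \<open>eps * sd n\<close> apart by \<open>nbhd_distance\<close>; the factor \<open>1 / eps\<close>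
  in the weight compensates for \<open>eps\<close>.\<close>

lemma separating_path:
  assumes eps: "gap_const eps" and F: "full m wt'" and w: "w \<in> W n"
    and nn: "\<And>v. 0 \<le> wt v" and ge: "\<And>v. take n v \<in> nbhd w - {w} \<Longrightarrow> 1 / eps * wt' (drop n v) \<le> wt v"
    and g: "gpath (n + m) vs" and start: "take n (hd vs) = w" and finish: "take n (last vs) \<notin> nbhd w"
  shows "1 \<le> len wt vs"
proof -
  have e0: "0 < eps" using eps by (simp add: gap_const_def)
  have ne: "vs \<noteq> []" using gpath_ne[OF g] .
  have self: "w \<in> nbhd w" unfolding nbhd_eq[OF w] using w touch_refl by blast
  have near_tile: "take n y \<in> nbhd w"
    if xy: "x \<in> W (n + m)" "y \<in> W (n + m)" "touch x y" "take n x = w" for x y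
  proof -
    obtain z where z: "z \<in> sq x" "z \<in> sq y" using xy(3) touch_iffW[OF xy(1,2)] by blast
    have "z \<in> sq (take n x)" "z \<in> sq (take n y)"
      using z tile_sub[OF W_drop[OF xy(1)], of "take n x"] tile_sub[OF W_drop[OF xy(2)], of "take n y"] by auto
    hence "touch w (take n y)" using touchW[OF w W_take[OF xy(2)]] xy(4) by blast
    thus ?thesis unfolding nbhd_eq[OF w] using W_take[OF xy(2)] touch_refl by blast
  qed
  have "\<exists>x\<in>set vs. take n x = w" using start ne by (intro bexI[of _ "hd vs"]) simp_all
  from split_list_last_prop[OF this] obtain as b cs where s1: "vs = as @ b # cs" "take n b = w" "\<forall>z\<in>set cs. take n z \<noteq> w"
    by blast
  have cs: "cs \<noteq> []"
  proof
    assume "cs = []"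
    hence "last vs = b" using s1(1) by simp
    thus False using finish s1(2) self by simp
  qed
  have g1: "gpath (n + m) (b # cs)"
    using g gpath_append_iff[of as "b # cs" "n + m"] unfolding s1(1) by (cases "as = []") simp_all
  have bW: "b \<in> W (n + m)" using gpath_W[OF g1] by simp
  have g2: "gpath (n + m) cs" "touch b (hd cs)" using g1 gpath_append_iff[of "[b]" cs "n + m"] cs by simp_all
  have "last cs = last vs" using s1(1) cs by simp
  hence "\<exists>x\<in>set cs. take n x \<notin> nbhd w" using finish last_in_set[OF cs] by (intro bexI[of _ "last cs"]) simp_all
  from split_list_first_prop[OF this] obtain ds e es where s2: "cs = ds @ e # es" "take n e \<notin> nbhd w"
    "\<forall>z\<in>set ds. \<not> take n z \<notin> nbhd w" by blast
  have eW: "e \<in> W (n + m)" by (rule gpath_W[OF g2(1)]) (simp add: s2(1))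
  \<comment> \<open>A tile touching \<open>w\<close> belongs to \<open>nbhd w\<close>, so the path
    cannot jump from \<open>w\<close> to the outside.\<close>
  have ds: "ds \<noteq> []"
  proof
    assume "ds = []"
    hence "touch b e" using g2(2) s2(1) by simp
    thus False using near_tile[OF bW eW _ s1(2)] s2(2) by blast
  qed
  have g3: "gpath (n + m) ds" "touch (last ds) e"
    using g2(1) gpath_append_iff[of ds "e # es" "n + m"] ds unfolding s2(1) by simp_all
  have hd_ds: "hd cs = hd ds" using ds s2(1) by simp
  have W: "hd ds \<in> W (n + m)" "last ds \<in> W (n + m)" using gpath_hd[OF g3(1)] gpath_last[OF g3(1)] .
  have tiles: "take n z \<in> nbhd w - {w}" if "z \<in> set ds" for z using that s1(3) s2 by auto
  have "touch b (hd ds)" using g2(2) hd_ds by simp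
  then obtain p where p: "p \<in> sq b" "p \<in> sq (hd ds)" using touch_iffW[OF bW W(1)] by blast
  obtain q where q: "q \<in> sq (last ds)" "q \<in> sq e" using g3(2) touch_iffW[OF W(2) eW] by blast
  have n1: "take n (hd ds) \<noteq> take n b" using tiles[of "hd ds"] ds s1(2) by simp
  have n2: "take n (last ds) \<noteq> take n e" using tiles[of "last ds"] ds s2(2) by auto
  have "1 / eps * dinf p q \<le> sd n * len wt ds"
  proof (rule tile_decomposition[OF F _ g3(1) _ p(2) tile_interface[OF W(1) bW n1 p(2,1)] q(1)
        tile_interface[OF W(2) eW n2 q]])
    show "0 \<le> 1 / eps" using e0 by simp
    show "1 / eps * wt' (drop n v) \<le> wt v" if "v \<in> set ds" for v using ge tiles[OF that] by blast
  qed
  moreover have "eps * sd n \<le> dinf p q"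
  proof (rule nbhd_distance[OF eps w W_take[OF eW] s2(2)])
    show "p \<in> sq w" using p(1) tile_sub[OF W_drop[OF bW], of w] s1(2) append_take_drop_id[of n b] by auto
    show "q \<in> sq (take n e)" using q(2) tile_sub[OF W_drop[OF eW], of "take n e"] by auto
  qed
  hence "1 / eps * (eps * sd n) \<le> 1 / eps * dinf p q" using e0 by (intro mult_left_mono) simp_all
  moreover have "1 / eps * (eps * sd n) = sd n * 1" using e0 by simp
  ultimately have "sd n * 1 \<le> sd n * len wt ds" by linarith
  hence "1 \<le> len wt ds" by (rule mult_left_le_imp_le) simp
  moreover have "len wt ds \<le> len wt vs"
    unfolding s1(1) s2(1) using len_nonneg[of as wt] len_nonneg[of es wt] nn[of b] nn[of e] nn by simp
  ultimately show ?thesis by linarith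
qed

section \<open>Cutoff functions from vertex weights\<close>

lemma degree_bound: "v \<in> W n \<Longrightarrow> card {v' \<in> W n. adj v v'} \<le> 9"
proof -
  assume v: "v \<in> W n"
  have "{v' \<in> W n. adj v v'} \<subseteq> {u \<in> W n. \<bar>px u - px v\<bar> \<le> real 1 * sd n \<and> \<bar>py u - py v\<bar> \<le> real 1 * sd n}" (is "_ \<subseteq> ?B")
  proof
    fix u assume "u \<in> {v' \<in> W n. adj v v'}"
    hence u: "u \<in> W n" "touch v u" using adj_iff[OF v] by blast+
    thus "u \<in> ?B"
      using W_length[OF v] by (simp add: touch_def abs_minus_commute)
  qed
  from card_mono[OF _ this] near_card[OF v, of 1] show ?thesis by simp
qed

lemma nbhd_card: "w \<in> W n \<Longrightarrow> card (nbhd w) \<le> 25"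
proof -
  assume w: "w \<in> W n"
  have "nbhd w \<subseteq> {u \<in> W n. \<bar>px u - px w\<bar> \<le> real 2 * sd n \<and> \<bar>py u - py w\<bar> \<le> real 2 * sd n}" (is "_ \<subseteq> ?B")
  proof
    fix u assume "u \<in> nbhd w"
    then obtain x where x: "u \<in> W n" "x \<in> W n" "touch w x" "touch u x" unfolding nbhd_eq[OF w] by blast
    hence "\<bar>px w - px x\<bar> \<le> sd n" "\<bar>py w - py x\<bar> \<le> sd n" "\<bar>px u - px x\<bar> \<le> sd n" "\<bar>py u - py x\<bar> \<le> sd n"
      using W_length[OF w] W_length[OF x(1)] by (simp_all add: touch_def)
    hence "\<bar>px u - px w\<bar> \<le> 2 * sd n" "\<bar>py u - py w\<bar> \<le> 2 * sd n" by linarith+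
    thus "u \<in> ?B" using x(1) by simp
  qed
  from card_mono[OF _ this] near_card[OF w, of 2] show ?thesis by simp
qed

lemma adj_sym: "adj u v \<longleftrightarrow> adj v u" by (auto simp: adj_def)

text \<open>Each edge is charged to its two end points. By symmetry of \<open>adj\<close> a vertex
  is charged once per neighbour, hence at most 9 times.\<close>

lemma energy_le_mass:
  assumes "\<And>u v. u \<in> W n \<Longrightarrow> v \<in> W n \<Longrightarrow> adj u v \<Longrightarrow> (g u - g v)\<^sup>2 \<le> (wt u)\<^sup>2 + (wt v)\<^sup>2"
  shows "energy (W n) g \<le> 9 * mass n wt"
proof -
  let ?S = "Sigma (W n) (\<lambda>u. {v \<in> W n. adj u v})"
  have fin: "finite ?S" by (intro finite_SigmaI) simp_all
  have deg: "(\<Sum>(u, v)\<in>?S. (wt u)\<^sup>2) \<le> 9 * mass n wt"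
  proof -
    have "(\<Sum>(u, v)\<in>?S. (wt u)\<^sup>2) = (\<Sum>u\<in>W n. \<Sum>v | v \<in> W n \<and> adj u v. (wt u)\<^sup>2)"
      by (subst sum.Sigma) simp_all
    also have "\<dots> = (\<Sum>u\<in>W n. real (card {v \<in> W n. adj u v}) * (wt u)\<^sup>2)" by simp
    also have "\<dots> \<le> (\<Sum>u\<in>W n. 9 * (wt u)\<^sup>2)"
      by (intro sum_mono mult_right_mono) (use degree_bound in force)+
    finally show ?thesis by (simp add: mass_def sum_distrib_left)
  qed
  have swap: "(\<Sum>(u, v)\<in>?S. (wt v)\<^sup>2) = (\<Sum>(u, v)\<in>?S. (wt u)\<^sup>2)"
    by (rule sum.reindex_bij_witness[of _ prod.swap prod.swap]) (auto simp: adj_sym)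
  have "{(u, v). u \<in> W n \<and> v \<in> W n \<and> adj u v} = ?S" by blast
  hence "energy (W n) g = 1 / 2 * (\<Sum>(u, v)\<in>?S. (g u - g v)\<^sup>2)" unfolding energy_def by simp
  also have "\<dots> \<le> 1 / 2 * (\<Sum>(u, v)\<in>?S. (wt u)\<^sup>2 + (wt v)\<^sup>2)"
    by (intro mult_left_mono sum_mono) (use assms in auto)
  also have "(\<Sum>(u, v)\<in>?S. (wt u)\<^sup>2 + (wt v)\<^sup>2) = (\<Sum>(u, v)\<in>?S. (wt u)\<^sup>2) + (\<Sum>(u, v)\<in>?S. (wt v)\<^sup>2)"
    by (simp add: split_beta sum.distrib)
  finally show ?thesis using deg swap by simp
qed

text \<open>The truncated distance from the tiles satisfying \<open>P\<close>, with respect to the vertex weights, is a cutoff function.\<close>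

lemma cutoff_exists:
  assumes nn: "\<And>v. 0 \<le> wt v" and zero: "\<And>v. v \<in> W M \<Longrightarrow> P v \<Longrightarrow> wt v = 0"
    and far: "\<And>vs. gpath M vs \<Longrightarrow> P (hd vs) \<Longrightarrow> B (last vs) \<Longrightarrow> 1 \<le> len wt vs"
  shows "\<exists>g. (\<forall>v\<in>W M. P v \<longrightarrow> g v = 0) \<and> (\<forall>v\<in>W M. B v \<longrightarrow> g v = 1) \<and> energy (W M) g \<le> 9 * mass M wt"
proof -
  \<comment> \<open>Inserting 1 truncates the distance and keeps the infimum over a nonempty set
    when no path exists.\<close>
  define D where "D u = insert 1 {len wt vs | vs. gpath M vs \<and> P (hd vs) \<and> last vs = u}" for u
  define g where "g u = Inf (D u)" for u
  have low: "0 \<le> x" if "x \<in> D u" for x u using that len_nonneg nn unfolding D_def by auto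
  have bdd: "bdd_below (D u)" for u using low by (intro bdd_belowI[of _ 0]) blast
  have ne: "D u \<noteq> {}" for u by (simp add: D_def)
  have g0: "0 \<le> g u" for u unfolding g_def by (rule cInf_greatest[OF ne low])
  have g1: "g u \<le> 1" for u unfolding g_def by (rule cInf_lower[OF _ bdd]) (simp add: D_def)
  have A: "g v = 0" if "v \<in> W M" "P v" for v
  proof -
    have "len wt [v] \<in> D v" unfolding D_def using gpath_single[OF that(1)] that(2) by (intro insertI2) force
    hence "0 \<in> D v" using zero[OF that] by simp
    hence "g v \<le> 0" unfolding g_def by (rule cInf_lower[OF _ bdd])
    thus ?thesis using g0[of v] by simp
  qed
  have Bv: "g v = 1" if "B v" for v
  proof -
    have "1 \<le> x" if "x \<in> D v" for x using that far \<open>B v\<close> unfolding D_def by blast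
    hence "1 \<le> g v" unfolding g_def by (intro cInf_greatest[OF ne])
    thus ?thesis using g1[of v] by simp
  qed
  have step: "g v \<le> g u + wt v" if "u \<in> W M" "v \<in> W M" "touch u v" for u v
  proof -
    have "g v - wt v \<le> x" if "x \<in> D u" for x
    proof (cases "x = 1")
      case True thus ?thesis using g1[of v] nn[of v] by simp
    next
      case False
      then obtain vs where vs: "x = len wt vs" "gpath M vs" "P (hd vs)" "last vs = u"
        using \<open>x \<in> D u\<close> unfolding D_def by blast
      have n: "vs \<noteq> []" using gpath_ne[OF vs(2)] .
      have "gpath M (vs @ [v])"
        using gpath_append_iff[of vs "[v]" M] n vs(2,4) gpath_single[OF \<open>v \<in> W M\<close>] \<open>touch u v\<close> by simp
      moreover have "P (hd (vs @ [v]))" "last (vs @ [v]) = v" using vs(3) n by simp_all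
      ultimately have "len wt (vs @ [v]) \<in> D v" unfolding D_def by blast
      hence "g v \<le> len wt (vs @ [v])" unfolding g_def by (rule cInf_lower[OF _ bdd])
      thus ?thesis using vs(1) by simp
    qed
    hence "g v - wt v \<le> g u" unfolding g_def[of u] by (intro cInf_greatest[OF ne])
    thus ?thesis by simp
  qed
  have "energy (W M) g \<le> 9 * mass M wt"
  proof (rule energy_le_mass)
    fix u v assume uv: "u \<in> W M" "v \<in> W M" "adj u v"
    have t: "touch u v" "touch v u" using uv(3) adj_iff[OF uv(1,2)] touch_symW[OF uv(1,2)] by blast+
    have "\<bar>g u - g v\<bar> \<le> max (wt u) (wt v)" using step[OF uv(1,2) t(1)] step[OF uv(2,1) t(2)] by linarith
    hence "\<bar>g u - g v\<bar>\<^sup>2 \<le> (max (wt u) (wt v))\<^sup>2" by (rule power_mono) simp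
    also have "\<dots> \<le> (wt u)\<^sup>2 + (wt v)\<^sup>2" by (cases "wt u \<le> wt v") (simp_all add: max_def)
    finally show "(g u - g v)\<^sup>2 \<le> (wt u)\<^sup>2 + (wt v)\<^sup>2" by simp
  qed
  thus ?thesis using A Bv by blast
qed

text \<open>Also covers the degenerate values: an empty \<open>B\<close> means infinite resistance,
  and a competitor of energy zero has inverse energy infinity.\<close>

lemma inverse_le_resistance:
  assumes "\<And>v. v \<in> A \<Longrightarrow> g v = 0" "\<And>v. v \<in> B \<Longrightarrow> g v = 1" "energy (W n) g \<le> x"
  shows "inverse (ennreal x) \<le> resistance n A B"
proof (cases "B = {}")
  case False
  have "inverse (ennreal x) \<le> inverse (ennreal (energy (W n) g))"
  proof (cases "energy (W n) g \<le> 0")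
    case True
    thus ?thesis by (simp add: ennreal_neg)
  next
    case False
    thus ?thesis using assms(3) by (simp add: inverse_ennreal le_imp_inverse_le)
  qed
  also have "\<dots> \<le> resistance n A B"
    unfolding resistance_def using False assms(1,2) by (auto intro!: Sup_upper)
  finally show ?thesis .
qed (simp add: resistance_def)

section \<open>Comparison of both sides with the modulus\<close>

lemma R_lower_bound: "\<exists>C>0. \<forall>m. inverse (ennreal (C * Q m)) \<le> R m"
proof -
  obtain eps where eps: "gap_const eps" using gap_const_exists by blast
  have e0: "0 < eps" using eps by (simp add: gap_const_def)
  obtain C where C: "C > 0" "\<And>m. \<exists>wt. full m wt \<and> mass m wt \<le> C * Q m" using full_exists by blast
  \<comment> \<open>\<open>225 = 9 * 25\<close>: the degree bound times the number of tiles in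
    \<open>nbhd w\<close>.\<close>
  define C' where "C' = 225 * (1 / eps)\<^sup>2 * C"
  have "inverse (ennreal (C' * Q m)) \<le> resistance (length w + m) ({w} \<cdot> W m) ((W (length w) - nbhd w) \<cdot> W m)"
    if "w \<in> W n" for w m n
  proof -
    note len_w = W_length[OF that]
    obtain wt' where w': "full m wt'" "mass m wt' \<le> C * Q m" using C(2) by blast
    define wt where "wt v = (if take n v \<in> nbhd w - {w} then 1 / eps * wt' (drop n v) else 0)" for v
    have nn: "0 \<le> wt v" for v using full_nonneg[OF w'(1)] e0 by (simp add: wt_def)
    have "mass (n + m) wt \<le> real 25 * ((1 / eps)\<^sup>2 * mass m wt')"
      unfolding wt_def
    proof (rule mass_select)
      have "{t \<in> W n. t \<in> nbhd w - {w}} \<subseteq> nbhd w" by blast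
      moreover have "finite (nbhd w)" unfolding nbhd_eq[OF that] by simp
      ultimately show "card {t \<in> W n. t \<in> nbhd w - {w}} \<le> 25"
        using card_mono nbhd_card[OF that] le_trans by blast
      fix t assume "t \<in> W n"
      thus "mass m (\<lambda>u. 1 / eps * wt' (drop n (t @ u))) = (1 / eps)\<^sup>2 * mass m wt'"
        using W_length[of t n] mass_scale[of m "1 / eps" wt'] by simp
    qed (simp add: mass_nonneg)
    also have "\<dots> \<le> real 25 * ((1 / eps)\<^sup>2 * (C * Q m))" using w'(2) by (intro mult_left_mono) simp_all
    finally have mass: "9 * mass (n + m) wt \<le> C' * Q m" by (simp add: C'_def mult_ac)
    have ex: "\<exists>g. (\<forall>v\<in>W (n + m). take n v = w \<longrightarrow> g v = 0) \<and> (\<forall>v\<in>W (n + m). take n v \<notin> nbhd w \<longrightarrow> g v = 1) \<and>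
        energy (W (n + m)) g \<le> 9 * mass (n + m) wt"
    proof (rule cutoff_exists[where P = "\<lambda>v. take n v = w" and B = "\<lambda>v. take n v \<notin> nbhd w", OF nn])
      show "wt v = 0" if "take n v = w" for v using that by (simp add: wt_def)
      fix vs assume vs: "gpath (n + m) vs" "take n (hd vs) = w" "take n (last vs) \<notin> nbhd w"
      show "1 \<le> len wt vs"
        by (rule separating_path[OF eps w'(1) that nn _ vs]) (simp add: wt_def)
    qed
    then obtain g where g: "\<forall>v\<in>W (n + m). take n v = w \<longrightarrow> g v = 0" "\<forall>v\<in>W (n + m). take n v \<notin> nbhd w \<longrightarrow> g v = 1"
        "energy (W (n + m)) g \<le> 9 * mass (n + m) wt" by blast
    show ?thesis
      unfolding len_w
    proof (rule inverse_le_resistance)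
      show "energy (W (n + m)) g \<le> C' * Q m" using g(3) mass by linarith
      fix v assume "v \<in> {w} \<cdot> W m"
      then obtain u where u: "u \<in> W m" "v = w @ u" unfolding cat_single by blast
      thus "g v = 0" using g(1) W_append[OF that u(1)] len_w by simp
    next
      fix v assume "v \<in> (W n - nbhd w) \<cdot> W m"
      then obtain t u where u: "t \<in> W n" "t \<notin> nbhd w" "u \<in> W m" "v = t @ u" unfolding cat_def by blast
      thus "g v = 1" using g(2) W_append[OF u(1,3)] W_length[OF u(1)] by simp
    qed
  qed
  hence "\<forall>m. inverse (ennreal (C' * Q m)) \<le> R m"
    unfolding R_def W_star_def by (blast intro: INF_greatest)
  moreover have "0 < C'" using C(1) e0 by (simp add: C'_def)
  ultimately show ?thesis by blast
qed

lemma sigma_upper_bound: "\<exists>C>0. \<forall>m. sigma m \<le> ennreal (C * real N ^ m / Q m)"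
proof -
  obtain C where C: "C > 0" "\<forall>m n w w' f. w \<in> W n \<longrightarrow> w' \<in> W n \<longrightarrow> adj w w' \<longrightarrow> energy ({w, w'} \<cdot> W m) f = 1 \<longrightarrow>
     (average ({w} \<cdot> W m) f - average ({w'} \<cdot> W m) f)\<^sup>2 \<le> C / Q m" using oscillation_bound by blast
  have pair: "sigma_pair m w w' \<le> ennreal (C * real N ^ m / Q m)" if "w \<in> W n" "w' \<in> W n" "adj w w'" for m n w w'
    unfolding sigma_pair_def
  proof (rule Sup_least, clarify)
    fix f assume "energy ({w, w'} \<cdot> W m) f = 1"
    hence "(average ({w} \<cdot> W m) f - average ({w'} \<cdot> W m) f)\<^sup>2 \<le> C / Q m" using C(2) that by blast
    hence "real N ^ m * (average ({w} \<cdot> W m) f - average ({w'} \<cdot> W m) f)\<^sup>2 \<le> real N ^ m * (C / Q m)"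
      by (rule mult_left_mono) simp
    thus "ennreal (real N ^ m * (average ({w} \<cdot> W m) f - average ({w'} \<cdot> W m) f)\<^sup>2) \<le> ennreal (C * real N ^ m / Q m)"
      by (intro ennreal_leI) (simp add: mult.commute)
  qed
  have "sigma m \<le> ennreal (C * real N ^ m / Q m)" for m
    unfolding sigma_def by (rule Sup_least) (use pair in blast)
  thus ?thesis using C(1) by blast
qed

lemma sigma_le_R: "\<exists>C>0. \<forall>m. sigma m \<le> ennreal (C * real N ^ m) * R m"
proof -
  obtain C1 where C1: "C1 > 0" "\<And>m. sigma m \<le> ennreal (C1 * real N ^ m / Q m)" using sigma_upper_bound by blast
  obtain C2 where C2: "C2 > 0" "\<And>m. inverse (ennreal (C2 * Q m)) \<le> R m" using R_lower_bound by blast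
  have "sigma m \<le> ennreal (C1 * C2 * real N ^ m) * R m" for m
  proof -
    have pos: "0 < C2 * Q m" using C2(1) Q_pos by simp
    have "ennreal (C1 * real N ^ m / Q m) = ennreal (C1 * C2 * real N ^ m) * ennreal (inverse (C2 * Q m))"
      using pos C1(1) C2(1) Q_pos[of m] by (simp add: ennreal_mult[symmetric] field_simps)
    also have "ennreal (inverse (C2 * Q m)) = inverse (ennreal (C2 * Q m))" using pos by (simp add: inverse_ennreal)
    also have "ennreal (C1 * C2 * real N ^ m) * inverse (ennreal (C2 * Q m)) \<le> ennreal (C1 * C2 * real N ^ m) * R m"
      by (rule mult_left_mono[OF C2(2)]) simp
    finally show ?thesis using C1(2)[of m] by (rule order_trans[rotated])
  qed
  moreover have "0 < C1 * C2" using C1(1) C2(1) by simp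
  ultimately show ?thesis by blast
qed

end

theorem mainTheorem4:
  fixes k N :: nat and c :: "nat \<Rightarrow> real \<times> real" and K :: "(real \<times> real) set"
  assumes "unconstrained_carpet k N c K"
  shows "\<exists>C::real. C > 0 \<and>
    (\<forall>n\<ge>1. unconstrained_carpet.sigma k N c K n
             \<le> ennreal (C * real N ^ n) * unconstrained_carpet.R k N c K n)"
proof -
  interpret unconstrained_carpet k N c K by (rule assms)
  obtain C where "C > 0" "\<forall>m. sigma m \<le> ennreal (C * real N ^ m) * R m" using sigma_le_R by blast
  thus ?thesis by blast
qed

end
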